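(* Let $\mathcal D\subset\mathbb R^d$ be a bounded domain satisfying the standing assumptions in the context, and let $(\tilde X_t,\tilde V_t)_{t\in\mathbb R}$ be the stationary Knudsen stochastic billiard in $\mathcal D$, i.e. $(\tilde X_t,\tilde V_t)$ is uniformly distributed on $\mathcal D\times\mathbb S^{d-1}$ for each $t$. Then the processes $(\tilde X_t,\tilde V_t)_{t\in\mathbb R}$ and $(\tilde X_{-t},-\tilde V_{-t})_{t\in\mathbb R}$ have the same law.
   Context: Notation: $d\ge 2$; $\|\cdot\|$ is the Euclidean norm, $\mathcal B(x,\varepsilon)$ the open ball, $\mathbb S^{d-1}$ the unit sphere, $e=(1,0,\dots,0)$, and $\mathbb S_v=\{w\in\mathbb S^{d-1}:v\cdot w>0\}$. Standing assumptions on the domain: $\mathcal D\subset\mathbb R^d$ is open and connected, and (Lipschitz condition) for every $x\in\partial\mathcal D$ there exist $\varepsilon_x>0$, an affine isometry $\mathfrak I_x:\mathbb R^d\to\mathbb R^d$ with $\mathfrak I_x x=0$ and a Lipschitz function $f_x:\mathbb R^{d-1}\to\mathbb R$ with $f_x(0)=0$ such that $\mathfrak I_x(\mathcal D\cap\mathcal B(x,\varepsilon_x))=\{z\in\mathcal B(0,\varepsilon_x):z^{(d)}>f_x(z^{(1)},\dots,z^{(d-1)})\}$. Moreover there is a relatively open set $\mathcal R\subset\partial\mathcal D$, with $\partial\mathcal D\setminus\mathcal R$ of $(d-1)$-dimensional Hausdorff measure zero, such that $\partial\mathcal D$ has a local $C^1$ parametrization at each point of $\mathcal R$. For $x\in\mathcal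 R$, $\mathbf n(x)$ is the unit normal vector pointing into $\mathcal D$. Knudsen stochastic billiard (cosine reflection law): let $\gamma_d=\big(\int_{\mathbb S_e}u\cdot e\,du\big)^{-1}$ ($du$ surface measure), let $\eta_0,\eta_1,\dots$ be i.i.d. on $\mathbb S_e$ with density $\gamma_d\,e\cdot u$, and let $(U_x,x\in\partial\mathcal D)$ be a measurable family of orthogonal linear operators with $U_xe=\mathbf n(x)$ for $x\in\mathcal R$. For $x\in\mathcal R,u\in\mathbb S_{\mathbf n(x)}$ or $x\in\mathcal D,u\in\mathbb S^{d-1}$ let $\mathsf r_x(u)=\inf\{t>0:x+tu\in\partial\mathcal D\}$ and $\mathsf h_x(u)=x+u\,\mathsf r_x(u)$. Started from $\tilde\xi_0\in\mathcal R$: $\tilde\xi_{n+1}=\mathsf h_{\tilde\xi_n}(U_{\tilde\xi_n}\eta_n)$, $\tau_0=0$, $\tau_n=\sum_{i=0}^{n-1}\mathsf r_{\tilde\xi_i}(U_{\tilde\xi_i}\eta_i)$, and for $t\in[\tau_n,\tau_{n+1})$, $\tilde X_t=\tilde\xi_n+(t-\tau_n)U_{\tilde\xi_n}\eta_n$ and $\tilde V_t=U_{\tilde\xi_n}\eta_n$. Started from $(x_0,v_0)\in\mathcal D\times\mathbb S^{d-1}$: $\tilde X_t=x_0+tv_0$, $\tilde V_t=v_0$ up to time $\mathsf r_{x_0}(v_0)$, after which the process continues as the process just described started from $\mathsf h_{x_0}(v_0)$. The Markov process $(\tilde X_t,\tilde V_t)_{t\ge0}$ has the uniform distribution on $\mathcal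 D\times\mathbb S^{d-1}$ (normalized Lebesgue measure times normalized surface measure) as an invariant measure; its stationary version indexed by $t\in\mathbb R$ is obtained by starting from this uniform distribution at time $-T$ and letting $T\to\infty$ (in law). Equality in law of processes means equality of all finite-dimensional distributions. *)

theory Defs
  imports "HOL-Probability.Probability"
begin

section \<open>Hausdorff null sets and surface measure on the sphere\<close>

text \<open>
  The usual dimensional constant is omitted from the Hausdorff measure, because below only its null
  sets matter. Boundedness of the covering sets has to be required separately, since the library's
  \<open>diameter\<close> is 0 on unbounded sets.
\<close>

definition hausdorff_pre :: "nat \<Rightarrow> real \<Rightarrow> 'a::metric_space set \<Rightarrow> ennreal" where
  "hausdorff_pre s \<delta> A =
     (INF C \<in> {C :: nat \<Rightarrow> 'a set. A \<subseteq> (\<Union>i. C i) \<and> (\<forall>i. bounded (C i) \<and> diameter (C i) \<le> \<delta>)}.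
        \<Sum>i. if C i = {} then 0 else ennreal (diameter (C i) ^ s))"

definition hausdorff_measure :: "nat \<Rightarrow> 'a::metric_space set \<Rightarrow> ennreal" where
  "hausdorff_measure s A = (SUP \<delta> \<in> {0<..}. hausdorff_pre s \<delta> A)"

text \<open>
  Surface measure on the unit sphere, from polar coordinates: the mass of \<open>A\<close> is \<open>d\<close> times the
  volume of the cone of all \<open>r u\<close> with \<open>0 < r < 1\<close> and \<open>u \<in> A\<close>. The underlying space of the
  measure is the sphere itself.
\<close>

definition sphere_measure :: "'a::euclidean_space measure" where
  "sphere_measure =
     scale_measure (of_nat DIM('a))
       (distr (restrict_space lborel (ball 0 1 - {0})) (restrict_space borel (sphere 0 1))
          (\<lambda>x. x /\<^sub>R norm x))"

definition hemisphere :: "'a::euclidean_space \<Rightarrow> 'a set" where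
  "hemisphere v = {w \<in> sphere 0 1. v \<bullet> w > 0}"


section \<open>The domain\<close>

text \<open>
  \<open>\<real>\<^sup>d\<close> with \<open>d \<ge> 2\<close> is written as \<open>'p \<times> real\<close> with \<open>'p\<close> a Euclidean space of
  dimension \<open>d - 1 \<ge> 1\<close>: \<open>fst z\<close> stands for the first \<open>d - 1\<close> coordinates of \<open>z\<close> and \<open>snd z\<close> for
  the last one. The norm on the product type is the Euclidean one.
\<close>

definition affine_isometry :: "('a::euclidean_space \<Rightarrow> 'a) \<Rightarrow> bool" where
  "affine_isometry \<I> \<longleftrightarrow> (\<exists>Q c. orthogonal_transformation Q \<and> (\<forall>y. \<I> y = Q y + c))"

definition lipschitz_domain :: "('p::euclidean_space \<times> real) set \<Rightarrow> bool" where
  "lipschitz_domain D \<longleftrightarrow>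
     (\<forall>x \<in> frontier D. \<exists>\<epsilon>>0. \<exists>\<I> f L.
        affine_isometry \<I> \<and> \<I> x = 0 \<and> L-lipschitz_on UNIV (f :: 'p \<Rightarrow> real) \<and> f 0 = 0 \<and>
        \<I> ` (D \<inter> ball x \<epsilon>) = {z \<in> ball 0 \<epsilon>. snd z > f (fst z)})"

text \<open>
  A local \<open>C\<^sup>1\<close> parametrization of a hypersurface \<open>S\<close>: a homeomorphism from an open subset of
  \<open>\<real>\<^sup>d\<^sup>-\<^sup>1\<close> onto a relatively open part of \<open>S\<close> which is continuously differentiable with
  injective derivative. Without injectivity there would be no tangent space; even
  corners admit \<open>C\<^sup>1\<close> parametrizations with vanishing derivative.
\<close>

definition C1_param ::
  "('p::euclidean_space \<times> real) set \<Rightarrow> 'p set \<Rightarrow> ('p \<Rightarrow> 'p \<times> real) \<Rightarrow> ('p \<Rightarrow> 'p \<Rightarrow>\<^sub>L ('p \<times> real)) \<Rightarrow> bool"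
where
  "C1_param S W \<phi> \<phi>' \<longleftrightarrow>
     open W \<and> openin (top_of_set S) (\<phi> ` W) \<and> (\<exists>\<psi>. homeomorphism W (\<phi> ` W) \<phi> \<psi>) \<and>
     continuous_on W \<phi>' \<and>
     (\<forall>w \<in> W. (\<phi> has_derivative blinfun_apply (\<phi>' w)) (at w) \<and> inj (blinfun_apply (\<phi>' w)))"

definition billiard_domain ::
  "('p::euclidean_space \<times> real) set \<Rightarrow> ('p \<times> real) set \<Rightarrow> bool" where
  "billiard_domain D R \<longleftrightarrow>
     open D \<and> connected D \<and> D \<noteq> {} \<and> lipschitz_domain D \<and>
     openin (top_of_set (frontier D)) R \<and>
     hausdorff_measure DIM('p) (frontier D - R) = 0 \<and>
     (\<forall>x \<in> R. \<exists>W \<phi> \<phi>'. C1_param (frontier D) W \<phi> \<phi>' \<and> x \<in> \<phi> ` W)"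

definition is_inward_normal ::
  "('p::euclidean_space \<times> real) set \<Rightarrow> 'p \<times> real \<Rightarrow> 'p \<times> real \<Rightarrow> bool" where
  "is_inward_normal D x n \<longleftrightarrow>
     norm n = 1 \<and>
     (\<exists>W \<phi> \<phi>' w. C1_param (frontier D) W \<phi> \<phi>' \<and> w \<in> W \<and> \<phi> w = x \<and>
        (\<forall>y. n \<bullet> blinfun_apply (\<phi>' w) y = 0)) \<and>
     (\<exists>\<delta>>0. \<forall>t \<in> {0<..<\<delta>}. x + t *\<^sub>R n \<in> D)"

definition inward_normal ::
  "('p::euclidean_space \<times> real) set \<Rightarrow> 'p \<times> real \<Rightarrow> 'p \<times> real" where
  "inward_normal D x = (THE n. is_inward_normal D x n)"


section \<open>The Knudsen stochastic billiard\<close>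

definition cosine_constant :: "'a::euclidean_space \<Rightarrow> real" where
  "cosine_constant e = inverse (LINT u:hemisphere e|sphere_measure. u \<bullet> e)"

definition cosine_law :: "'a::euclidean_space \<Rightarrow> 'a measure" where
  "cosine_law e =
     density sphere_measure
       (\<lambda>u. ennreal (cosine_constant e * (e \<bullet> u)) * indicator (hemisphere e) u)"

definition reflection_frame ::
  "('p::euclidean_space \<times> real) set \<Rightarrow> ('p \<times> real) set \<Rightarrow> 'p \<times> real \<Rightarrow>
   ('p \<times> real \<Rightarrow> 'p \<times> real \<Rightarrow> 'p \<times> real) \<Rightarrow> bool" where
  "reflection_frame D R e U \<longleftrightarrow>
     (\<forall>x \<in> frontier D. orthogonal_transformation (U x)) \<and>
     (\<forall>v. (\<lambda>x. U x v) \<in> borel_measurable (restrict_space borel (frontier D))) \<and>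
     (\<forall>x \<in> R. U x e = inward_normal D x)"

text \<open>
  In a bounded domain the ray hits the boundary whenever \<open>x \<in> R\<close> and \<open>u\<close> points inwards, or
  \<open>x \<in> D\<close> and \<open>u\<close> is a unit vector. If it does not hit the boundary, the flight time is 0 by
  convention; then \<open>hit_point\<close> maps boundary points to boundary points for every \<open>u\<close>, so that the
  random variables below, which involve \<open>U x\<close> only for boundary points \<open>x\<close>, are measurable
  everywhere and not only almost everywhere.
\<close>

definition flight_time :: "'a::euclidean_space set \<Rightarrow> 'a \<Rightarrow> 'a \<Rightarrow> real" where
  "flight_time D x u =
     (let H = {t. t > 0 \<and> x + t *\<^sub>R u \<in> frontier D} in if H = {} then 0 else Inf H)"

definition hit_point :: "'a::euclidean_space set \<Rightarrow> 'a \<Rightarrow> 'a \<Rightarrow> 'a" where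
  "hit_point D x u = x + flight_time D x u *\<^sub>R u"

primrec billiard_chain ::
  "'a::euclidean_space set \<Rightarrow> ('a \<Rightarrow> 'a \<Rightarrow> 'a) \<Rightarrow> 'a \<Rightarrow> (nat \<Rightarrow> 'a) \<Rightarrow> nat \<Rightarrow> 'a" where
  "billiard_chain D U x \<eta> 0 = x"
| "billiard_chain D U x \<eta> (Suc n) =
     hit_point D (billiard_chain D U x \<eta> n) (U (billiard_chain D U x \<eta> n) (\<eta> n))"

definition reflection_time ::
  "'a::euclidean_space set \<Rightarrow> ('a \<Rightarrow> 'a \<Rightarrow> 'a) \<Rightarrow> 'a \<Rightarrow> (nat \<Rightarrow> 'a) \<Rightarrow> nat \<Rightarrow> real" where
  "reflection_time D U x \<eta> n =
     (\<Sum>i<n. flight_time D (billiard_chain D U x \<eta> i) (U (billiard_chain D U x \<eta> i) (\<eta> i)))"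

text \<open>
  Position and velocity at time \<open>t \<ge> 0\<close>. The index \<open>n\<close> is unique because reflection times are
  nondecreasing; it exists unless infinitely many reflections occur by time \<open>t\<close>, which has
  probability 0.
\<close>

definition billiard_from_boundary ::
  "'a::euclidean_space set \<Rightarrow> ('a \<Rightarrow> 'a \<Rightarrow> 'a) \<Rightarrow> 'a \<Rightarrow> (nat \<Rightarrow> 'a) \<Rightarrow> real \<Rightarrow> 'a \<times> 'a" where
  "billiard_from_boundary D U x \<eta> t =
     (let n = (THE n. reflection_time D U x \<eta> n \<le> t \<and> t < reflection_time D U x \<eta> (Suc n));
          \<xi> = billiard_chain D U x \<eta> n;
          v = U \<xi> (\<eta> n)
      in (\<xi> + (t - reflection_time D U x \<eta> n) *\<^sub>R v, v))"

definition billiard_from_interior ::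
  "'a::euclidean_space set \<Rightarrow> ('a \<Rightarrow> 'a \<Rightarrow> 'a) \<Rightarrow> 'a \<times> 'a \<Rightarrow> (nat \<Rightarrow> 'a) \<Rightarrow> real \<Rightarrow> 'a \<times> 'a" where
  "billiard_from_interior D U = (\<lambda>(x, v) \<eta> t.
     if t < flight_time D x v then (x + t *\<^sub>R v, v)
     else billiard_from_boundary D U (hit_point D x v) \<eta> (t - flight_time D x v))"

text \<open>The underlying space of the following measure is \<open>D\<close> times the unit sphere.\<close>

definition uniform_phase :: "'a::euclidean_space set \<Rightarrow> ('a \<times> 'a) measure" where
  "uniform_phase D =
     uniform_measure (restrict_space lborel D) D \<Otimes>\<^sub>M uniform_measure sphere_measure (sphere 0 1)"

definition billiard_space :: "'a::euclidean_space set \<Rightarrow> 'a \<Rightarrow> (('a \<times> 'a) \<times> (nat \<Rightarrow> 'a)) measure" where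
  "billiard_space D e = uniform_phase D \<Otimes>\<^sub>M (\<Pi>\<^sub>M i\<in>UNIV. cosine_law e)"

definition uniform_start_billiard ::
  "'a::euclidean_space set \<Rightarrow> ('a \<Rightarrow> 'a \<Rightarrow> 'a) \<Rightarrow> real \<Rightarrow> ('a \<times> 'a) \<times> (nat \<Rightarrow> 'a) \<Rightarrow> 'a \<times> 'a" where
  "uniform_start_billiard D U t = (\<lambda>(z, \<eta>). billiard_from_interior D U z \<eta> t)"


section \<open>Finite-dimensional distributions and the stationary version\<close>

definition fdd ::
  "'w measure \<Rightarrow> (real \<Rightarrow> 'w \<Rightarrow> 's::topological_space) \<Rightarrow> real set \<Rightarrow> (real \<Rightarrow> 's) measure" where
  "fdd M Z J = distr M (\<Pi>\<^sub>M t\<in>J. borel) (\<lambda>\<omega>. \<lambda>t\<in>J. Z t \<omega>)"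

definition same_law ::
  "'w measure \<Rightarrow> (real \<Rightarrow> 'w \<Rightarrow> 's::topological_space) \<Rightarrow>
   'v measure \<Rightarrow> (real \<Rightarrow> 'v \<Rightarrow> 's) \<Rightarrow> bool" where
  "same_law M Z N Y \<longleftrightarrow> (\<forall>J. finite J \<longrightarrow> fdd M Z J = fdd N Y J)"

text \<open>
  The last clause says that the finite-dimensional distributions are the weak limits, as
  \<open>T \<longlongrightarrow> \<infinity>\<close>, of those of the billiard started from the uniform distribution at time
  \<open>-T\<close>, whose state at time \<open>t\<close> is that of the billiard started at time 0, taken at time \<open>t + T\<close>.
  Continuity of \<open>f\<close> refers to the product topology.
\<close>

definition stationary_billiard ::
  "'a::euclidean_space set \<Rightarrow> 'a \<Rightarrow> ('a \<Rightarrow> 'a \<Rightarrow> 'a) \<Rightarrow>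
   'w measure \<Rightarrow> (real \<Rightarrow> 'w \<Rightarrow> 'a \<times> 'a) \<Rightarrow> bool" where
  "stationary_billiard D e U M Z \<longleftrightarrow>
     prob_space M \<and> (\<forall>t. Z t \<in> borel_measurable M) \<and>
     (\<forall>t. distr M borel (Z t) = distr (uniform_phase D) borel (\<lambda>z. z)) \<and>
     (\<forall>J f. finite J \<and> continuous_on UNIV f \<and> bounded (range f) \<longrightarrow>
        ((\<lambda>T. LINT z|fdd (billiard_space D e) (\<lambda>t. uniform_start_billiard D U (t + T)) J. (f z :: real))
           \<longlongrightarrow> (LINT z|fdd M Z J. f z)) at_top)"

end

theory Submission
  imports Defs
begin

text \<open>
  Every phase point \<open>(x, v)\<close> of the domain lies on a chord, given by a boundary point \<open>\<xi>\<close> and the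
  direction \<open>v\<close>. In the coordinates chord and position on the chord, the volume of phase space is
  length times a flux measure on chords (translation invariance and Fubini). Reversing the direction
  of all chords preserves this flux measure because \<open>v \<mapsto> - v\<close> preserves phase volume. Near the
  boundary, which is a Lipschitz graph that is differentiable almost everywhere, a change of variables
  along each direction shows that the flux measure is \<open>|n(\<xi>) \<cdot> v| d\<xi> dv\<close>; hence it is finite, and given
  \<open>\<xi>\<close> the direction follows the cosine law. Consequently the Markov chain of successive chords is in
  detailed balance with the flux measure up to the reversal of chords. Fixing the number of reflections
  in \<open>[0, T]\<close> and substituting \<open>s \<mapsto> total length - T - s\<close> for the starting position turns this into the
  reversibility of the billiard on \<open>[0, T]\<close>. Reversibility for two different horizons gives invariance
  of the uniform distribution under the dynamics, so the distributions whose weak limit defines the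
  stationary process are eventually constant.
\<close>

section \<open>Lebesgue and surface measure under isometries\<close>

text \<open>No surface measure on the boundary is constructed. \<open>flux\<close> is defined from
  phase volume in the interior, so its invariance under chord reversal is immediate; the geometry of
  the boundary serves to show that, given its foot point, a chord has the direction
  \<open>U0\<close> applied to a cosine-distributed vector. This is where the cosine law produces
  reversibility: at a reflection the reversed incoming direction and the outgoing direction are then
  independent with the same conditional law, so they may be exchanged. Two kinds of exceptional
  points must be discarded. Boundary points outside \<open>R\<close>, where no tangent space is
  available, sweep out only a Lebesgue null set along each direction. Paths are right continuous, so
  a path and its reversal disagree at the instants of reflection; for given chords and observation
  times this concerns only countably many starting positions. The number of reflections is fixed
  because reversal is a bijection on finite sequences of chords only. Summing over that number is
  legitimate because almost surely infinitely many chords have infinite total length.\<close>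

lemma pred_ball [measurable]: "Measurable.pred borel (\<lambda>x. x \<in> ball a r)"
  by (simp add: pred_def del: mem_ball)

lemma pred_singleton [measurable]: "Measurable.pred borel (\<lambda>x::'a::t1_space. x \<in> {a})"
  by (simp add: pred_def)

lemma nn_integral_lborel_translate:
  fixes f :: "'a::euclidean_space \<Rightarrow> ennreal"
  assumes [measurable]: "f \<in> borel_measurable borel"
  shows "(\<integral>\<^sup>+x. f (x + a) \<partial>lborel) = (\<integral>\<^sup>+x. f x \<partial>lborel)"
proof -
  have "(\<integral>\<^sup>+x. f x \<partial>lborel) = (\<integral>\<^sup>+x. f x \<partial>distr lborel borel ((+) a))"
    by (simp add: lborel_distr_plus)
  also have "\<dots> = (\<integral>\<^sup>+x. f (x + a) \<partial>lborel)"
    by (subst nn_integral_distr) (auto simp: add.commute)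
  finally show ?thesis ..
qed

lemma nn_integral_lborel_reflect_real:
  fixes f :: "real \<Rightarrow> ennreal"
  assumes [measurable]: "f \<in> borel_measurable borel"
  shows "(\<integral>\<^sup>+s. f (a - s) \<partial>lborel) = (\<integral>\<^sup>+s. f s \<partial>lborel)"
  using nn_integral_real_affine[of f "-1" a] by simp

lemma orthogonal_transformation_borel_measurable:
  fixes Q :: "'a::euclidean_space \<Rightarrow> 'a"
  assumes "orthogonal_transformation Q"
  shows "Q \<in> borel_measurable borel"
  using assms by (intro borel_measurable_continuous_onI linear_continuous_on linear_conv_bounded_linear[THEN iffD1])
    (auto simp: orthogonal_transformation_def)

text \<open>Comparing \<open>lborel\<close> and its image on the product of \<open>A\<close> with the unit ball, by translation
  invariance in each factor, is the usual argument for the uniqueness of Haar measure.\<close>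

lemma lborel_distr_orthogonal:
  fixes Q :: "'a::euclidean_space \<Rightarrow> 'a"
  assumes Q: "orthogonal_transformation Q"
  shows "distr lborel borel Q = lborel"
proof (rule measure_eqI)
  note [measurable] = orthogonal_transformation_borel_measurable[OF Q]
  obtain P where P: "orthogonal_transformation P" "\<And>x. P (Q x) = x" "\<And>x. Q (P x) = x"
    using Q orthogonal_transformation_inv[OF Q] orthogonal_transformation_bij[OF Q]
    by (metis bij_inv_eq_iff)
  note [measurable] = orthogonal_transformation_borel_measurable[OF P(1)]
  have lin: "Q (x + y) = Q x + Q y" for x y
    using Q by (simp add: linear_add orthogonal_transformation_def)
  fix A assume "A \<in> sets (distr lborel borel Q)"
  then have [measurable]: "A \<in> sets borel" by simp
  define B where "B = ball (0::'a) 1"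
  have [measurable]: "B \<in> sets borel" by (simp add: B_def)
  have "emeasure lborel (Q -` A) * emeasure lborel B
      = (\<integral>\<^sup>+y. \<integral>\<^sup>+x. indicator A (Q x) * indicator B y \<partial>lborel \<partial>lborel)"
  proof -
    have [measurable]: "Q -` A \<in> sets borel"
      using measurable_sets[of Q borel borel A] by simp
    have "(\<integral>\<^sup>+x. indicator A (Q x) \<partial>lborel) = (\<integral>\<^sup>+x. indicator (Q -` A) x \<partial>lborel)"
      by (auto intro!: nn_integral_cong simp: indicator_def)
    also have "\<dots> = emeasure lborel (Q -` A)" by simp
    finally have "(\<integral>\<^sup>+x. indicator A (Q x) \<partial>lborel) = emeasure lborel (Q -` A)" .
    then show "emeasure lborel (Q -` A) * emeasure lborel B
      = (\<integral>\<^sup>+y. \<integral>\<^sup>+x. indicator A (Q x) * indicator B y \<partial>lborel \<partial>lborel)"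
      by (simp add: nn_integral_cmult nn_integral_multc)
  qed
  also have "\<dots> = (\<integral>\<^sup>+y. \<integral>\<^sup>+x. indicator A (Q x + y) * indicator B y \<partial>lborel \<partial>lborel)"
  proof (rule nn_integral_cong)
    fix y
    have "(\<integral>\<^sup>+x. indicator A (Q (x + P y)) * indicator B y \<partial>lborel)
        = (\<integral>\<^sup>+x. indicator A (Q x) * indicator B y \<partial>lborel)"
      by (rule nn_integral_lborel_translate[of "\<lambda>x. indicator A (Q x) * indicator B y"]) measurable
    then show "(\<integral>\<^sup>+x. indicator A (Q x) * indicator B y \<partial>lborel)
        = (\<integral>\<^sup>+x. indicator A (Q x + y) * indicator B y \<partial>lborel)"
      by (simp add: lin P)
  qed
  also have "\<dots> = (\<integral>\<^sup>+x. \<integral>\<^sup>+y. indicator A (Q x + y) * indicator B y \<partial>lborel \<partial>lborel)"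
    by (rule lborel_pair.Fubini') measurable
  also have "\<dots> = (\<integral>\<^sup>+x. \<integral>\<^sup>+y. indicator A y * indicator B (y - Q x) \<partial>lborel \<partial>lborel)"
  proof (rule nn_integral_cong)
    fix x
    show "(\<integral>\<^sup>+y. indicator A (Q x + y) * indicator B y \<partial>lborel)
        = (\<integral>\<^sup>+y. indicator A y * indicator B (y - Q x) \<partial>lborel)"
      using nn_integral_lborel_translate[of "\<lambda>y. indicator A y * indicator B (y - Q x)" "Q x"]
      by (simp add: add.commute)
  qed
  also have "\<dots> = (\<integral>\<^sup>+y. \<integral>\<^sup>+x. indicator A y * indicator B (y - Q x) \<partial>lborel \<partial>lborel)"
    by (rule lborel_pair.Fubini') measurable
  also have "\<dots> = (\<integral>\<^sup>+y. indicator A y * emeasure lborel B \<partial>lborel)"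
  proof (rule nn_integral_cong)
    fix y
    have "indicator B (y - Q x) = (indicator (ball (P y) 1) x :: ennreal)" for x
    proof -
      have "norm (y - Q x) = norm (Q (P y - x))"
        using Q by (simp add: P linear_diff orthogonal_transformation_def)
      also have "\<dots> = dist (P y) x"
        by (simp add: orthogonal_transformation_norm[OF Q] dist_norm)
      finally show ?thesis by (simp add: B_def indicator_def)
    qed
    moreover have "emeasure lborel (ball (P y) 1) = emeasure lborel B"
      by (simp add: B_def emeasure_ball)
    ultimately show "(\<integral>\<^sup>+x. indicator A y * indicator B (y - Q x) \<partial>lborel) = indicator A y * emeasure lborel B"
      by (simp add: nn_integral_cmult)
  qed
  also have "\<dots> = emeasure lborel A * emeasure lborel B"
    by (simp add: nn_integral_multc)
  finally have "emeasure lborel (Q -` A) * emeasure lborel B = emeasure lborel A * emeasure lborel B" .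
  moreover have "emeasure lborel B \<noteq> 0" "emeasure lborel B \<noteq> \<infinity>"
    using less_imp_neq[OF unit_ball_vol_pos[of "real DIM('a)", OF of_nat_0_le_iff]]
    by (auto simp: B_def emeasure_ball)
  ultimately have "emeasure lborel (Q -` A) = emeasure lborel A"
    by (auto simp: mult.commute[of _ "emeasure lborel B"] ennreal_mult_cancel_left)
  then show "emeasure (distr lborel borel Q) A = emeasure lborel A"
    by (simp add: emeasure_distr)
qed simp

lemma nn_integral_lborel_orthogonal:
  fixes Q :: "'a::euclidean_space \<Rightarrow> 'a" and f :: "'a \<Rightarrow> ennreal"
  assumes Q: "orthogonal_transformation Q" and [measurable]: "f \<in> borel_measurable borel"
  shows "(\<integral>\<^sup>+x. f (Q x) \<partial>lborel) = (\<integral>\<^sup>+x. f x \<partial>lborel)"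
proof -
  note [measurable] = orthogonal_transformation_borel_measurable[OF Q]
  have "(\<integral>\<^sup>+x. f x \<partial>distr lborel borel Q) = (\<integral>\<^sup>+x. f (Q x) \<partial>lborel)"
    by (subst nn_integral_distr) auto
  then show ?thesis by (simp add: lborel_distr_orthogonal[OF Q])
qed

section \<open>Integration against surface measure on the unit sphere\<close>

lemma space_sphere_measure [simp]: "space sphere_measure = sphere 0 1"
  by (simp add: sphere_measure_def space_scale_measure space_restrict_space)

lemma sets_sphere_measure [simp, measurable_cong]:
  "sets sphere_measure = sets (restrict_space borel (sphere 0 1))"
  by (simp add: sphere_measure_def)

lemma measurable_sphere_measure:
  "f \<in> measurable borel M \<Longrightarrow> f \<in> measurable sphere_measure M"
  by (simp add: measurable_cong_sets[OF sets_sphere_measure refl] measurable_restrict_space1)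

lemma nn_integral_sphere_measure:
  fixes f :: "'a::euclidean_space \<Rightarrow> ennreal"
  assumes [measurable]: "f \<in> borel_measurable borel"
  shows "(\<integral>\<^sup>+u. f u \<partial>sphere_measure)
    = of_nat DIM('a) * (\<integral>\<^sup>+x. f (x /\<^sub>R norm x) * indicator (ball 0 1 - {0}) x \<partial>lborel)"
proof -
  have *: "(\<lambda>x::'a. x /\<^sub>R norm x) \<in> measurable (restrict_space lborel (ball 0 1 - {0})) (restrict_space borel (sphere 0 1))"
    by (rule measurable_restrict_space3) auto
  have **: "f \<in> borel_measurable (distr (restrict_space lborel (ball 0 1 - {0})) (restrict_space borel (sphere 0 1)) (\<lambda>x. x /\<^sub>R norm x))"
    by (simp add: measurable_distr_eq1 measurable_restrict_space1)
  show ?thesis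
    unfolding sphere_measure_def
    by (simp add: nn_integral_scale_measure[OF **] nn_integral_distr[OF * **] nn_integral_restrict_space)
qed

text \<open>Radial projection commutes with \<open>Q\<close>, and \<open>Q\<close> preserves the
  punctured ball, so invariance passes from Lebesgue measure through the cone formula.\<close>

lemma nn_integral_sphere_measure_orthogonal:
  fixes Q :: "'a::euclidean_space \<Rightarrow> 'a" and f :: "'a \<Rightarrow> ennreal"
  assumes Q: "orthogonal_transformation Q" and [measurable]: "f \<in> borel_measurable borel"
  shows "(\<integral>\<^sup>+u. f (Q u) \<partial>sphere_measure) = (\<integral>\<^sup>+u. f u \<partial>sphere_measure)"
proof -
  note [measurable] = orthogonal_transformation_borel_measurable[OF Q]
  let ?g = "\<lambda>x::'a. f (x /\<^sub>R norm x) * indicator (ball 0 1 - {0}) x"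
  have Q': "linear Q" "norm (Q x) = norm x" for x
    using Q by (auto simp: orthogonal_transformation)
  have "f (Q (x /\<^sub>R norm x)) * indicator (ball 0 1 - {0}) x = ?g (Q x)" for x
    using Q'(2)[of x] by (auto simp: indicator_def linear_cmul[OF Q'(1)])
  then have "(\<integral>\<^sup>+x. f (Q (x /\<^sub>R norm x)) * indicator (ball 0 1 - {0}) x \<partial>lborel) = (\<integral>\<^sup>+x. ?g (Q x) \<partial>lborel)"
    by (intro nn_integral_cong)
  also have "\<dots> = (\<integral>\<^sup>+x. ?g x \<partial>lborel)"
    by (rule nn_integral_lborel_orthogonal[OF Q]) measurable
  finally have "(\<integral>\<^sup>+x. f (Q (x /\<^sub>R norm x)) * indicator (ball 0 1 - {0}) x \<partial>lborel) = (\<integral>\<^sup>+x. ?g x \<partial>lborel)" .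
  then show ?thesis
    by (simp add: nn_integral_sphere_measure)
qed

lemma nn_integral_sphere_measure_uminus:
  fixes f :: "'a::euclidean_space \<Rightarrow> ennreal"
  assumes [measurable]: "f \<in> borel_measurable borel"
  shows "(\<integral>\<^sup>+u. f (- u) \<partial>sphere_measure) = (\<integral>\<^sup>+u. f u \<partial>sphere_measure)"
  by (rule nn_integral_sphere_measure_orthogonal) (auto simp: orthogonal_transformation linear_uminus)

lemma finite_measure_sphere_measure: "finite_measure (sphere_measure :: 'a::euclidean_space measure)"
proof
  have "emeasure sphere_measure (space (sphere_measure::'a measure)) = (\<integral>\<^sup>+u. 1 \<partial>(sphere_measure::'a measure))"
    by (subst nn_integral_const) simp
  also have "\<dots> = of_nat DIM('a) * (\<integral>\<^sup>+x. indicator (ball 0 1 - {0}) x \<partial>(lborel::'a measure))"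
    by (subst nn_integral_sphere_measure) auto
  also have "\<dots> \<le> of_nat DIM('a) * emeasure (lborel::'a measure) (ball 0 1)"
    by (intro mult_left_mono) (auto intro!: emeasure_mono)
  also have "\<dots> < \<infinity>"
    by (auto simp: emeasure_ball ennreal_mult_less_top of_nat_less_top)
  finally show "emeasure sphere_measure (space (sphere_measure::'a measure)) \<noteq> \<infinity>" by simp
qed

section \<open>Normalisation and rotation of the cosine law\<close>

lemma cosine_integral_pos_finite:
  fixes e :: "'a::euclidean_space"
  assumes e: "norm e = 1"
  shows "0 < (\<integral>\<^sup>+u. ennreal (max 0 (e \<bullet> u)) \<partial>sphere_measure)"
    and "(\<integral>\<^sup>+u. ennreal (max 0 (e \<bullet> u)) \<partial>sphere_measure) < \<infinity>"
proof -
  interpret finite_measure "sphere_measure :: 'a measure" by (rule finite_measure_sphere_measure)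
  have "(\<integral>\<^sup>+u. ennreal (max 0 (e \<bullet> u)) \<partial>sphere_measure) \<le> (\<integral>\<^sup>+u. 1 \<partial>(sphere_measure :: 'a measure))"
  proof (rule nn_integral_mono)
    fix u :: 'a assume "u \<in> space sphere_measure"
    then have "e \<bullet> u \<le> 1" using norm_cauchy_schwarz[of e u] e by simp
    then show "ennreal (max 0 (e \<bullet> u)) \<le> 1" by (simp add: ennreal_le_1)
  qed
  also have "\<dots> < \<infinity>"
    using emeasure_finite[of "sphere 0 1"] by (simp add: less_top[symmetric])
  finally show "(\<integral>\<^sup>+u. ennreal (max 0 (e \<bullet> u)) \<partial>sphere_measure) < \<infinity>" .
  show "0 < (\<integral>\<^sup>+u. ennreal (max 0 (e \<bullet> u)) \<partial>sphere_measure)"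
  proof (rule ccontr)
    have [measurable]: "(\<lambda>u. ennreal (max 0 (e \<bullet> u))) \<in> borel_measurable borel" by measurable
    assume "\<not> ?thesis"
    then have "(\<integral>\<^sup>+x. ennreal (max 0 (e \<bullet> (x /\<^sub>R norm x))) * indicator (ball 0 1 - {0}) x \<partial>(lborel::'a measure)) = 0"
      by (auto simp: not_gr_zero nn_integral_sphere_measure)
    then have AE0: "AE x::'a in lborel. ennreal (max 0 (e \<bullet> (x /\<^sub>R norm x))) * indicator (ball 0 1 - {0}) x = 0"
      by (subst (asm) nn_integral_0_iff_AE) auto
    \<comment> \<open>If the integral vanished, the integrand in the cone formula would vanish
      almost everywhere in the ball; but it is positive on the open half ball \<open>G\<close>, and
      a nonempty open set is not null.\<close>
    define G where "G = ball (0::'a) 1 \<inter> {x. 0 < e \<bullet> x}"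
    have G: "x \<notin> G" if "ennreal (max 0 (e \<bullet> (x /\<^sub>R norm x))) * indicator (ball 0 1 - {0}) x = 0" for x
      using that by (auto simp: G_def indicator_def max_def mult_le_0_iff not_less zero_le_mult_iff split: if_splits)
    from AE0 have "AE x in lborel. x \<notin> G" by (rule eventually_mono) (rule G)
    moreover have "open G"
      unfolding G_def by (intro open_Int open_ball open_Collect_less continuous_intros)
    ultimately have "emeasure lborel G = 0"
      by (subst (asm) AE_iff_measurable[OF _ refl]) auto
    then have "G = {}"
      using open_not_negligible[OF \<open>open G\<close>] \<open>open G\<close>
      by (auto simp: negligible_iff_null_sets null_sets_completionI null_sets_def)
    moreover have "e /\<^sub>R 2 \<in> G" using e by (simp add: G_def dot_square_norm)
    ultimately show False by simp
  qed
qed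

text \<open>The constant is the inverse of a Bochner integral, so it normalises only because the
  cosine integral is known to be positive and finite.\<close>

lemma cosine_law_constant:
  fixes e :: "'a::euclidean_space"
  assumes e: "norm e = 1"
  shows "cosine_constant e > 0"
    and "ennreal (cosine_constant e) * (\<integral>\<^sup>+u. ennreal (max 0 (e \<bullet> u)) \<partial>sphere_measure) = 1"
proof -
  define I where "I = (\<integral>\<^sup>+u. ennreal (max 0 (e \<bullet> u)) \<partial>(sphere_measure :: 'a measure))"
  have I: "0 < I" "I < \<infinity>" using cosine_integral_pos_finite[OF e] by (auto simp: I_def)
  have "(LINT u:hemisphere e|sphere_measure. u \<bullet> e) = (LINT u|sphere_measure. max 0 (e \<bullet> u))"
    unfolding set_lebesgue_integral_def
    by (intro Bochner_Integration.integral_cong)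
      (auto simp: hemisphere_def indicator_def inner_commute)
  also have "\<dots> = enn2real I"
    unfolding I_def by (intro integral_eq_nn_integral measurable_sphere_measure) auto
  finally have c: "cosine_constant e = inverse (enn2real I)" by (simp add: cosine_constant_def)
  then show "cosine_constant e > 0" using I by (simp add: enn2real_positive_iff)
  have "ennreal (cosine_constant e) * I = ennreal (inverse (enn2real I)) * ennreal (enn2real I)"
    using I by (simp add: c)
  also have "\<dots> = 1" using I enn2real_positive_iff[of I]
    by (subst ennreal_mult[symmetric]) auto
  finally show "ennreal (cosine_constant e) * (\<integral>\<^sup>+u. ennreal (max 0 (e \<bullet> u)) \<partial>sphere_measure) = 1"
    by (simp add: I_def)
qed

lemma space_cosine_law [simp]: "space (cosine_law e) = sphere 0 1"
  by (simp add: cosine_law_def)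

lemma sets_cosine_law [simp, measurable_cong]:
  "sets (cosine_law e) = sets (restrict_space borel (sphere 0 1))"
  by (simp add: cosine_law_def)

lemma measurable_cosine_law:
  "f \<in> measurable borel M \<Longrightarrow> f \<in> measurable (cosine_law e) M"
  by (simp add: measurable_cong_sets[OF sets_cosine_law refl] measurable_restrict_space1)

lemma nn_integral_cosine_law:
  fixes f :: "'a::euclidean_space \<Rightarrow> ennreal"
  assumes e: "norm e = 1" and f [measurable]: "f \<in> borel_measurable borel"
  shows "(\<integral>\<^sup>+u. f u \<partial>cosine_law e)
    = ennreal (cosine_constant e) * (\<integral>\<^sup>+u. ennreal (max 0 (e \<bullet> u)) * f u \<partial>sphere_measure)"
proof -
  have 1: "hemisphere e \<in> sets (restrict_space borel (sphere 0 1))"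
  proof -
    have "hemisphere e = {w. 0 < e \<bullet> w} \<inter> sphere 0 1" by (auto simp: hemisphere_def)
    then show ?thesis by (auto simp: sets_restrict_space_iff)
  qed
  have 2: "(\<lambda>u. ennreal (cosine_constant e * (e \<bullet> u)) * indicator (hemisphere e) u) \<in> borel_measurable sphere_measure"
    using 1 by (intro borel_measurable_times_ennreal borel_measurable_indicator measurable_sphere_measure) auto
  have "(\<integral>\<^sup>+u. f u \<partial>cosine_law e)
      = (\<integral>\<^sup>+u. ennreal (cosine_constant e) * (ennreal (max 0 (e \<bullet> u)) * f u) \<partial>sphere_measure)"
    unfolding cosine_law_def
    by (subst nn_integral_density[OF 2 measurable_sphere_measure[OF f]])
      (use cosine_law_constant(1)[OF e] in \<open>auto intro!: nn_integral_cong
        simp: hemisphere_def indicator_def ennreal_mult' mult.assoc max_def\<close>)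
  also have "\<dots> = ennreal (cosine_constant e) * (\<integral>\<^sup>+u. ennreal (max 0 (e \<bullet> u)) * f u \<partial>sphere_measure)"
    by (intro nn_integral_cmult measurable_sphere_measure) measurable
  finally show ?thesis .
qed

lemma prob_space_cosine_law:
  fixes e :: "'a::euclidean_space"
  assumes e: "norm e = 1"
  shows "prob_space (cosine_law e)"
proof
  have "emeasure (cosine_law e) (space (cosine_law e)) = (\<integral>\<^sup>+u. 1 \<partial>cosine_law e)" by simp
  also have "\<dots> = 1"
    using cosine_law_constant(2)[OF e] by (subst nn_integral_cosine_law[OF e]) simp_all
  finally show "emeasure (cosine_law e) (space (cosine_law e)) = 1" .
qed

text \<open>The left-hand side depends on \<open>Q\<close> only through \<open>Q e\<close>. Hence
  every frame \<open>U x\<close> with \<open>U x e\<close> equal to the normal gives the same law of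
  reflected directions, namely the cosine law about the normal. The factor is the total cosine
  mass.\<close>

lemma nn_integral_sphere_measure_cosine:
  fixes Q :: "'a::euclidean_space \<Rightarrow> 'a" and f :: "'a \<Rightarrow> ennreal"
  assumes e: "norm e = 1" and Q: "orthogonal_transformation Q"
    and [measurable]: "f \<in> borel_measurable borel"
  shows "(\<integral>\<^sup>+u. ennreal (max 0 (Q e \<bullet> u)) * f u \<partial>sphere_measure)
    = ennreal (1 / cosine_constant e) * (\<integral>\<^sup>+u. f (Q u) \<partial>cosine_law e)"
proof -
  note [measurable] = orthogonal_transformation_borel_measurable[OF Q]
  have "(\<integral>\<^sup>+u. ennreal (max 0 (Q e \<bullet> u)) * f u \<partial>sphere_measure)
      = (\<integral>\<^sup>+u. ennreal (max 0 (Q e \<bullet> Q u)) * f (Q u) \<partial>sphere_measure)"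
    by (rule nn_integral_sphere_measure_orthogonal[OF Q, symmetric]) measurable
  also have "\<dots> = (\<integral>\<^sup>+u. ennreal (max 0 (e \<bullet> u)) * f (Q u) \<partial>sphere_measure)"
    using Q by (simp add: orthogonal_transformation_def)
  also have "\<dots> = ennreal (1 / cosine_constant e) * (ennreal (cosine_constant e) *
      (\<integral>\<^sup>+u. ennreal (max 0 (e \<bullet> u)) * f (Q u) \<partial>sphere_measure))"
    using cosine_law_constant(1)[OF e]
    by (simp add: mult.assoc[symmetric] ennreal_mult'[symmetric])
  finally show ?thesis
    by (subst nn_integral_cosine_law[OF e]) auto
qed

text \<open>The substitution rule for absolutely integrable functions is applied to indicators only;
  it then says that two measures agree, and equality of measures extends it to all nonnegative Borel
  functions.\<close>

lemma nn_integral_change_of_variables_real: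
  fixes g h :: "real \<Rightarrow> real" and f :: "real \<Rightarrow> ennreal"
  assumes [measurable]: "S \<in> sets borel" "g \<in> borel_measurable borel" "h \<in> borel_measurable borel"
      "f \<in> borel_measurable borel" "g ` S \<in> sets borel"
    and deriv: "\<And>s. s \<in> S \<Longrightarrow> (g has_real_derivative h s) (at s)"
    and inj: "inj_on g S" and bounded: "bounded (g ` S)"
  shows "(\<integral>\<^sup>+z. indicator (g ` S) z * f z \<partial>lborel)
    = (\<integral>\<^sup>+s. indicator S s * (ennreal \<bar>h s\<bar> * f (g s)) \<partial>lborel)"
proof -
  define M1 where "M1 = density lborel (indicator (g ` S) :: real \<Rightarrow> ennreal)"
  define M2 where "M2 = distr (density lborel (\<lambda>s. indicator S s * ennreal \<bar>h s\<bar>)) borel g"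
  have "M1 = M2"
  proof (rule measure_eqI)
    fix B assume "B \<in> sets M1"
    then have [measurable]: "B \<in> sets borel" by (simp add: M1_def)
    have [measurable]: "g -` B \<in> sets borel"
      using measurable_sets[of g borel borel B] by simp
    let ?f = "indicator B :: real \<Rightarrow> real"
    \<comment> \<open>Boundedness of the image is what makes the indicators absolutely
      integrable.\<close>
    have fin: "g ` S \<inter> B \<in> lmeasurable"
      using bounded by (intro bounded_set_imp_lmeasurable) (auto intro: bounded_subset)
    have "?f absolutely_integrable_on g ` S"
      unfolding set_integrable_def using fin
      by (simp add: indicator_inter_arith[symmetric] integrable_real_indicator fmeasurable_def)
    moreover have eq: "((\<lambda>x. \<bar>h x\<bar> *\<^sub>R ?f (g x)) absolutely_integrable_on S \<and>
         integral S (\<lambda>x. \<bar>h x\<bar> *\<^sub>R ?f (g x)) = b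
          \<longleftrightarrow> ?f absolutely_integrable_on g ` S \<and> integral (g ` S) ?f = b)" for b
      by (rule has_absolute_integral_change_of_variables_real)
        (auto intro: inj deriv has_field_derivative_at_within)
    ultimately have 1: "(\<lambda>x. \<bar>h x\<bar> *\<^sub>R ?f (g x)) absolutely_integrable_on S"
      and 2: "integral S (\<lambda>x. \<bar>h x\<bar> *\<^sub>R ?f (g x)) = integral (g ` S) ?f" by blast+
    have int: "integrable lborel (\<lambda>x. indicator S x * (\<bar>h x\<bar> * ?f (g x)))"
    proof -
      have "integrable lebesgue (\<lambda>x. indicator S x * (\<bar>h x\<bar> * ?f (g x)))"
        using 1 by (simp add: set_integrable_def)
      then show ?thesis by (subst (asm) integrable_completion) auto
    qed
    have "emeasure M2 B = (\<integral>\<^sup>+s. indicator S s * ennreal \<bar>h s\<bar> * indicator B (g s) \<partial>lborel)"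
      unfolding M2_def
      by (auto simp: emeasure_distr emeasure_density indicator_def intro!: nn_integral_cong)
    also have "\<dots> = (\<integral>\<^sup>+s. ennreal (indicator S s * (\<bar>h s\<bar> * ?f (g s))) \<partial>lborel)"
      by (auto intro!: nn_integral_cong simp: indicator_def)
    also have "\<dots> = ennreal (LINT s|lborel. indicator S s * (\<bar>h s\<bar> * ?f (g s)))"
      by (rule nn_integral_eq_integral[OF int]) auto
    also have "(LINT s|lborel. indicator S s * (\<bar>h s\<bar> * ?f (g s))) = integral S (\<lambda>x. \<bar>h x\<bar> *\<^sub>R ?f (g x))"
      using set_lebesgue_integral_eq_integral(2)[OF 1]
      by (simp add: set_lebesgue_integral_def integral_completion)
    also have "\<dots> = measure lebesgue (g ` S \<inter> B)"
      unfolding 2 using integral_indicator[of B "g ` S"] fin by (simp only: Int_commute[of B])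
    also have "ennreal \<dots> = emeasure lebesgue (g ` S \<inter> B)"
      using fin by (intro emeasure_eq_measure2[symmetric])
    also have "\<dots> = emeasure lborel (g ` S \<inter> B)"
      by simp
    also have "\<dots> = emeasure M1 B"
      unfolding M1_def by (simp add: emeasure_density indicator_inter_arith[symmetric])
    finally show "emeasure M1 B = emeasure M2 B" ..
  qed (simp add: M1_def M2_def)
  have "(\<integral>\<^sup>+z. indicator (g ` S) z * f z \<partial>lborel) = (\<integral>\<^sup>+z. f z \<partial>M1)"
    unfolding M1_def by (subst nn_integral_density) auto
  also have "\<dots> = (\<integral>\<^sup>+s. indicator S s * (ennreal \<bar>h s\<bar> * f (g s)) \<partial>lborel)"
    unfolding \<open>M1 = M2\<close> M2_def
    by (subst nn_integral_distr, (auto)[2], subst nn_integral_density) (auto simp: mult.assoc)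
  finally show ?thesis .
qed

section \<open>Chords of a bounded open set\<close>

lemma borel_measurable_fst_snd [measurable (raw)]:
  fixes f :: "'c \<Rightarrow> 'a::second_countable_topology \<times> 'b::second_countable_topology"
  assumes f: "f \<in> borel_measurable M"
  shows "(\<lambda>x. fst (f x)) \<in> borel_measurable M" "(\<lambda>x. snd (f x)) \<in> borel_measurable M"
  using f unfolding borel_prod[symmetric] by measurable

section \<open>Flight times and hit points\<close>

lemma flight_time_nonneg: "flight_time D x u \<ge> 0"
  unfolding flight_time_def Let_def by (auto intro!: cInf_greatest)

lemma flight_time_eqI:
  assumes "r > 0" "x + r *\<^sub>R u \<in> frontier D"
    and "\<And>t. 0 < t \<Longrightarrow> t < r \<Longrightarrow> x + t *\<^sub>R u \<notin> frontier D"
  shows "flight_time D x u = r"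
proof -
  have "Inf {t. t > 0 \<and> x + t *\<^sub>R u \<in> frontier D} = r"
    by (rule cInf_eq_minimum) (use assms in \<open>auto simp: not_less[symmetric]\<close>)
  then show ?thesis
    using assms(1,2) by (auto simp: flight_time_def Let_def)
qed

lemma flight_time_not_frontier:
  assumes "0 < t" "t < flight_time D x u"
  shows "x + t *\<^sub>R u \<notin> frontier D"
proof
  assume *: "x + t *\<^sub>R u \<in> frontier D"
  let ?H = "{t. t > 0 \<and> x + t *\<^sub>R u \<in> frontier D}"
  have "Inf ?H \<le> t"
    by (rule cInf_lower) (use * assms in \<open>auto intro!: bdd_belowI[of _ 0]\<close>)
  moreover have "flight_time D x u = Inf ?H"
    using * assms by (auto simp: flight_time_def Let_def)
  ultimately show False using assms by simp
qed

lemma hit_point_frontier: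
  assumes "t > 0" "x + t *\<^sub>R u \<in> frontier D"
  shows "hit_point D x u \<in> frontier D"
proof -
  let ?H = "{t. t > 0 \<and> x + t *\<^sub>R u \<in> frontier D}"
  have H: "?H \<noteq> {}" "bdd_below ?H"
    using assms by (auto intro!: bdd_belowI[of _ 0])
  then have "Inf ?H \<in> closure ?H" by (rule closure_contains_Inf)
  also have "\<dots> \<subseteq> closure ((\<lambda>t. x + t *\<^sub>R u) -` frontier D)"
    by (rule closure_mono) auto
  also have "\<dots> = (\<lambda>t. x + t *\<^sub>R u) -` frontier D"
    by (intro closure_closed closed_vimage continuous_intros frontier_closed)
  finally show ?thesis
    using H by (auto simp: hit_point_def flight_time_def Let_def)
qed

lemma hit_point_frontier':
  assumes "x \<in> frontier D"
  shows "hit_point D x u \<in> frontier D"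
proof (cases "\<exists>t>0. x + t *\<^sub>R u \<in> frontier D")
  case False
  then show ?thesis using assms by (auto simp: hit_point_def flight_time_def Let_def)
qed (auto intro: hit_point_frontier)

text \<open>Compactness of the time window lets a limiting hitting time be extracted. This
  closedness is the source of the measurability of \<open>flight_time\<close>, which is an infimum
  over uncountably many conditions.\<close>

lemma closed_line_meets:
  fixes F :: "'a::euclidean_space set"
  assumes "closed F"
  shows "closed {z::'a \<times> 'a. \<exists>t\<in>{a..b}. fst z + t *\<^sub>R snd z \<in> F}" (is "closed ?C")
  unfolding closed_sequential_limits
proof (intro allI impI)
  fix X :: "nat \<Rightarrow> 'a \<times> 'a" and l assume "(\<forall>n. X n \<in> ?C) \<and> X \<longlonglongrightarrow> l"
  then have "\<forall>n. \<exists>t. t \<in> {a..b} \<and> fst (X n) + t *\<^sub>R snd (X n) \<in> F" and X: "X \<longlonglongrightarrow> l"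
    by blast+
  then obtain t where t: "\<And>n. t n \<in> {a..b}" "\<And>n. fst (X n) + t n *\<^sub>R snd (X n) \<in> F"
    by metis
  obtain s r where s: "s \<in> {a..b}" "strict_mono (r :: nat \<Rightarrow> nat)" "(t \<circ> r) \<longlonglongrightarrow> s"
    using t(1) compact_Icc[of a b] unfolding compact_def by metis
  have "(X \<circ> r) \<longlonglongrightarrow> l" using X s(2) by (rule LIMSEQ_subseq_LIMSEQ)
  then have "(\<lambda>n. fst ((X \<circ> r) n) + (t \<circ> r) n *\<^sub>R snd ((X \<circ> r) n)) \<longlonglongrightarrow> fst l + s *\<^sub>R snd l"
    by (intro tendsto_intros s(3))
  then have "fst l + s *\<^sub>R snd l \<in> F"
    by (rule closed_sequentially[OF assms, rotated]) (use t in auto)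
  then show "l \<in> ?C" using s(1) by auto
qed

text \<open>A hit at some time strictly between 0 and \<open>a\<close> is a hit within one of
  countably many compact windows, so the event is a countable union of closed sets.\<close>

lemma flight_time_measurable' :
  "(\<lambda>z. flight_time D (fst z) (snd z)) \<in> borel_measurable (borel :: ('a::euclidean_space \<times> 'a) measure)"
proof -
  define H where "H z = {t. t > 0 \<and> fst z + t *\<^sub>R snd z \<in> frontier D}" for z :: "'a \<times> 'a"
  have ft: "flight_time D (fst z) (snd z) = (if H z = {} then 0 else Inf (H z))" for z
    by (simp only: flight_time_def H_def Let_def)
  have 1: "{z. H z \<inter> {..<a} \<noteq> {}} \<in> sets borel" for a
  proof -
    have "{z. H z \<inter> {..<a} \<noteq> {}} = (\<Union>k. {z. \<exists>t\<in>{1/Suc k..a - 1/Suc k}. fst z + t *\<^sub>R snd z \<in> frontier D})"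
    proof (intro set_eqI iffI)
      fix z assume "z \<in> {z. H z \<inter> {..<a} \<noteq> {}}"
      then obtain t where t: "0 < t" "t < a" "fst z + t *\<^sub>R snd z \<in> frontier D" by (auto simp: H_def)
      obtain k where "inverse (of_nat (Suc k)) < min t (a - t)"
        using reals_Archimedean[of "min t (a - t)"] t by auto
      then have "t \<in> {1/Suc k..a - 1/Suc k}" by (auto simp: inverse_eq_divide)
      then show "z \<in> (\<Union>k. {z. \<exists>t\<in>{1/Suc k..a - 1/Suc k}. fst z + t *\<^sub>R snd z \<in> frontier D})"
        using t(3) by blast
    next
      fix z assume "z \<in> (\<Union>k. {z. \<exists>t\<in>{1/Suc k..a - 1/Suc k}. fst z + t *\<^sub>R snd z \<in> frontier D})"
      then obtain k t where t: "1/Suc k \<le> t" "t \<le> a - 1/Suc k" "fst z + t *\<^sub>R snd z \<in> frontier D" by auto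
      moreover have "0 < 1 / real (Suc k)" by simp
      ultimately have "0 < t" "t < a" by linarith+
      then show "z \<in> {z. H z \<inter> {..<a} \<noteq> {}}" using t(3) by (auto simp: H_def)
    qed
    also have "\<dots> \<in> sets borel"
      by (rule sets.countable_UN) (use borel_closed[OF closed_line_meets[OF frontier_closed]] in blast)
    finally show ?thesis .
  qed
  have 2: "{z. H z \<noteq> {}} \<in> sets borel"
  proof -
    have "{z. H z \<noteq> {}} = (\<Union>n::nat. {z. H z \<inter> {..<real n} \<noteq> {}})"
    proof (intro set_eqI iffI)
      fix z assume "z \<in> {z. H z \<noteq> {}}"
      then obtain t where "t \<in> H z" by auto
      moreover obtain n :: nat where "t < real n" using reals_Archimedean2 by blast
      ultimately show "z \<in> (\<Union>n::nat. {z. H z \<inter> {..<real n} \<noteq> {}})" by auto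
    qed auto
    also have "\<dots> \<in> sets borel" using 1 by (intro sets.countable_UN') auto
    finally show ?thesis .
  qed
  have "{z. flight_time D (fst z) (snd z) < a} \<in> sets borel" for a
  proof (cases "a > 0")
    case True
    have "Inf (H z) < a \<longleftrightarrow> H z \<inter> {..<a} \<noteq> {}" if "H z \<noteq> {}" for z
      by (subst cInf_less_iff) (use that in \<open>auto simp: H_def intro!: bdd_belowI[of _ 0]\<close>)
    \<comment> \<open>Rays that never hit have flight time 0 by convention and therefore belong to
      the sublevel set.\<close>
    then have "{z. flight_time D (fst z) (snd z) < a} = (UNIV - {z. H z \<noteq> {}}) \<union> {z. H z \<inter> {..<a} \<noteq> {}}"
      using True by (auto simp: ft)
    then show ?thesis using 1 2 by simp
  next
    case False
    then have "\<not> flight_time D (fst z) (snd z) < a" for z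
      using flight_time_nonneg[of D "fst z" "snd z"] by linarith
    then have "{z. flight_time D (fst z) (snd z) < a} = {}" by simp
    then show ?thesis by simp
  qed
  then show ?thesis unfolding borel_measurable_iff_less by simp
qed

lemma flight_time_measurable [measurable (raw)]:
  fixes f g :: "'b \<Rightarrow> 'a::euclidean_space"
  assumes [measurable]: "f \<in> borel_measurable M" "g \<in> borel_measurable M"
  shows "(\<lambda>x. flight_time D (f x) (g x)) \<in> borel_measurable M"
proof -
  have "(\<lambda>x. (f x, g x)) \<in> borel_measurable M" by measurable
  from measurable_compose[OF this flight_time_measurable'[of D]] show ?thesis by simp
qed

lemma hit_point_measurable [measurable (raw)]:
  fixes f g :: "'b \<Rightarrow> 'a::euclidean_space"
  assumes [measurable]: "f \<in> borel_measurable M" "g \<in> borel_measurable M"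
  shows "(\<lambda>x. hit_point D (f x) (g x)) \<in> borel_measurable M"
  unfolding hit_point_def by measurable

text \<open>Up to the flight time, a ray from a boundary point stays inside \<open>D\<close> or outside \<open>D\<close>; the midpoint
  decides which.\<close>

definition chords :: "'a::euclidean_space set \<Rightarrow> ('a \<times> 'a) set" where
  "chords D = {(\<xi>, u). \<xi> \<in> frontier D \<and> norm u = 1 \<and> flight_time D \<xi> u > 0 \<and>
     \<xi> + (flight_time D \<xi> u / 2) *\<^sub>R u \<in> D}"

definition chord_flip :: "'a::euclidean_space set \<Rightarrow> 'a \<times> 'a \<Rightarrow> 'a \<times> 'a" where
  "chord_flip D c = (hit_point D (fst c) (snd c), - snd c)"

definition chord_through :: "'a::euclidean_space set \<Rightarrow> 'a \<times> 'a \<Rightarrow> 'a \<times> 'a" where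
  "chord_through D z = (hit_point D (fst z) (- snd z), snd z)"

definition chord_length :: "'a::euclidean_space set \<Rightarrow> 'a \<times> 'a \<Rightarrow> real" where
  "chord_length D c = flight_time D (fst c) (snd c)"

lemma chord_maps_measurable [measurable]:
  fixes D :: "'a::euclidean_space set"
  shows "chord_flip D \<in> borel_measurable borel"
    and "chord_through D \<in> borel_measurable borel"
    and "chord_length D \<in> borel_measurable borel"
  unfolding chord_flip_def[abs_def] chord_through_def[abs_def] chord_length_def[abs_def] by measurable

lemma chord_length_nonneg [simp]: "chord_length D c \<ge> 0"
  by (simp add: chord_length_def flight_time_nonneg)

section \<open>Points of the domain, the chords through them, and reversal of chords\<close>

locale bounded_open =
  fixes D :: "'a::euclidean_space set"
  assumes open_D: "open D" and bounded_D: "bounded D"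
begin

lemma D_borel [measurable]: "D \<in> sets borel"
  using open_D by simp

lemma D_not_frontier: "x \<in> D \<Longrightarrow> x \<notin> frontier D"
  using open_D by (simp add: frontier_def interior_open)

lemma chords_measurable [measurable]: "chords D \<in> sets borel"
proof -
  have [measurable]: "frontier D \<in> sets borel" by (simp add: borel_closed frontier_closed)
  have "chords D = {z. fst z \<in> frontier D \<and> norm (snd z) = 1 \<and> flight_time D (fst z) (snd z) > 0 \<and>
     fst z + (flight_time D (fst z) (snd z) / 2) *\<^sub>R snd z \<in> D}"
    by (auto simp: chords_def)
  also have "\<dots> \<in> sets borel" by measurable
  finally show ?thesis .
qed

text \<open>A connected set meeting both \<open>D\<close> and its complement meets the
  frontier.\<close>

lemma segment_avoiding_frontier:
  assumes "x + s *\<^sub>R u \<in> D" "s \<in> {a<..<b}" "t \<in> {a<..<b}"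
    and "\<And>r. r \<in> {a<..<b} \<Longrightarrow> x + r *\<^sub>R u \<notin> frontier D"
  shows "x + t *\<^sub>R u \<in> D"
proof (rule ccontr)
  assume t: "x + t *\<^sub>R u \<notin> D"
  let ?f = "\<lambda>r. x + r *\<^sub>R u"
  have "connected (?f ` {a<..<b})"
    by (intro connected_continuous_image continuous_intros connected_Ioo)
  then have "?f ` {a<..<b} \<inter> frontier D \<noteq> {}"
  proof (rule connected_Int_frontier)
    show "?f ` {a<..<b} \<inter> D \<noteq> {}" using imageI[OF assms(2), of ?f] assms(1) by blast
    show "?f ` {a<..<b} - D \<noteq> {}" using imageI[OF assms(3), of ?f] t by blast
  qed
  then show False using assms(4) by auto
qed

lemma flight_from_interior:
  assumes x: "x \<in> D" and v: "norm v = 1"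
  shows "flight_time D x v > 0"
    and "hit_point D x v \<in> frontier D"
    and "0 \<le> t \<Longrightarrow> t < flight_time D x v \<Longrightarrow> x + t *\<^sub>R v \<in> D"
proof -
  obtain \<epsilon> where \<epsilon>: "\<epsilon> > 0" "ball x \<epsilon> \<subseteq> D" using open_D x open_contains_ball by blast
  have small: "x + t *\<^sub>R v \<in> D" if "\<bar>t\<bar> < \<epsilon>" for t
    using \<epsilon> that v by (auto simp: dist_norm subset_eq)
  obtain B where B: "B > 0" "\<And>y. y \<in> D \<Longrightarrow> norm y \<le> B" using bounded_D bounded_pos by blast
  \<comment> \<open>Since \<open>B\<close> bounds the norm on \<open>D\<close>, a unit-speed ray
    from \<open>x\<close> has left \<open>D\<close> by this time.\<close>
  define T where "T = B + norm x + 1"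
  have T: "x + T *\<^sub>R v \<notin> D"
  proof
    assume "x + T *\<^sub>R v \<in> D"
    then have "norm (x + T *\<^sub>R v) \<le> B" by (rule B)
    moreover have "norm (T *\<^sub>R v) \<le> norm (x + T *\<^sub>R v) + norm x"
      using norm_triangle_ineq4[of "x + T *\<^sub>R v" x] by simp
    moreover have "norm (T *\<^sub>R v) = T" using B(1) v norm_ge_zero[of x] by (simp add: T_def)
    ultimately show False by (simp add: T_def)
  qed
  obtain t' where t': "t' > 0" "x + t' *\<^sub>R v \<in> frontier D"
  proof -
    let ?f = "\<lambda>r. x + r *\<^sub>R v"
    have T0: "T \<ge> 0" using B(1) norm_ge_zero[of x] by (simp add: T_def)
    have "connected (?f ` {0..T})"
      by (intro connected_continuous_image continuous_intros connected_Icc)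
    then have "?f ` {0..T} \<inter> frontier D \<noteq> {}"
    proof (rule connected_Int_frontier)
      have "?f 0 \<in> ?f ` {0..T}" using T0 by (intro imageI) auto
      then show "?f ` {0..T} \<inter> D \<noteq> {}" using x by auto
      have "?f T \<in> ?f ` {0..T}" using T0 by (intro imageI) auto
      then show "?f ` {0..T} - D \<noteq> {}" using T by blast
    qed
    then obtain r where r: "0 \<le> r" "x + r *\<^sub>R v \<in> frontier D" by auto
    moreover have "r \<noteq> 0" using r(2) x D_not_frontier by auto
    ultimately show ?thesis using that[of r] by simp
  qed
  show hit: "hit_point D x v \<in> frontier D" using t' by (rule hit_point_frontier)
  then have "flight_time D x v \<noteq> 0" using x D_not_frontier by (auto simp: hit_point_def)
  then show pos: "flight_time D x v > 0" using flight_time_nonneg[of D x v] by simp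
  show "x + t *\<^sub>R v \<in> D" if "0 \<le> t" "t < flight_time D x v"
  \<comment> \<open>The open interval starts at \<open>- \<epsilon>\<close> so that time 0, where
    the ray is known to be in \<open>D\<close>, lies inside it.\<close>
  proof (rule segment_avoiding_frontier[where s = 0 and a = "- \<epsilon>" and b = "flight_time D x v"])
    fix r assume "r \<in> {- \<epsilon><..<flight_time D x v}"
    then show "x + r *\<^sub>R v \<notin> frontier D"
      using flight_time_not_frontier[of r D x v] D_not_frontier[OF small[of r]] \<epsilon>(1)
      by (cases "r > 0") auto
  qed (use \<epsilon> pos that x in auto)
qed

lemma chordsD:
  assumes "(\<xi>, u) \<in> chords D"
  shows "\<xi> \<in> frontier D" "norm u = 1" "flight_time D \<xi> u > 0"
    and "0 < t \<Longrightarrow> t < flight_time D \<xi> u \<Longrightarrow> \<xi> + t *\<^sub>R u \<in> D"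
    and "hit_point D \<xi> u \<in> frontier D"
proof -
  show \<xi>: "\<xi> \<in> frontier D" and "norm u = 1" and pos: "flight_time D \<xi> u > 0"
    using assms by (auto simp: chords_def)
  show "\<xi> + t *\<^sub>R u \<in> D" if "0 < t" "t < flight_time D \<xi> u"
    by (rule segment_avoiding_frontier[where s = "flight_time D \<xi> u / 2" and a = 0 and b = "flight_time D \<xi> u"])
      (use assms that flight_time_not_frontier[of _ D \<xi> u] in \<open>auto simp: chords_def\<close>)
  show "hit_point D \<xi> u \<in> frontier D" using hit_point_frontier'[OF \<xi>] .
qed

lemma chordsI:
  assumes "\<xi> \<in> frontier D" "norm u = 1" "r > 0" "\<xi> + r *\<^sub>R u \<in> frontier D"
    "\<And>t. 0 < t \<Longrightarrow> t < r \<Longrightarrow> \<xi> + t *\<^sub>R u \<in> D"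
  shows "(\<xi>, u) \<in> chords D" "flight_time D \<xi> u = r"
proof -
  show "flight_time D \<xi> u = r"
    using assms D_not_frontier by (intro flight_time_eqI) auto
  then show "(\<xi>, u) \<in> chords D"
    using assms by (auto simp: chords_def)
qed

text \<open>The point at distance \<open>t\<close> from the far end is the point at distance
  \<open>?l - t\<close> from the near end, so the reversed segment is again a chord with the same
  interior points.\<close>

lemma chord_flip:
  assumes c: "c \<in> chords D"
  shows "chord_flip D c \<in> chords D" "chord_length D (chord_flip D c) = chord_length D c"
    "chord_flip D (chord_flip D c) = c"
proof -
  obtain \<xi> u where cu: "c = (\<xi>, u)" by (cases c)
  let ?l = "flight_time D \<xi> u" and ?y = "hit_point D \<xi> u"
  note cD = chordsD[OF c[unfolded cu]]
  have seg: "?y + t *\<^sub>R (- u) = \<xi> + (?l - t) *\<^sub>R u" for t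
    by (simp add: hit_point_def algebra_simps)
  have *: "(?y, - u) \<in> chords D" "flight_time D ?y (- u) = ?l"
  proof -
    have "norm (- u) = 1" "?y + ?l *\<^sub>R (- u) \<in> frontier D"
      and "\<And>t. 0 < t \<Longrightarrow> t < ?l \<Longrightarrow> ?y + t *\<^sub>R (- u) \<in> D"
      unfolding seg using cD by auto
    from chordsI[OF cD(5) this(1) cD(3) this(2,3)]
    show "(?y, - u) \<in> chords D" "flight_time D ?y (- u) = ?l" by blast+
  qed
  show "chord_flip D c \<in> chords D" "chord_length D (chord_flip D c) = chord_length D c"
    using * by (auto simp: chord_flip_def chord_length_def cu)
  show "chord_flip D (chord_flip D c) = c"
    using *(2) seg[of ?l] by (simp add: chord_flip_def cu hit_point_def[of D ?y])
qed

lemma chord_through: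
  assumes x: "x \<in> D" and v: "norm v = 1"
  shows "chord_through D (x, v) \<in> chords D"
    and "chord_length D (chord_through D (x, v)) = flight_time D x (- v) + flight_time D x v"
    and "chord_flip D (chord_through D (x, v)) = chord_through D (x, - v)"
    and "hit_point D (fst (chord_through D (x, v))) v = hit_point D x v"
    and "fst (chord_through D (x, v)) + flight_time D x (- v) *\<^sub>R v = x"
proof -
  let ?b = "hit_point D x (- v)" and ?l = "flight_time D x (- v) + flight_time D x v"
  have v': "norm (- v) = 1" using v by simp
  note fw = flight_from_interior[OF x v] and bw = flight_from_interior[OF x v']
  have seg: "?b + t *\<^sub>R v = x + (t - flight_time D x (- v)) *\<^sub>R v" for t
    by (simp add: hit_point_def algebra_simps)
  have *: "(?b, v) \<in> chords D" "flight_time D ?b v = ?l"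
  proof -
    have pos: "?l > 0" using fw(1) bw(1) by simp
    have hit: "?b + ?l *\<^sub>R v \<in> frontier D" unfolding seg using fw(2) by (simp add: hit_point_def)
    have "?b + t *\<^sub>R v \<in> D" if "0 < t" "t < ?l" for t
    proof (cases "t \<ge> flight_time D x (- v)")
      case True
      then show ?thesis unfolding seg using that by (intro fw(3)) auto
    next
      case False
      then show ?thesis using bw(3)[of "flight_time D x (- v) - t"] that
        unfolding seg by (simp add: algebra_simps)
    qed
    from chordsI[OF bw(2) v pos hit this]
    show "(?b, v) \<in> chords D" "flight_time D ?b v = ?l" by blast+
  qed
  show "chord_through D (x, v) \<in> chords D"
    and len: "chord_length D (chord_through D (x, v)) = flight_time D x (- v) + flight_time D x v"
    using * by (auto simp: chord_through_def chord_length_def)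
  show hit: "hit_point D (fst (chord_through D (x, v))) v = hit_point D x v"
    using *(2) seg[of ?l] by (simp add: chord_through_def hit_point_def[of D ?b] hit_point_def[of D x v])
  show "chord_flip D (chord_through D (x, v)) = chord_through D (x, - v)"
    using hit by (simp add: chord_flip_def chord_through_def)
  show "fst (chord_through D (x, v)) + flight_time D x (- v) *\<^sub>R v = x"
    by (simp add: chord_through_def hit_point_def)
qed

text \<open>Together with \<open>chord_through\<close> this gives the coordinates of phase space: a
  chord, and the distance from its foot point, which is the backward flight time.\<close>

lemma point_on_chord:
  assumes c: "(\<xi>, u) \<in> chords D" and s: "0 < s" "s < flight_time D \<xi> u"
  shows "\<xi> + s *\<^sub>R u \<in> D"
    and "chord_through D (\<xi> + s *\<^sub>R u, u) = (\<xi>, u)"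
    and "flight_time D (\<xi> + s *\<^sub>R u) (- u) = s"
    and "flight_time D (\<xi> + s *\<^sub>R u) u = flight_time D \<xi> u - s"
proof -
  note cD = chordsD[OF c]
  show x: "\<xi> + s *\<^sub>R u \<in> D" by (rule cD(4)[OF s])
  show bw: "flight_time D (\<xi> + s *\<^sub>R u) (- u) = s"
  proof (rule flight_time_eqI)
    fix t assume "0 < t" "t < s"
    then have "\<xi> + (s - t) *\<^sub>R u \<in> D" using s by (intro cD(4)) auto
    then show "\<xi> + s *\<^sub>R u + t *\<^sub>R - u \<notin> frontier D"
      using D_not_frontier by (auto simp: algebra_simps)
  qed (use s cD in auto)
  then show "chord_through D (\<xi> + s *\<^sub>R u, u) = (\<xi>, u)"
    by (simp add: chord_through_def hit_point_def)
  with chord_through(2)[OF x cD(2)] bw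
  show "flight_time D (\<xi> + s *\<^sub>R u) u = flight_time D \<xi> u - s"
    by (simp add: chord_length_def)
qed

text \<open>Both ends lie in the bounded frontier. The bound later limits the length of the tubes
  swept out by a null part of the boundary.\<close>

lemma chord_length_bounded: "\<exists>L>0. \<forall>c. c \<in> chords D \<longrightarrow> chord_length D c \<le> L"
proof -
  have "bounded (frontier D)" using bounded_D by (simp add: bounded_closure frontier_def bounded_diff)
  then obtain B where B: "B > 0" "\<And>y. y \<in> frontier D \<Longrightarrow> norm y \<le> B" using bounded_pos by blast
  have "chord_length D c \<le> 2 * B" if c: "c \<in> chords D" for c
  proof -
    obtain \<xi> u where cu: "c = (\<xi>, u)" by (cases c)
    note cD = chordsD[OF c[unfolded cu]]
    have "chord_length D c = norm (hit_point D \<xi> u - \<xi>)"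
      using cD(2,3) by (simp add: hit_point_def chord_length_def cu)
    also have "\<dots> \<le> norm (hit_point D \<xi> u) + norm \<xi>" by (rule norm_triangle_ineq4)
    also have "\<dots> \<le> 2 * B" using B(2)[OF cD(1)] B(2)[OF cD(5)] by simp
    finally show ?thesis .
  qed
  then show ?thesis using B(1) by (intro exI[of _ "2 * B"]) auto
qed

end

section \<open>The flux measure on chords\<close>

text \<open>The same measure carried on the whole space, so that products with Lebesgue measure have
  the Borel sets of the product space and no integrand has to be restricted to the sphere.\<close>

definition surface_measure :: "'a::euclidean_space measure" where
  "surface_measure = distr sphere_measure borel (\<lambda>u. u)"

lemma sets_surface_measure [simp, measurable_cong]: "sets surface_measure = sets borel"
  by (simp add: surface_measure_def)

lemma space_surface_measure [simp]: "space surface_measure = UNIV"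
  by (simp add: surface_measure_def)

lemma nn_integral_surface_measure:
  fixes f :: "'a::euclidean_space \<Rightarrow> ennreal"
  assumes "f \<in> borel_measurable borel"
  shows "(\<integral>\<^sup>+u. f u \<partial>surface_measure) = (\<integral>\<^sup>+u. f u \<partial>sphere_measure)"
  unfolding surface_measure_def using assms
  by (subst nn_integral_distr) (auto intro: measurable_sphere_measure)

lemma finite_measure_surface_measure: "finite_measure (surface_measure :: 'a::euclidean_space measure)"
  unfolding surface_measure_def
  by (rule finite_measure.finite_measure_distr[OF finite_measure_sphere_measure])
    (auto intro: measurable_sphere_measure)

lemma sigma_finite_surface_measure:
  "sigma_finite_measure (surface_measure :: 'a::euclidean_space measure)"
  by (intro finite_measure.axioms(1) finite_measure_surface_measure)

interpretation surface_measure: sigma_finite_measure "surface_measure :: 'a::euclidean_space measure"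
  by (rule sigma_finite_surface_measure)

interpretation surface_lborel: pair_sigma_finite
  "surface_measure :: 'a::euclidean_space measure" "lborel :: 'b::euclidean_space measure" ..

lemma AE_surface_measure_norm: "AE u in (surface_measure :: 'a::euclidean_space measure). norm u = 1"
  unfolding surface_measure_def
  by (subst AE_distr_iff) (auto intro: measurable_sphere_measure)

lemma nn_integral_surface_measure_uminus:
  fixes f :: "'a::euclidean_space \<Rightarrow> ennreal"
  assumes [measurable]: "f \<in> borel_measurable borel"
  shows "(\<integral>\<^sup>+u. f (- u) \<partial>surface_measure) = (\<integral>\<^sup>+u. f u \<partial>surface_measure)"
  by (simp add: nn_integral_surface_measure nn_integral_sphere_measure_uminus)

text \<open>
  The measure \<open>|n(\<xi>) \<cdot> u| d\<xi> du\<close> on boundary points \<open>\<xi>\<close> and directions \<open>u\<close>, described without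
  reference to the boundary: the volume of phase space divided by the length of the chord on which a
  phase point lies, pushed forward to the chords.
\<close>

definition flux :: "'a::euclidean_space set \<Rightarrow> ('a \<times> 'a) measure" where
  "flux D = distr (density (surface_measure \<Otimes>\<^sub>M lborel)
     (\<lambda>(v, x). indicator D x * ennreal (1 / chord_length D (chord_through D (x, v)))))
     borel (\<lambda>(v, x). chord_through D (x, v))"

lemma sets_flux [simp, measurable_cong]: "sets (flux D) = sets borel"
  by (simp add: flux_def)

lemma space_flux [simp]: "space (flux D) = UNIV"
  by (simp add: flux_def)

lemma sets_surface_lborel [measurable_cong]:
  "sets (surface_measure \<Otimes>\<^sub>M (lborel :: 'a::euclidean_space measure))
    = sets (borel :: ('b::euclidean_space \<times> 'a) measure)"
  by (metis borel_prod sets_lborel sets_pair_measure_cong sets_surface_measure)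

context bounded_open
begin

lemma nn_integral_flux:
  assumes [measurable]: "f \<in> borel_measurable borel"
  shows "(\<integral>\<^sup>+c. f c \<partial>flux D) = (\<integral>\<^sup>+v. \<integral>\<^sup>+x. indicator D x *
      (ennreal (1 / chord_length D (chord_through D (x, v))) * f (chord_through D (x, v))) \<partial>lborel \<partial>surface_measure)"
proof -
  have "(\<integral>\<^sup>+c. f c \<partial>flux D) = (\<integral>\<^sup>+(v, x). indicator D x *
      (ennreal (1 / chord_length D (chord_through D (x, v))) * f (chord_through D (x, v))) \<partial>(surface_measure \<Otimes>\<^sub>M lborel))"
    unfolding flux_def
    by (subst nn_integral_distr, (measurable)[2], subst nn_integral_density)
      (auto simp: split_beta' mult.assoc)
  also have "\<dots> = (\<integral>\<^sup>+v. \<integral>\<^sup>+x. indicator D x *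
      (ennreal (1 / chord_length D (chord_through D (x, v))) * f (chord_through D (x, v))) \<partial>lborel \<partial>surface_measure)"
    by (subst lborel.nn_integral_fst[symmetric]) auto
  finally show ?thesis .
qed

lemma AE_flux_chords: "AE c in flux D. c \<in> chords D"
proof (rule AE_I')
  have "emeasure (flux D) (- chords D) = (\<integral>\<^sup>+c. indicator (- chords D) c \<partial>flux D)"
    by simp
  also have "\<dots> = (\<integral>\<^sup>+v. 0 \<partial>(surface_measure :: 'a measure))"
    by (subst nn_integral_flux, measurable, rule nn_integral_cong_AE, use AE_surface_measure_norm in eventually_elim)
      (auto simp: nn_integral_0_iff_AE indicator_def chord_through)
  finally show "- chords D \<in> null_sets (flux D)" by auto
qed auto

text \<open>In the interior description a flip is \<open>v\<close> turned into \<open>- v\<close> at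
  a fixed \<open>x\<close>: the chord through \<open>(x, v)\<close> becomes the one through
  \<open>(x, - v)\<close>, and its length, the only weight, is unchanged.\<close>

lemma nn_integral_flux_flip:
  assumes [measurable]: "f \<in> borel_measurable borel"
  shows "(\<integral>\<^sup>+c. f (chord_flip D c) \<partial>flux D) = (\<integral>\<^sup>+c. f c \<partial>flux D)"
proof -
  let ?g = "\<lambda>v x. indicator D x *
      (ennreal (1 / chord_length D (chord_through D (x, v))) * f (chord_through D (x, v)))"
  have "(\<integral>\<^sup>+c. f (chord_flip D c) \<partial>flux D) = (\<integral>\<^sup>+v. \<integral>\<^sup>+x. ?g (- v) x \<partial>lborel \<partial>surface_measure)"
  proof (subst nn_integral_flux, measurable, rule nn_integral_cong_AE,
      use AE_surface_measure_norm in eventually_elim, rule nn_integral_cong)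
    fix v x :: 'a assume v: "norm v = 1"
    show "indicator D x * (ennreal (1 / chord_length D (chord_through D (x, v))) *
          f (chord_flip D (chord_through D (x, v)))) = ?g (- v) x"
      using chord_through[of x v] chord_through(2)[of x "- v"] v
      by (cases "x \<in> D") (auto simp: add.commute)
  qed
  also have "\<dots> = (\<integral>\<^sup>+v. \<integral>\<^sup>+x. ?g v x \<partial>lborel \<partial>surface_measure)"
    by (rule nn_integral_surface_measure_uminus[of "\<lambda>v. \<integral>\<^sup>+x. ?g v x \<partial>lborel"]) measurable
  also have "\<dots> = (\<integral>\<^sup>+c. f c \<partial>flux D)" by (subst nn_integral_flux) auto
  finally show ?thesis .
qed

text \<open>The backward and forward flight times act as coordinates on the chord; moving by
  \<open>t\<close> transfers \<open>t\<close> from one to the other while their sum, the chord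
  length, is preserved.\<close>

lemma move_along_chord:
  assumes x: "x \<in> D" and v: "norm v = 1" and t: "- flight_time D x (- v) < t" "t < flight_time D x v"
  shows "x + t *\<^sub>R v \<in> D" "chord_through D (x + t *\<^sub>R v, v) = chord_through D (x, v)"
    "flight_time D (x + t *\<^sub>R v) (- v) = flight_time D x (- v) + t"
    "flight_time D (x + t *\<^sub>R v) v = flight_time D x v - t"
proof -
  define b where "b = fst (chord_through D (x, v))"
  let ?s = "flight_time D x (- v)"
  note ct = chord_through[OF x v]
  have b: "(b, v) \<in> chords D" using ct(1) by (simp add: b_def chord_through_def)
  have l: "flight_time D b v = ?s + flight_time D x v"
    using ct(2) by (simp add: b_def chord_through_def chord_length_def)
  have x': "x + t *\<^sub>R v = b + (?s + t) *\<^sub>R v"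
    using ct(5) by (simp add: b_def algebra_simps)
  have s: "0 < ?s + t" "?s + t < flight_time D b v" using t l by auto
  note p = point_on_chord[OF b s, folded x']
  show "x + t *\<^sub>R v \<in> D" "flight_time D (x + t *\<^sub>R v) (- v) = ?s + t" 
    "flight_time D (x + t *\<^sub>R v) v = flight_time D x v - t"
    using p l by auto
  show "chord_through D (x + t *\<^sub>R v, v) = chord_through D (x, v)"
    using p(2) by (simp add: b_def chord_through_def)
qed

text \<open>Writing the position on the chord through \<open>x\<close> relative to \<open>x\<close>, the right-hand side becomes an
  integral over pairs of points on a common chord, in which the two points can be exchanged.\<close>

lemma santalo:
  assumes f [measurable]: "f \<in> borel_measurable borel"
  shows "(\<integral>\<^sup>+v. \<integral>\<^sup>+x. indicator D x * f (x, v) \<partial>lborel \<partial>surface_measure)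
    = (\<integral>\<^sup>+c. \<integral>\<^sup>+s. indicator {0<..<chord_length D c} s * f (fst c + s *\<^sub>R snd c, snd c) \<partial>lborel \<partial>flux D)"
proof -
  have [measurable]: "Measurable.pred borel (\<lambda>x. x \<in> D)" by simp
  have "(\<integral>\<^sup>+x. indicator D x * f (x, v) \<partial>lborel)
     = (\<integral>\<^sup>+x. indicator D x * (ennreal (1 / chord_length D (chord_through D (x, v))) *
         (\<integral>\<^sup>+s. indicator {0<..<chord_length D (chord_through D (x, v))} s *
            f (fst (chord_through D (x, v)) + s *\<^sub>R snd (chord_through D (x, v)), snd (chord_through D (x, v))) \<partial>lborel)) \<partial>lborel)"
    (is "?l = ?r") if v: "norm v = 1" for v
  proof -
    let ?l = "\<lambda>x. chord_length D (chord_through D (x, v))"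
    let ?on = "\<lambda>x t. x \<in> D \<and> - flight_time D x (- v) < t \<and> t < flight_time D x v"
    \<comment> \<open>Substituting \<open>s\<close> = \<open>t\<close> plus the backward flight time
      makes \<open>t\<close> the signed distance from \<open>x\<close> itself.\<close>
    have "?r = (\<integral>\<^sup>+x. \<integral>\<^sup>+t. of_bool (?on x t) * (ennreal (1 / ?l x) * f (x + t *\<^sub>R v, v)) \<partial>lborel \<partial>lborel)"
    proof (rule nn_integral_cong)
      fix x :: 'a
      show "indicator D x * (ennreal (1 / ?l x) *
         (\<integral>\<^sup>+s. indicator {0<..<?l x} s *
            f (fst (chord_through D (x, v)) + s *\<^sub>R snd (chord_through D (x, v)), snd (chord_through D (x, v))) \<partial>lborel))
         = (\<integral>\<^sup>+t. of_bool (?on x t) * (ennreal (1 / ?l x) * f (x + t *\<^sub>R v, v)) \<partial>lborel)"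
      proof (cases "x \<in> D")
        case True
        note ct = chord_through[OF True v]
        let ?b = "fst (chord_through D (x, v))" and ?s = "flight_time D x (- v)"
        have b: "?b + (t + ?s) *\<^sub>R v = x + t *\<^sub>R v" for t
          using ct(5) by (simp add: algebra_simps)
        have "(\<integral>\<^sup>+s. indicator {0<..<?l x} s * f (?b + s *\<^sub>R v, v) \<partial>lborel)
            = (\<integral>\<^sup>+t. indicator {0<..<?l x} (t + ?s) * f (?b + (t + ?s) *\<^sub>R v, v) \<partial>lborel)"
          by (rule nn_integral_lborel_translate[symmetric]) measurable
        also have "\<dots> = (\<integral>\<^sup>+t. of_bool (?on x t) * f (x + t *\<^sub>R v, v) \<partial>lborel)"
          using True by (intro nn_integral_cong) (auto simp: b ct(2) indicator_def)
        finally show ?thesis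
          using True
          by (subst mult.left_commute, subst nn_integral_cmult)
            (auto simp: chord_through_def[of D "(x, v)"])
      qed simp
    qed
    also have "\<dots> = (\<integral>\<^sup>+t. \<integral>\<^sup>+x. of_bool (?on x t) * (ennreal (1 / ?l x) * f (x + t *\<^sub>R v, v)) \<partial>lborel \<partial>lborel)"
      by (rule lborel_pair.Fubini') measurable
    \<comment> \<open>The point where \<open>f\<close> is evaluated becomes the integration
      variable. The points \<open>x\<close> and \<open>x + t *\<^sub>R v\<close> lie on the same
      chord, so the weight is the same at both, and seen from the second point the first has offset
      \<open>- t\<close>.\<close>
    also have "\<dots> = (\<integral>\<^sup>+t. \<integral>\<^sup>+x. of_bool (?on x (- t)) * (ennreal (1 / ?l x) * f (x, v)) \<partial>lborel \<partial>lborel)"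
    proof (rule nn_integral_cong)
      fix t :: real
      have "(\<integral>\<^sup>+x. of_bool (?on x t) * (ennreal (1 / ?l x) * f (x + t *\<^sub>R v, v)) \<partial>lborel)
        = (\<integral>\<^sup>+x. of_bool (?on (x + t *\<^sub>R v) (- t)) * (ennreal (1 / ?l (x + t *\<^sub>R v)) * f (x + t *\<^sub>R v, v)) \<partial>lborel)"
      proof (rule nn_integral_cong)
        fix x
        have "?on (x + t *\<^sub>R v) (- t) \<and> ?l (x + t *\<^sub>R v) = ?l x" if "?on x t"
          using that move_along_chord[OF _ v, of x t] flight_from_interior(1)[of x] v by auto
        moreover have "?on x t" if "?on (x + t *\<^sub>R v) (- t)"
          using that move_along_chord[OF _ v, of "x + t *\<^sub>R v" "- t"]
            flight_from_interior(1)[of "x + t *\<^sub>R v"] v by auto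
        ultimately show "of_bool (?on x t) * (ennreal (1 / ?l x) * f (x + t *\<^sub>R v, v)) =
            of_bool (?on (x + t *\<^sub>R v) (- t)) * (ennreal (1 / ?l (x + t *\<^sub>R v)) * f (x + t *\<^sub>R v, v))"
          by (cases "?on x t") auto
      qed
      also have "\<dots> = (\<integral>\<^sup>+x. of_bool (?on x (- t)) * (ennreal (1 / ?l x) * f (x, v)) \<partial>lborel)"
        by (rule nn_integral_lborel_translate) measurable
      finally show "(\<integral>\<^sup>+x. of_bool (?on x t) * (ennreal (1 / ?l x) * f (x + t *\<^sub>R v, v)) \<partial>lborel) = \<dots>" .
    qed
    also have "\<dots> = (\<integral>\<^sup>+x. \<integral>\<^sup>+t. of_bool (?on x (- t)) * (ennreal (1 / ?l x) * f (x, v)) \<partial>lborel \<partial>lborel)"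
      by (rule lborel_pair.Fubini') measurable
    \<comment> \<open>Now \<open>t\<close> occurs only through its admissible interval, whose length
      is the chord length and cancels the weight.\<close>
    also have "\<dots> = (\<integral>\<^sup>+x. indicator D x * f (x, v) \<partial>lborel)"
    proof (rule nn_integral_cong)
      fix x :: 'a
      show "(\<integral>\<^sup>+t. of_bool (?on x (- t)) * (ennreal (1 / ?l x) * f (x, v)) \<partial>lborel) = indicator D x * f (x, v)"
      proof (cases "x \<in> D")
        case True
        let ?a = "- flight_time D x v" and ?b = "flight_time D x (- v)"
        have pos: "?l x > 0" "?l x = ?b - ?a"
          using chord_through(2)[OF True v] flight_from_interior(1)[OF True v] flight_from_interior(1)[of x "- v"] True v
          by auto
        have "(\<integral>\<^sup>+t. of_bool (?on x (- t)) * (ennreal (1 / ?l x) * f (x, v)) \<partial>lborel)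
          = (\<integral>\<^sup>+t. indicator {?a<..<?b} t * (ennreal (1 / ?l x) * f (x, v)) \<partial>lborel)"
          using True by (intro nn_integral_cong) (auto simp: indicator_def)
        also have "\<dots> = emeasure lborel {?a<..<?b} * (ennreal (1 / ?l x) * f (x, v))"
          by (subst nn_integral_multc) auto
        also have "emeasure lborel {?a<..<?b} = ennreal (?l x)"
          using pos by simp
        also have "ennreal (?l x) * (ennreal (1 / ?l x) * f (x, v)) = f (x, v)"
          using pos(1) by (simp add: mult.assoc[symmetric] ennreal_mult'[symmetric])
        finally show ?thesis using True by simp
      qed simp
    qed
    finally show ?thesis ..
  qed
  then have "(\<integral>\<^sup>+v. \<integral>\<^sup>+x. indicator D x * f (x, v) \<partial>lborel \<partial>surface_measure)
     = (\<integral>\<^sup>+v. \<integral>\<^sup>+x. indicator D x * (ennreal (1 / chord_length D (chord_through D (x, v))) *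
         (\<integral>\<^sup>+s. indicator {0<..<chord_length D (chord_through D (x, v))} s *
            f (fst (chord_through D (x, v)) + s *\<^sub>R snd (chord_through D (x, v)), snd (chord_through D (x, v))) \<partial>lborel)) \<partial>lborel \<partial>surface_measure)"
    by (intro nn_integral_cong_AE, use AE_surface_measure_norm in eventually_elim) simp
  also have "\<dots> = (\<integral>\<^sup>+c. \<integral>\<^sup>+s. indicator {0<..<chord_length D c} s * f (fst c + s *\<^sub>R snd c, snd c) \<partial>lborel \<partial>flux D)"
  proof (rule nn_integral_flux[symmetric])
    have "(\<lambda>z. indicator {0<..<chord_length D (fst z)} (snd z) * f (fst (fst z) + snd z *\<^sub>R snd (fst z), snd (fst z)))
       = (\<lambda>z. of_bool (0 < snd z \<and> snd z < chord_length D (fst z)) * f (fst (fst z) + snd z *\<^sub>R snd (fst z), snd (fst z)))"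
      by (auto simp: indicator_def)
    also have "\<dots> \<in> borel_measurable (borel \<Otimes>\<^sub>M lborel)" by measurable
    finally show "(\<lambda>c. \<integral>\<^sup>+s. indicator {0<..<chord_length D c} s * f (fst c + s *\<^sub>R snd c, snd c) \<partial>lborel)
        \<in> borel_measurable borel"
      by (intro lborel.borel_measurable_nn_integral) (simp add: split_beta')
  qed
  finally show ?thesis .
qed

end

section \<open>Paths along a sequence of chords\<close>

definition arc_length :: "'a::euclidean_space set \<Rightarrow> (nat \<Rightarrow> 'a \<times> 'a) \<Rightarrow> nat \<Rightarrow> real" where
  "arc_length D x n = (\<Sum>i<n. chord_length D (x i))"

definition leg_state :: "'a::euclidean_space set \<Rightarrow> (nat \<Rightarrow> 'a \<times> 'a) \<Rightarrow> real \<Rightarrow> nat \<Rightarrow> 'a \<times> 'a" where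
  "leg_state D x a k = (fst (x k) + (a - arc_length D x k) *\<^sub>R snd (x k), snd (x k))"

text \<open>The strict inequality makes paths right continuous: at the joint of two legs the later
  one counts, and for \<open>a \<ge> 0\<close> legs of length 0 are skipped. As the speed is 1, arc
  length is time since the start of the first chord.\<close>

definition path_state :: "'a::euclidean_space set \<Rightarrow> (nat \<Rightarrow> 'a \<times> 'a) \<Rightarrow> real \<Rightarrow> 'a \<times> 'a" where
  "path_state D x a = leg_state D x a (LEAST k. a < arc_length D x (Suc k))"

definition turn_back :: "'a::euclidean_space \<times> 'a \<Rightarrow> 'a \<times> 'a" where
  "turn_back z = (fst z, - snd z)"

lemma arc_length_simps [simp]:
  "arc_length D x 0 = 0" "arc_length D x (Suc n) = arc_length D x n + chord_length D (x n)"
  by (simp_all add: arc_length_def)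

lemma arc_length_mono: "m \<le> n \<Longrightarrow> arc_length D x m \<le> arc_length D x n"
  unfolding arc_length_def by (rule sum_mono2) auto

lemma arc_length_cong: "(\<And>i. i < n \<Longrightarrow> x i = y i) \<Longrightarrow> arc_length D x n = arc_length D y n"
  by (simp add: arc_length_def)

lemma path_state_eq:
  assumes "arc_length D x k \<le> a" "a < arc_length D x (Suc k)"
  shows "path_state D x a = leg_state D x a k"
proof -
  have "(LEAST k. a < arc_length D x (Suc k)) = k"
  proof (rule Least_equality)
    fix j assume j: "a < arc_length D x (Suc j)"
    show "k \<le> j"
    proof (rule ccontr)
      assume "\<not> k \<le> j"
      then have "arc_length D x (Suc j) \<le> arc_length D x k" by (intro arc_length_mono) simp
      then show False using j assms by simp
    qed
  qed (rule assms(2))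
  then show ?thesis by (simp add: path_state_def)
qed

lemma obtain_leg:
  assumes "0 \<le> a" "a < arc_length D x (Suc n)"
  obtains k where "k \<le> n" "arc_length D x k \<le> a" "a < arc_length D x (Suc k)"
proof -
  define k where "k = (LEAST k. a < arc_length D x (Suc k))"
  have 1: "a < arc_length D x (Suc k)" "k \<le> n"
    unfolding k_def using assms(2) by (rule LeastI, rule Least_le)
  moreover have "arc_length D x k \<le> a"
  proof (cases k)
    case (Suc j)
    then have "\<not> a < arc_length D x (Suc j)" unfolding k_def by (intro not_less_Least) simp
    then show ?thesis by (simp only: Suc not_less)
  qed (use assms in simp)
  ultimately show ?thesis using that by blast
qed

text \<open>Up to arc length \<open>a\<close> only finitely many chords matter, which allows the
  tail of an infinite sequence to be replaced before reversing.\<close>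

lemma path_state_cong:
  assumes "\<And>i. i \<le> n \<Longrightarrow> x i = y i" "0 \<le> a" "a < arc_length D x (Suc n)"
  shows "path_state D x a = path_state D y a"
proof -
  have arc: "arc_length D y k = arc_length D x k" if "k \<le> Suc n" for k
    using assms(1) that by (intro arc_length_cong) simp
  obtain k where k: "k \<le> n" "arc_length D x k \<le> a" "a < arc_length D x (Suc k)"
    using obtain_leg[OF assms(2,3)] .
  then have "path_state D y a = leg_state D y a k"
    using arc[of k] arc[of "Suc k"] by (intro path_state_eq) simp_all
  moreover have "path_state D x a = leg_state D x a k" using k(2,3) by (rule path_state_eq)
  ultimately show ?thesis using assms(1)[OF k(1)] arc[of k] k(1) by (simp add: leg_state_def)
qed

context bounded_open
begin

lemma arc_length_reverse:
  assumes "\<And>i. i \<le> n \<Longrightarrow> x i \<in> chords D" "k \<le> Suc n"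
  shows "arc_length D (\<lambda>i. chord_flip D (x (n - i))) k = arc_length D x (Suc n) - arc_length D x (Suc n - k)"
  using assms(2)
proof (induction k)
  case (Suc k)
  then have k: "k \<le> n" "Suc n - k = Suc (n - k)" by auto
  have "arc_length D (\<lambda>i. chord_flip D (x (n - i))) (Suc k)
      = arc_length D x (Suc n) - arc_length D x (Suc (n - k)) + chord_length D (x (n - k))"
    using Suc chord_flip(2)[OF assms(1)[of "n - k"]] k by simp
  then show ?case by simp
qed simp

text \<open>Arc length \<open>a\<close> on leg \<open>k\<close> corresponds to the remaining arc
  length on leg \<open>n - k\<close> of the reversed sequence. At a joint this fails: by right
  continuity the forward path is already on the leg after the joint, and the reversed path is on the
  flip of the leg before it, so \<open>generic\<close> excludes joints.\<close>

lemma path_state_reverse: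
  assumes x: "\<And>i. i \<le> n \<Longrightarrow> x i \<in> chords D" and a: "0 < a" "a < arc_length D x (Suc n)"
    and generic: "\<And>k. a \<noteq> arc_length D x k"
  shows "path_state D (\<lambda>i. chord_flip D (x (n - i))) (arc_length D x (Suc n) - a) = turn_back (path_state D x a)"
proof -
  let ?y = "\<lambda>i. chord_flip D (x (n - i))" and ?L = "arc_length D x (Suc n)"
  obtain k where k: "k \<le> n" "arc_length D x k \<le> a" "a < arc_length D x (Suc k)"
    using obtain_leg[of a D x n] a by auto
  have k': "arc_length D x k < a" using k(2) generic[of k] by simp
  have arc: "arc_length D ?y (n - k) = ?L - arc_length D x (Suc k)"
      "arc_length D ?y (Suc (n - k)) = ?L - arc_length D x k"
    using arc_length_reverse[of n x "n - k", OF x] arc_length_reverse[of n x "Suc (n - k)", OF x] k(1)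
    by (simp_all add: Suc_diff_le del: arc_length_simps)
  have "path_state D ?y (?L - a) = leg_state D ?y (?L - a) (n - k)"
    by (rule path_state_eq) (unfold arc, use k k' in simp_all)
  also have "\<dots> = turn_back (leg_state D x a k)"
  proof -
    have "n - (n - k) = k" using k(1) by simp
    moreover have "hit_point D (fst (x k)) (snd (x k)) = fst (x k) + chord_length D (x k) *\<^sub>R snd (x k)"
      by (simp add: hit_point_def chord_length_def)
    ultimately show ?thesis
      unfolding leg_state_def turn_back_def arc
      by (simp add: chord_flip_def algebra_simps)
  qed
  also have "leg_state D x a k = path_state D x a" by (rule path_state_eq[symmetric]) (rule k)+
  finally show ?thesis .
qed

end

section \<open>The flux measure over a Lipschitz graph\<close>

text \<open>The last assumption is the image equation of \<open>lipschitz_domain\<close> in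
  pointwise form, with the affine isometry split into its orthogonal part \<open>Q\<close> and
  translation \<open>c\<close>.\<close>

locale lipschitz_chart =
  fixes D :: "('p::euclidean_space \<times> real) set" and x0 :: "'p \<times> real" and \<epsilon> :: real
    and Q :: "'p \<times> real \<Rightarrow> 'p \<times> real" and c :: "'p \<times> real" and f :: "'p \<Rightarrow> real" and L :: real
  assumes open_D: "open D" and Q: "orthogonal_transformation Q" and \<epsilon>: "\<epsilon> > 0"
    and center: "Q x0 + c = 0" and lipschitz: "L-lipschitz_on UNIV f"
    and chart_D: "x \<in> ball x0 \<epsilon> \<Longrightarrow> x \<in> D \<longleftrightarrow> f (fst (Q x + c)) < snd (Q x + c)"
begin

section \<open>Coordinates of a chart and the graph over its base\<close>

definition chart :: "'p \<times> real \<Rightarrow> 'p \<times> real" where "chart x = Q x + c"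

definition unchart :: "'p \<times> real \<Rightarrow> 'p \<times> real" where "unchart z = inv Q (z - c)"

definition graph_point :: "'p \<Rightarrow> 'p \<times> real" where "graph_point y = unchart (y, f y)"

lemma Q_facts: "linear Q" "bounded_linear Q" "norm (Q x) = norm x" "Q x \<bullet> Q y = x \<bullet> y"
  using Q orthogonal_transformation_norm[OF Q]
  by (auto simp: linear_conv_bounded_linear orthogonal_transformation_def simp del: split_paired_All)

lemma Q_inv: "inv Q (Q x) = x" "Q (inv Q x) = x" "orthogonal_transformation (inv Q)"
  using orthogonal_transformation_bij[OF Q] orthogonal_transformation_inv[OF Q]
  by (auto simp: bij_def surj_f_inv_f)

lemma unchart_chart [simp]: "unchart (chart x) = x" "chart (unchart z) = z"
  by (auto simp: chart_def unchart_def Q_inv)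

lemma chart_add: "chart (x + s *\<^sub>R v) = chart x + s *\<^sub>R Q v"
  by (simp add: chart_def linear_add[OF Q_facts(1)] linear_cmul[OF Q_facts(1)])

lemma unchart_add: "unchart (z + s *\<^sub>R Q v) = unchart z + s *\<^sub>R v"
  by (metis chart_add unchart_chart)

lemma chart_measurable [measurable]: "chart \<in> borel_measurable borel" "unchart \<in> borel_measurable borel"
  unfolding chart_def[abs_def] unchart_def[abs_def]
  using orthogonal_transformation_borel_measurable[OF Q]
    orthogonal_transformation_borel_measurable[OF Q_inv(3)] by measurable

lemma continuous_chart: "continuous_on S chart" "continuous_on S unchart"
proof -
  have "bounded_linear (inv Q)"
    using Q_inv(3) by (simp add: orthogonal_transformation_def linear_conv_bounded_linear)
  from linear_continuous_on[OF this] show "continuous_on S unchart"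
    unfolding unchart_def[abs_def]
    by (rule continuous_on_compose2[of UNIV]) (auto intro!: continuous_on_diff)
  show "continuous_on S chart"
    unfolding chart_def[abs_def]
    by (rule continuous_on_add[OF linear_continuous_on[OF Q_facts(2)] continuous_on_const])
qed

lemma continuous_f: "continuous_on S f"
  using lipschitz_on_continuous_on[OF lipschitz] continuous_on_subset by blast

lemma f_measurable [measurable]: "f \<in> borel_measurable borel"
  by (intro borel_measurable_continuous_onI continuous_f)

lemma graph_point_measurable [measurable]: "graph_point \<in> borel_measurable borel"
  unfolding graph_point_def[abs_def] by measurable

lemma continuous_graph_point: "continuous_on S graph_point"
  unfolding graph_point_def[abs_def]
  by (rule continuous_on_compose2[OF continuous_chart(2)[of UNIV]]) (auto intro!: continuous_intros continuous_f)

lemma dist_chart: "dist (chart x) (chart y) = dist x y"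
  by (simp add: chart_def dist_norm linear_diff[OF Q_facts(1), symmetric] Q_facts(3))

lemma chart_D': "x \<in> ball x0 \<epsilon> \<Longrightarrow> x \<in> D \<longleftrightarrow> f (fst (chart x)) < snd (chart x)"
  using chart_D by (simp add: chart_def)

lemma ball_moves:
  assumes "x \<in> ball x0 \<epsilon>"
  obtains \<delta> where "\<delta> > 0" "\<And>s. \<bar>s\<bar> < \<delta> \<Longrightarrow> x + s *\<^sub>R v \<in> ball x0 \<epsilon>"
proof -
  have "open ((\<lambda>s. x + s *\<^sub>R v) -` ball x0 \<epsilon>)"
    by (intro open_vimage continuous_intros open_ball)
  then obtain \<delta> where "\<delta> > 0" "ball 0 \<delta> \<subseteq> (\<lambda>s. x + s *\<^sub>R v) -` ball x0 \<epsilon>"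
    using assms by (metis (mono_tags, lifting) add.right_neutral open_contains_ball scaleR_zero_left vimage_eq)
  then show ?thesis by (intro that[of \<delta>]) (auto simp: subset_eq)
qed

text \<open>Points above the graph are in the open set \<open>D\<close>, points below it have a
  neighbourhood disjoint from \<open>D\<close>, and points on it are approached from
  \<open>D\<close> by moving vertically upwards.\<close>

lemma chart_frontier:
  assumes x: "x \<in> ball x0 \<epsilon>"
  shows "x \<in> frontier D \<longleftrightarrow> snd (chart x) = f (fst (chart x))"
proof -
  have front: "x \<in> frontier D \<longleftrightarrow> x \<in> closure D \<and> x \<notin> D"
    using open_D by (simp add: frontier_def interior_open)
  consider "snd (chart x) > f (fst (chart x))" | "snd (chart x) < f (fst (chart x))"
    | "snd (chart x) = f (fst (chart x))" by linarith
  then show ?thesis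
  proof cases
    case 1
    then show ?thesis using front chart_D'[OF x] by simp
  next
    case 2
    let ?O = "ball x0 \<epsilon> \<inter> {y. snd (chart y) < f (fst (chart y))}"
    have "open ?O"
      by (intro open_Int open_ball open_Collect_less continuous_intros continuous_chart
          continuous_on_compose2[OF continuous_f[of UNIV]]) auto
    moreover have "?O \<inter> D = {}" using chart_D' by fastforce
    ultimately have "?O \<inter> closure D = {}" by (simp add: open_Int_closure_eq_empty)
    then have "x \<notin> closure D" using x 2 by auto
    then show ?thesis using front 2 by simp
  next
    case 3
    have "x \<in> closure D"
    proof (subst closure_approachable, intro allI impI)
      fix e :: real assume e: "e > 0"
      \<comment> \<open>The direction that the chart sends to the upward unit vector.\<close>
      define v where "v = inv Q (0, 1)"
      have v: "Q v = (0, 1)" "norm v = 1"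
        using Q_inv(2) Q_facts(3)[of v] by (auto simp: v_def norm_Pair)
      obtain \<delta> where \<delta>: "\<delta> > 0" "\<And>s. \<bar>s\<bar> < \<delta> \<Longrightarrow> x + s *\<^sub>R v \<in> ball x0 \<epsilon>"
        using ball_moves[OF x] by blast
      define s where "s = min \<delta> e / 2"
      have s: "0 < s" "s < \<delta>" "s < e" using \<delta> e by (auto simp: s_def)
      have "x + s *\<^sub>R v \<in> D"
        using chart_D'[OF \<delta>(2)[of s]] s 3 v by (simp add: chart_add)
      moreover have "dist (x + s *\<^sub>R v) x < e" using s v by (simp add: dist_norm)
      ultimately show "\<exists>y\<in>D. dist y x < e" by blast
    qed
    then show ?thesis using front 3 chart_D'[OF x] by simp
  qed
qed

lemma frontier_graph_point:
  assumes "x \<in> ball x0 \<epsilon>" "x \<in> frontier D"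
  shows "graph_point (fst (chart x)) = x"
  using chart_frontier[OF assms(1)] assms(2) unchart_chart(1)[of x]
  by (metis graph_point_def prod.collapse)

text \<open>The height \<open>q\<close> of the moving point above the graph vanishes at 0 and has
  there the derivative \<open>snd (Q v) - f' (fst (Q v))\<close>; its sign decides on which side of
  the graph the ray starts.\<close>

lemma ray_near_frontier:
  assumes x: "x \<in> ball x0 \<epsilon>" "x \<in> frontier D"
    and deriv: "(f has_derivative f') (at (fst (chart x)))"
  shows "snd (Q v) > f' (fst (Q v)) \<Longrightarrow> \<exists>\<delta>>0. \<forall>s\<in>{0<..<\<delta>}. x + s *\<^sub>R v \<in> D"
    and "snd (Q v) < f' (fst (Q v)) \<Longrightarrow> \<exists>\<delta>>0. \<forall>s\<in>{0<..<\<delta>}. x + s *\<^sub>R v \<notin> D"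
proof -
  let ?y = "fst (chart x)" and ?w = "fst (Q v)"
  define q where "q s = f ?y + s * snd (Q v) - f (?y + s *\<^sub>R ?w)" for s
  obtain \<delta> where \<delta>: "\<delta> > 0" "\<And>s. \<bar>s\<bar> < \<delta> \<Longrightarrow> x + s *\<^sub>R v \<in> ball x0 \<epsilon>"
    using ball_moves[OF x(1)] by blast
  have D: "x + s *\<^sub>R v \<in> D \<longleftrightarrow> 0 < q s" if "\<bar>s\<bar> < \<delta>" for s
    using chart_D'[OF \<delta>(2)[OF that]] chart_frontier[OF x(1)] x(2)
    by (auto simp: chart_add q_def algebra_simps)
  have "((\<lambda>s. ?y + s *\<^sub>R ?w) has_derivative (\<lambda>s. s *\<^sub>R ?w)) (at 0)"
    by (auto intro!: derivative_eq_intros)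
  moreover have "(f has_derivative f') (at (?y + 0 *\<^sub>R ?w))" using deriv by simp
  ultimately have "((\<lambda>s. f (?y + s *\<^sub>R ?w)) has_derivative (\<lambda>s. f' (s *\<^sub>R ?w))) (at 0)"
    by (rule has_derivative_compose)
  then have "((\<lambda>s. f (?y + s *\<^sub>R ?w)) has_real_derivative f' ?w) (at 0)"
    using linear_cmul[OF has_derivative_linear[OF deriv]]
    by (simp add: has_field_derivative_def mult_commute_abs)
  then have q: "(q has_real_derivative (snd (Q v) - f' ?w)) (at 0)"
    unfolding q_def by (auto intro!: derivative_eq_intros)
  have q0: "q 0 = 0" by (simp add: q_def)
  show "\<exists>\<delta>>0. \<forall>s\<in>{0<..<\<delta>}. x + s *\<^sub>R v \<in> D" if "snd (Q v) > f' (fst (Q v))"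
  proof -
    obtain d where "d > 0" "\<And>h. 0 < h \<Longrightarrow> h < d \<Longrightarrow> q 0 < q (0 + h)"
      using DERIV_pos_inc_right[OF q] \<open>snd (Q v) > _\<close> by auto
    then show ?thesis using \<delta>(1) D q0 by (intro exI[of _ "min d \<delta>"]) auto
  qed
  show "\<exists>\<delta>>0. \<forall>s\<in>{0<..<\<delta>}. x + s *\<^sub>R v \<notin> D" if "snd (Q v) < f' (fst (Q v))"
  proof -
    obtain d where "d > 0" "\<And>h. 0 < h \<Longrightarrow> h < d \<Longrightarrow> q (0 + h) < q 0"
      using DERIV_neg_dec_right[OF q] \<open>snd (Q v) < _\<close> by auto
    then show ?thesis using \<delta>(1) D q0 by (intro exI[of _ "min d \<delta>"]) (auto simp: not_less less_imp_le)
  qed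
qed

lemma lipschitz_derivative_bound:
  assumes "(f has_derivative f') (at y)"
  shows "\<bar>f' h\<bar> \<le> L * norm h"
proof (rule field_le_epsilon)
  fix e :: real assume e: "e > 0"
  show "\<bar>f' h\<bar> \<le> L * norm h + e"
  proof (cases "h = 0")
    case True
    then show ?thesis using e linear_0[OF has_derivative_linear[OF assms]] by simp
  next
    case False
    define e' where "e' = e / norm h"
    have e': "e' > 0" using e False by (simp add: e'_def)
    then obtain d where d: "d > 0" "\<And>z. norm (z - y) < d \<Longrightarrow> norm (f z - f y - f' (z - y)) \<le> e' * norm (z - y)"
      using assms unfolding has_derivative_at_alt by blast
    define t where "t = d / (2 * norm h)"
    have t: "t > 0" "norm (t *\<^sub>R h) < d" using d(1) False by (auto simp: t_def)
    have "norm (f (y + t *\<^sub>R h) - f y - f' (t *\<^sub>R h)) \<le> e' * norm (t *\<^sub>R h)"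
      using d(2)[of "y + t *\<^sub>R h"] t by simp
    moreover have "\<bar>f (y + t *\<^sub>R h) - f y\<bar> \<le> L * norm (t *\<^sub>R h)"
      using lipschitz_onD[OF lipschitz, of "y + t *\<^sub>R h" y] by (simp add: dist_norm)
    ultimately have "\<bar>f' (t *\<^sub>R h)\<bar> \<le> L * norm (t *\<^sub>R h) + e' * norm (t *\<^sub>R h)"
      by simp
    also have "f' (t *\<^sub>R h) = t * f' h"
      using linear_cmul[OF has_derivative_linear[OF assms]] by simp
    finally have "t * \<bar>f' h\<bar> \<le> t * (L * norm h + e' * norm h)"
      using t(1) by (simp add: abs_mult algebra_simps)
    then show ?thesis using t(1) False by (simp add: e'_def)
  qed
qed

text \<open>A regular parametrization forces differentiability of \<open>f\<close>. The Lipschitz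
  bound passes to the derivative as \<open>\<bar>A2 h\<bar> \<le> L * norm (A1 h)\<close>, so no
  tangent vector is vertical; with injectivity of the full derivative this makes the horizontal part
  \<open>A1\<close> injective, hence invertible by equality of dimensions. Locally \<open>f\<close>
  is then the vertical component after the inverse of the horizontal one.\<close>

lemma graph_param:
  assumes C1: "C1_param (frontier D) W \<phi> \<phi>'" and w: "w \<in> W" "\<phi> w \<in> ball x0 \<epsilon>"
  shows "\<exists>f'. (f has_derivative f') (at (fst (chart (\<phi> w)))) \<and>
      (\<forall>h. snd (Q (blinfun_apply (\<phi>' w) h)) = f' (fst (Q (blinfun_apply (\<phi>' w) h)))) \<and>
      surj (\<lambda>h. fst (Q (blinfun_apply (\<phi>' w) h)))"
proof -
  let ?A = "blinfun_apply (\<phi>' w)"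
  define A1 A2 where "A1 h = fst (Q (?A h))" and "A2 h = snd (Q (?A h))" for h
  define \<phi>1 \<phi>2 where "\<phi>1 z = fst (chart (\<phi> z))" and "\<phi>2 z = snd (chart (\<phi> z))" for z
  have W: "open W" and op: "openin (top_of_set (frontier D)) (\<phi> ` W)"
    and d: "(\<phi> has_derivative ?A) (at w)" and inj: "inj ?A"
    using C1 w(1) by (auto simp: C1_param_def)
  obtain \<psi> where \<psi>: "homeomorphism W (\<phi> ` W) \<phi> \<psi>" using C1 by (auto simp: C1_param_def)
  have dQ: "((\<lambda>z. chart (\<phi> z)) has_derivative (\<lambda>h. Q (?A h))) (at w)"
    unfolding chart_def using bounded_linear.has_derivative[OF Q_facts(2) d]
    by (auto intro!: derivative_eq_intros)
  have d1: "(\<phi>1 has_derivative A1) (at w)" and d2: "(\<phi>2 has_derivative A2) (at w)"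
    unfolding \<phi>1_def \<phi>2_def A1_def A2_def using dQ
    by (auto intro: has_derivative_fst has_derivative_snd)
  define N where "N = W \<inter> \<phi> -` ball x0 \<epsilon>"
  have "continuous_on W \<phi>" using \<psi> by (simp add: homeomorphism_def)
  then have N: "open N" "w \<in> N"
    using W w by (auto simp: N_def intro!: continuous_open_preimage)
  have graph: "\<phi>2 z = f (\<phi>1 z)" if "z \<in> N" for z
  proof -
    have "\<phi> z \<in> frontier D" using op that by (auto simp: N_def dest: openin_imp_subset)
    then show ?thesis using that chart_frontier[of "\<phi> z"] by (auto simp: N_def \<phi>1_def \<phi>2_def)
  qed
  \<comment> \<open>The Lipschitz inequality is used for a single small increment
    \<open>t *\<^sub>R h\<close>; the errors of the linearisations of \<open>\<phi>1\<close> and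
    \<open>\<phi>2\<close> contribute \<open>L * e\<close> and \<open>e\<close>, and the factor
    \<open>t\<close> cancels by homogeneity.\<close>
  have A2_bound: "\<bar>A2 h\<bar> \<le> L * norm (A1 h) + e * ((L + 1) * norm h)" if e: "e > 0" for e h
  proof (cases "h = 0")
    case True
    then show ?thesis using linear_0[OF has_derivative_linear[OF d2]] e
      lipschitz_on_nonneg[OF lipschitz] by simp
  next
    case False
    obtain r1 where r1: "r1 > 0" "\<And>z. norm (z - w) < r1 \<Longrightarrow> norm (\<phi>1 z - \<phi>1 w - A1 (z - w)) \<le> e * norm (z - w)"
      using d1 e unfolding has_derivative_at_alt by blast
    obtain r2 where r2: "r2 > 0" "\<And>z. norm (z - w) < r2 \<Longrightarrow> norm (\<phi>2 z - \<phi>2 w - A2 (z - w)) \<le> e * norm (z - w)"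
      using d2 e unfolding has_derivative_at_alt by blast
    obtain r3 where r3: "r3 > 0" "ball w r3 \<subseteq> N" using N open_contains_ball by blast
    define r where "r = min r1 (min r2 r3)"
    have r: "r > 0" "r \<le> r1" "r \<le> r2" "r \<le> r3" using r1 r2 r3 by (auto simp: r_def)
    define t where "t = r / (2 * norm h)"
    have t: "t > 0" using r False by (auto simp: t_def)
    have "norm (t *\<^sub>R h) = r / 2" using r False by (auto simp: t_def)
    then have tr: "norm (t *\<^sub>R h) < r1" "norm (t *\<^sub>R h) < r2" "norm (t *\<^sub>R h) < r3"
      using r by auto
    let ?z = "w + t *\<^sub>R h"
    have 1: "norm (\<phi>1 ?z - \<phi>1 w - A1 (t *\<^sub>R h)) \<le> e * norm (t *\<^sub>R h)"
      using r1(2)[of ?z] tr by simp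
    have 2: "norm (\<phi>2 ?z - \<phi>2 w - A2 (t *\<^sub>R h)) \<le> e * norm (t *\<^sub>R h)"
      using r2(2)[of ?z] tr by simp
    have "?z \<in> N" using r3(2) tr(3) by (auto simp: subset_eq dist_norm)
    then have "\<bar>\<phi>2 ?z - \<phi>2 w\<bar> \<le> L * norm (\<phi>1 ?z - \<phi>1 w)"
      using lipschitz_onD[OF lipschitz, of "\<phi>1 ?z" "\<phi>1 w"] graph[OF \<open>?z \<in> N\<close>] graph[OF N(2)] by (simp add: dist_norm)
    also have "\<dots> \<le> L * (norm (A1 (t *\<^sub>R h)) + e * norm (t *\<^sub>R h))"
    proof (rule mult_left_mono[OF _ lipschitz_on_nonneg[OF lipschitz]])
      show "norm (\<phi>1 ?z - \<phi>1 w) \<le> norm (A1 (t *\<^sub>R h)) + e * norm (t *\<^sub>R h)"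
        using 1 norm_triangle_sub[of "\<phi>1 ?z - \<phi>1 w" "A1 (t *\<^sub>R h)"] by linarith
    qed
    finally have "\<bar>A2 (t *\<^sub>R h)\<bar> \<le> L * (norm (A1 (t *\<^sub>R h)) + e * norm (t *\<^sub>R h)) + e * norm (t *\<^sub>R h)"
      using 2 by simp
    moreover have "A1 (t *\<^sub>R h) = t *\<^sub>R A1 h" "A2 (t *\<^sub>R h) = t * A2 h"
      using linear_cmul[OF has_derivative_linear[OF d1]] linear_cmul[OF has_derivative_linear[OF d2]] by auto
    ultimately have "t * \<bar>A2 h\<bar> \<le> t * (L * norm (A1 h) + e * ((L + 1) * norm h))"
      using t by (simp add: abs_mult algebra_simps)
    then show ?thesis using t by simp
  qed
  have A2_le: "\<bar>A2 h\<bar> \<le> L * norm (A1 h)" for h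
  proof (rule field_le_epsilon)
    fix e :: real assume e: "e > 0"
    let ?k = "(L + 1) * norm h + 1"
    have k: "?k > 0" using lipschitz_on_nonneg[OF lipschitz] by (simp add: add_nonneg_pos)
    then have "\<bar>A2 h\<bar> \<le> L * norm (A1 h) + e / ?k * ((L + 1) * norm h)"
      using e by (intro A2_bound) simp
    also have "e / ?k * ((L + 1) * norm h) \<le> e"
      using k e by (simp add: divide_simps)
    finally show "\<bar>A2 h\<bar> \<le> L * norm (A1 h) + e" by simp
  qed
  have lin1: "linear A1" using d1 by (rule has_derivative_linear)
  have "inj A1"
  proof (subst linear_injective_0[OF lin1], intro allI impI)
    fix h assume "A1 h = 0"
    then have "Q (?A h) = 0" using A2_le[of h] by (auto simp: A1_def A2_def prod_eq_iff)
    then have "?A h = 0" using Q_facts(3)[of "?A h"] by simp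
    then show "h = 0" using inj by (metis blinfun.zero_right injD)
  qed
  then obtain B where B: "linear B" "B \<circ> A1 = id"
    using linear_injective_left_inverse[OF lin1] by blast
  define y where "y = \<phi>1 w"
  obtain G where G: "open G" "\<phi> ` W = frontier D \<inter> G" using op by (auto simp: openin_open)
  define T where "T = graph_point -` (ball x0 \<epsilon> \<inter> G)"
  have yw: "graph_point y = \<phi> w"
    unfolding y_def \<phi>1_def using w G by (intro frontier_graph_point) auto
  have T: "open T" "y \<in> T"
    using G w yw by (auto simp: T_def intro!: open_vimage open_Int continuous_graph_point)
  \<comment> \<open>Near \<open>y\<close> this is a right inverse of \<open>\<phi>1\<close>. Its
    continuity, inherited from the homeomorphism, is what the inverse derivative rule requires in
    addition to invertibility of \<open>A1\<close>.\<close>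
  define g where "g z = \<psi> (graph_point z)" for z
  have gT: "graph_point z \<in> \<phi> ` W" if "z \<in> T" for z
    using that G(2) chart_frontier[of "graph_point z"] by (auto simp: T_def graph_point_def)
  have \<phi>g: "\<phi> (g z) = graph_point z" if "z \<in> T" for z
    unfolding g_def using homeomorphism_apply2[OF \<psi> gT[OF that]] .
  have \<phi>1g: "\<phi>1 (g z) = z" if "z \<in> T" for z
    by (simp add: \<phi>1_def \<phi>g[OF that]) (simp add: graph_point_def)
  have gy: "g y = w" using homeomorphism_apply1[OF \<psi> w(1)] by (simp add: g_def yw)
  have "continuous_on T g"
    unfolding g_def by (rule continuous_on_compose2[OF _ continuous_graph_point, of "\<phi> ` W"])
      (use \<psi> gT in \<open>auto simp: homeomorphism_def\<close>)
  then have "isCont g y" using T by (simp add: continuous_on_eq_continuous_at)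
  then have "(g has_derivative B) (at y)"
    using d1 B T \<phi>1g gy
    by (intro has_derivative_inverse_basic[of \<phi>1 A1 g y B T]) (auto simp: linear_conv_bounded_linear)
  moreover have "(\<phi>2 has_derivative A2) (at (g y))" using d2 gy by simp
  ultimately have "((\<lambda>z. \<phi>2 (g z)) has_derivative (\<lambda>h. A2 (B h))) (at y)"
    by (rule has_derivative_compose)
  then have df: "(f has_derivative (\<lambda>h. A2 (B h))) (at y)"
    by (rule has_derivative_transform_within_open[OF _ T])
      (simp add: \<phi>2_def \<phi>g, simp add: graph_point_def)
  have "surj A1" using linear_injective_imp_surjective[OF lin1 \<open>inj A1\<close>] by simp
  moreover have "A2 h = A2 (B (A1 h))" for h using B(2) by (metis comp_apply id_apply)
  ultimately show ?thesis
    using df unfolding y_def \<phi>1_def A1_def A2_def by blast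
qed

text \<open>The definition allows any parametrization through the point, so the normal must be shown
  not to depend on it. By \<open>graph_param\<close> every parametrization has the graph of the one
  derivative \<open>f'\<close> as tangent space, which fixes the line of \<open>Q n\<close>; the
  inward clause fixes the orientation, since a downward normal would start a ray outside
  \<open>D\<close>.\<close>

lemma is_inward_normal_graph:
  assumes C1: "C1_param (frontier D) W \<phi> \<phi>'" and w: "w \<in> W" "\<phi> w \<in> ball x0 \<epsilon>"
  obtains f' where "(f has_derivative f') (at (fst (chart (\<phi> w))))"
    and "\<And>n. is_inward_normal D (\<phi> w) n \<longleftrightarrow> norm n = 1 \<and> 0 < snd (Q n) \<and> (\<forall>h. fst (Q n) \<bullet> h = - (snd (Q n) * f' h))"
proof -
  define x where "x = \<phi> w"
  have xF: "x \<in> frontier D"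
    using C1 w by (auto simp: C1_param_def x_def dest: openin_imp_subset)
  obtain f' where f': "(f has_derivative f') (at (fst (chart x)))"
      and tangent: "\<And>h. snd (Q (blinfun_apply (\<phi>' w) h)) = f' (fst (Q (blinfun_apply (\<phi>' w) h)))"
    using graph_param[OF C1 w] by (auto simp: x_def)
  note lin = has_derivative_linear[OF f']
  have eqn: "fst (Q n) \<bullet> fst (Q (blinfun_apply (\<phi>1' w1) y)) + snd (Q n) * snd (Q (blinfun_apply (\<phi>1' w1) y))
      = n \<bullet> blinfun_apply (\<phi>1' w1) y" for n y w1 and \<phi>1' :: "'p \<Rightarrow> 'p \<Rightarrow>\<^sub>L ('p \<times> real)"
    using Q_facts(4)[of n "blinfun_apply (\<phi>1' w1) y"] by (simp add: inner_prod_def)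
  have inward: "is_inward_normal D x n" if n: "norm n = 1" "0 < snd (Q n)" "\<And>h. fst (Q n) \<bullet> h = - (snd (Q n) * f' h)" for n
  proof -
    have "n \<bullet> blinfun_apply (\<phi>' w) y = 0" for y
      unfolding eqn[symmetric] using n(3) tangent[of y] by simp
    moreover have "f' (fst (Q n)) < snd (Q n)"
    proof -
      have "snd (Q n) * f' (fst (Q n)) \<le> 0"
        using n(3)[of "fst (Q n)"] inner_ge_zero[of "fst (Q n)"] by linarith
      then show ?thesis using n(2) by (simp add: mult_le_0_iff)
    qed
    ultimately show ?thesis
      unfolding is_inward_normal_def
      using n(1) C1 w(1) ray_near_frontier(1)[of x f' n] f' xF w(2) x_def by blast
  qed
  have "norm n = 1 \<and> 0 < snd (Q n) \<and> (\<forall>h. fst (Q n) \<bullet> h = - (snd (Q n) * f' h))"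
    if inn: "is_inward_normal D x n" for n
  proof -
    obtain W1 \<phi>1 \<phi>1' w1 where 1: "C1_param (frontier D) W1 \<phi>1 \<phi>1'" "w1 \<in> W1" "\<phi>1 w1 = x"
        "\<And>y. n \<bullet> blinfun_apply (\<phi>1' w1) y = 0" and n: "norm n = 1"
      and dn: "\<exists>\<delta>>0. \<forall>t \<in> {0<..<\<delta>}. x + t *\<^sub>R n \<in> D"
      using inn unfolding is_inward_normal_def by blast
    obtain f1' where "(f has_derivative f1') (at (fst (chart x)))"
      and t1: "\<And>h. snd (Q (blinfun_apply (\<phi>1' w1) h)) = f1' (fst (Q (blinfun_apply (\<phi>1' w1) h)))"
      and surj: "surj (\<lambda>h. fst (Q (blinfun_apply (\<phi>1' w1) h)))"
      using graph_param[OF 1(1,2)] 1(3) w(2) by (auto simp: x_def)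
    then have f1': "f1' = f'" using f' has_derivative_unique by blast
    have perp: "fst (Q n) \<bullet> h = - (snd (Q n) * f' h)" for h
    proof -
      obtain y where y: "h = fst (Q (blinfun_apply (\<phi>1' w1) y))" using surjD[OF surj, of h] by auto
      have "snd (Q (blinfun_apply (\<phi>1' w1) y)) = f' h" using t1[of y] f1' y by simp
      then show ?thesis using eqn[of n \<phi>1' w1 y] 1(4)[of y] unfolding y[symmetric] by simp
    qed
    have "snd (Q n) \<noteq> 0"
    proof
      assume 0: "snd (Q n) = 0"
      then have "fst (Q n) = 0" using perp[of "fst (Q n)"] by simp
      then have "Q n = 0" using 0 by (simp add: prod_eq_iff)
      then show False using n Q_facts(3)[of n] by simp
    qed
    moreover have "\<not> snd (Q n) < 0"
    proof
      assume neg: "snd (Q n) < 0"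
      have "snd (Q n) * f' (fst (Q n)) \<le> 0"
        using perp[of "fst (Q n)"] inner_ge_zero[of "fst (Q n)"] by linarith
      then have "snd (Q n) < f' (fst (Q n))" using neg by (simp add: mult_le_0_iff)
      then obtain \<delta>1 where "\<delta>1 > 0" "\<forall>s\<in>{0<..<\<delta>1}. x + s *\<^sub>R n \<notin> D"
        using ray_near_frontier(2)[of x f' n] f' xF w(2) x_def by blast
      moreover obtain \<delta>2 where "\<delta>2 > 0" "\<forall>s\<in>{0<..<\<delta>2}. x + s *\<^sub>R n \<in> D" using dn by blast
      ultimately show False by (auto dest!: bspec[where x = "min \<delta>1 \<delta>2 / 2"])
    qed
    ultimately show ?thesis using n perp by auto
  qed
  with inward that[of f'] f' show ?thesis unfolding x_def by blast
qed

text \<open>In chart coordinates the normal is \<open>(- a, 1)\<close> divided by its norm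
  \<open>k\<close>, with \<open>a\<close> the gradient of \<open>f\<close>. The bounded quantity
  \<open>1 / snd (Q n)\<close> is therefore \<open>k\<close>, the area element of the graph; the
  bound later makes the flux over a chart finite.\<close>

lemma inward_normal_graph:
  assumes C1: "C1_param (frontier D) W \<phi> \<phi>'" and w: "w \<in> W" "\<phi> w = x" and x: "x \<in> ball x0 \<epsilon>"
  defines "n \<equiv> inward_normal D x"
  shows "snd (Q n) > 0" "norm n = 1" "1 / snd (Q n) \<le> 1 + L"
    "(f has_derivative (\<lambda>h. - (fst (Q n) \<bullet> h / snd (Q n)))) (at (fst (chart x)))"
proof -
  have w': "\<phi> w \<in> ball x0 \<epsilon>" using x w by simp
  obtain f' where f': "(f has_derivative f') (at (fst (chart x)))"
    and iff: "\<And>n. is_inward_normal D x n \<longleftrightarrow> norm n = 1 \<and> 0 < snd (Q n) \<and> (\<forall>h. fst (Q n) \<bullet> h = - (snd (Q n) * f' h))"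
    using is_inward_normal_graph[OF C1 w(1) w'] w(2) by metis
  define a where "a = (\<Sum>b\<in>Basis. f' b *\<^sub>R b)"
  have a: "a \<bullet> h = f' h" for h
  proof -
    have "f' h = f' (\<Sum>b\<in>Basis. (h \<bullet> b) *\<^sub>R b)" by (simp add: euclidean_representation)
    also have "\<dots> = (\<Sum>b\<in>Basis. (h \<bullet> b) * f' b)"
      using has_derivative_linear[OF f'] by (simp add: linear_sum linear_cmul)
    also have "\<dots> = a \<bullet> h" by (simp add: a_def inner_sum_left inner_commute[of h] mult.commute)
    finally show ?thesis ..
  qed
  define k where "k = norm (- a, 1::real)"
  have k: "k > 0" by (simp add: k_def prod_eq_iff)
  define n0 where "n0 = inv Q ((1 / k) *\<^sub>R (- a, 1))"
  have Qn0: "Q n0 = (1 / k) *\<^sub>R (- a, 1)" by (simp add: n0_def Q_inv)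
  have "norm (Q n0) = \<bar>1 / k\<bar> * k" unfolding Qn0 norm_scaleR by (simp add: k_def)
  then have "norm n0 = 1" using Q_facts(3)[of n0] k by simp
  then have n0: "is_inward_normal D x n0"
    unfolding iff using k by (simp add: Qn0 a)
  have uniq: "m = n0" if "is_inward_normal D x m" for m
  proof -
    have m: "norm m = 1" "0 < snd (Q m)" "\<And>h. fst (Q m) \<bullet> h = - (snd (Q m) * f' h)"
      using that iff by auto
    have "fst (Q m) = - snd (Q m) *\<^sub>R a"
      by (rule vector_eq_rdot[THEN iffD1]) (simp add: m(3) a)
    then have Qm: "Q m = snd (Q m) *\<^sub>R (- a, 1)" by (simp add: prod_eq_iff)
    then have "norm (Q m) = \<bar>snd (Q m)\<bar> * k" by (metis k_def norm_scaleR)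
    then have "snd (Q m) = 1 / k" using m k Q_facts(3)[of m] by (simp add: field_simps)
    then have "Q m = Q n0" using Qm by (simp add: Qn0)
    then show "m = n0" using Q_inv(1) by metis
  qed
  have n: "n = n0" unfolding n_def inward_normal_def by (rule the_equality, rule n0, rule uniq)
  show "snd (Q n) > 0" "norm n = 1" using n0 unfolding n iff by auto
  have "norm a * norm a = \<bar>f' a\<bar>" using a[of a] inner_ge_zero[of a] by (simp add: dot_square_norm power2_eq_square)
  also have "\<dots> \<le> L * norm a" by (rule lipschitz_derivative_bound[OF f'])
  finally have "norm a \<le> L" using lipschitz_on_nonneg[OF lipschitz] by (cases "a = 0") auto
  moreover have "k \<le> norm a + 1" unfolding k_def using norm_Pair_le[of "- a" "1::real"] by simp
  ultimately show "1 / snd (Q n) \<le> 1 + L" by (simp add: n Qn0)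
  have "(\<lambda>h. - (fst (Q n) \<bullet> h / snd (Q n))) = f'"
    using k by (auto simp: n Qn0 a)
  then show "(f has_derivative (\<lambda>h. - (fst (Q n) \<bullet> h / snd (Q n)))) (at (fst (chart x)))"
    using f' by simp
qed

end

section \<open>Flux through a Borel piece of a Lipschitz graph with a normal field\<close>

locale bounded_lipschitz_chart = lipschitz_chart D x0 \<epsilon> Q c f L + bounded_open D
  for D :: "('p::euclidean_space \<times> real) set" and x0 \<epsilon> Q c f L +
  fixes A :: "('p \<times> real) set" and n :: "'p \<times> real \<Rightarrow> 'p \<times> real"
  assumes A_borel [measurable]: "A \<in> sets borel" and n_borel [measurable]: "n \<in> borel_measurable borel"
    and A_chart: "x \<in> A \<Longrightarrow> x \<in> ball x0 \<epsilon>" and A_frontier: "x \<in> A \<Longrightarrow> x \<in> frontier D"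
    and n_pos: "x \<in> A \<Longrightarrow> snd (Q (n x)) > 0"
    and n_deriv: "x \<in> A \<Longrightarrow>
      (f has_derivative (\<lambda>h. - (fst (Q (n x)) \<bullet> h / snd (Q (n x))))) (at (fst (chart x)))"
begin

lemma Q_measurable [measurable]: "Q \<in> borel_measurable borel"
  by (rule orthogonal_transformation_borel_measurable[OF Q])

lemma fst_chart_graph_point [simp]: "fst (chart (graph_point y)) = y"
  by (simp add: graph_point_def)

text \<open>The Jacobian of \<open>(y, s) \<mapsto> graph_point y + s v\<close>.\<close>

definition jac :: "'p \<Rightarrow> 'p \<times> real \<Rightarrow> real" where
  "jac y v = n (graph_point y) \<bullet> v / snd (Q (n (graph_point y)))"

lemma jac_measurable [measurable (raw)]:
  assumes [measurable]: "g \<in> borel_measurable M" "h \<in> borel_measurable M"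
  shows "(\<lambda>x. jac (g x) (h x)) \<in> borel_measurable M"
  unfolding jac_def by measurable

text \<open>By \<open>n_deriv\<close> the second summand is minus the derivative of \<open>f\<close>
  along \<open>fst (Q v)\<close>, so \<open>jac\<close> is the rate at which a ray in direction
  \<open>v\<close> rises above the graph.\<close>

lemma jac_alt:
  assumes "graph_point y \<in> A"
  shows "jac y v = snd (Q v) + fst (Q (n (graph_point y))) \<bullet> fst (Q v) / snd (Q (n (graph_point y)))"
proof -
  have "n (graph_point y) \<bullet> v = Q (n (graph_point y)) \<bullet> Q v" by (simp only: Q_facts(4))
  then show ?thesis
    unfolding jac_def using n_pos[OF assms] by (simp only: inner_prod_def add_divide_distrib) simp
qed

text \<open>The sign of \<open>jac\<close> tells whether \<open>v\<close> points into
  \<open>D\<close>. Tangential directions remain undecided; they have weight 0 in the integrals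
  below.\<close>

lemma chord_iff_jac:
  assumes A: "graph_point y \<in> A" and v: "norm v = 1"
  shows "jac y v > 0 \<Longrightarrow> (graph_point y, v) \<in> chords D"
    and "jac y v < 0 \<Longrightarrow> (graph_point y, v) \<notin> chords D"
proof -
  let ?\<xi> = "graph_point y" and ?f' = "\<lambda>h. - (fst (Q (n (graph_point y))) \<bullet> h / snd (Q (n (graph_point y))))"
  have df: "(f has_derivative ?f') (at (fst (chart ?\<xi>)))" using n_deriv[OF A] by simp
  note ray = ray_near_frontier[OF A_chart[OF A] A_frontier[OF A] df, of v]
  show "(?\<xi>, v) \<in> chords D" if "jac y v > 0"
  proof -
    have "snd (Q v) > ?f' (fst (Q v))" using that unfolding jac_alt[OF A] by simp
    from ray(1)[OF this] obtain \<delta> where \<delta>: "\<delta> > 0" "\<And>s. 0 < s \<Longrightarrow> s < \<delta> \<Longrightarrow> ?\<xi> + s *\<^sub>R v \<in> D"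
      by auto
    \<comment> \<open>A point of the initial piece of the ray, whose backward flight returns to the
      given boundary point; the chord through it is the chord wanted.\<close>
    define x where "x = ?\<xi> + (\<delta>/2) *\<^sub>R v"
    have x: "x \<in> D" unfolding x_def using \<delta> by (intro \<delta>(2)) auto
    have "flight_time D x (- v) = \<delta>/2"
    proof (rule flight_time_eqI)
      fix t assume "0 < t" "t < \<delta>/2"
      then have "?\<xi> + (\<delta>/2 - t) *\<^sub>R v \<in> D" by (intro \<delta>(2)) auto
      then show "x + t *\<^sub>R - v \<notin> frontier D" using D_not_frontier by (auto simp: x_def algebra_simps)
    qed (use \<delta> A_frontier[OF A] in \<open>auto simp: x_def\<close>)
    then have "chord_through D (x, v) = (?\<xi>, v)"
      by (simp add: chord_through_def hit_point_def x_def)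
    then show ?thesis using chord_through(1)[OF x v] by simp
  qed
  show "(?\<xi>, v) \<notin> chords D" if "jac y v < 0"
  proof
    assume c: "(?\<xi>, v) \<in> chords D"
    have "snd (Q v) < ?f' (fst (Q v))" using that unfolding jac_alt[OF A] by simp
    from ray(2)[OF this] obtain \<delta> where \<delta>: "\<delta> > 0" "\<And>s. 0 < s \<Longrightarrow> s < \<delta> \<Longrightarrow> ?\<xi> + s *\<^sub>R v \<notin> D"
      by auto
    define s where "s = min \<delta> (flight_time D ?\<xi> v) / 2"
    have "0 < s" "s < \<delta>" "s < flight_time D ?\<xi> v"
      using \<delta>(1) chordsD(3)[OF c] by (auto simp: s_def)
    then show False using \<delta>(2) chordsD(4)[OF c] by blast
  qed
qed

lemma nn_integral_unchart:
  assumes [measurable]: "F \<in> borel_measurable borel"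
  shows "(\<integral>\<^sup>+x. F x \<partial>lborel) = (\<integral>\<^sup>+y. \<integral>\<^sup>+z. F (unchart (y, z)) \<partial>lborel \<partial>lborel)"
proof -
  have "(\<integral>\<^sup>+x. F x \<partial>lborel) = (\<integral>\<^sup>+x. F (inv Q x) \<partial>lborel)"
    by (rule nn_integral_lborel_orthogonal[OF Q_inv(3), symmetric]) measurable
  also have "\<dots> = (\<integral>\<^sup>+x. F (inv Q (x + - c)) \<partial>lborel)"
    using orthogonal_transformation_borel_measurable[OF Q_inv(3)]
    by (intro nn_integral_lborel_translate[symmetric]) measurable
  also have "\<dots> = (\<integral>\<^sup>+x. F (unchart x) \<partial>(lborel \<Otimes>\<^sub>M lborel))"
    by (simp add: unchart_def lborel_prod)
  also have "\<dots> = (\<integral>\<^sup>+y. \<integral>\<^sup>+z. F (unchart (y, z)) \<partial>lborel \<partial>lborel)"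
    by (subst lborel.nn_integral_fst[symmetric]) (simp_all add: lborel_prod borel_prod)
  finally show ?thesis .
qed

text \<open>On a line parallel to the last coordinate axis of the chart, the parametrization
  \<open>(y, s) \<mapsto> graph_point y + s v\<close> has one free variable, so that the one-dimensional change of
  variables suffices.\<close>

lemma chord_slice_change_of_variables:
  fixes y' :: 'p
  assumes v: "norm v = 1" and H [measurable]: "H \<in> borel_measurable borel"
  shows "(\<integral>\<^sup>+z. of_bool (unchart (y', z) \<in> D \<and> fst (chord_through D (unchart (y', z), v)) \<in> A) *
        (ennreal (1 / chord_length D (chord_through D (unchart (y', z), v))) * H (chord_through D (unchart (y', z), v))) \<partial>lborel)
    = (\<integral>\<^sup>+s. (let y = y' - s *\<^sub>R fst (Q v) in
         of_bool (graph_point y \<in> A \<and> (graph_point y, v) \<in> chords D \<and> 0 < s \<and> s < flight_time D (graph_point y) v) *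
        (ennreal \<bar>jac y v\<bar> * (ennreal (1 / flight_time D (graph_point y) v) * H (graph_point y, v)))) \<partial>lborel)"
proof -
  \<comment> \<open>To be above \<open>y'\<close> at distance \<open>s\<close>, a ray must start
    above this base point; \<open>g s\<close> is the height it then has reached.\<close>
  let ?y = "\<lambda>s. y' - s *\<^sub>R fst (Q v)"
  define S where "S = {s. graph_point (?y s) \<in> A \<and> (graph_point (?y s), v) \<in> chords D \<and>
      0 < s \<and> s < flight_time D (graph_point (?y s)) v}"
  define g where "g s = f (?y s) + s * snd (Q v)" for s
  define T where "T = {z. unchart (y', z) \<in> D \<and> fst (chord_through D (unchart (y', z), v)) \<in> A}"
  have S_borel [measurable]: "S \<in> sets borel"
    unfolding S_def using A_borel chords_measurable by measurable
  have T_borel [measurable]: "T \<in> sets borel"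
    unfolding T_def using A_borel D_borel by measurable
  have on_ray: "unchart (y', g s) = graph_point (?y s) + s *\<^sub>R v" for s
  proof -
    have "(y', g s) = (?y s, f (?y s)) + s *\<^sub>R Q v"
      by (simp add: g_def prod_eq_iff)
    then show ?thesis by (simp add: unchart_add graph_point_def)
  qed
  have S: "unchart (y', g s) \<in> D" "chord_through D (unchart (y', g s), v) = (graph_point (?y s), v)"
      "flight_time D (unchart (y', g s)) (- v) = s" if "s \<in> S" for s
    using that point_on_chord[of "graph_point (?y s)" v s] by (auto simp: on_ray S_def)
  have gS: "g ` S = T"
  proof (intro set_eqI iffI)
    fix z assume "z \<in> g ` S"
    then show "z \<in> T" using S by (auto simp: T_def S_def)
  next
    fix z assume z: "z \<in> T"
    define x where "x = unchart (y', z)"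
    have x: "x \<in> D" "fst (chord_through D (x, v)) \<in> A" using z by (auto simp: T_def x_def)
    define b where "b = fst (chord_through D (x, v))"
    define s where "s = flight_time D x (- v)"
    note ct = chord_through[OF x(1) v]
    have bv: "(b, v) \<in> chords D" using ct(1) by (simp add: b_def chord_through_def)
    have gp: "graph_point (fst (chart b)) = b"
      using frontier_graph_point[of b] A_chart[of b] A_frontier[of b] x(2) by (auto simp: b_def)
    have "x = b + s *\<^sub>R v" using ct(5) by (simp add: b_def s_def)
    then have "chart x = chart b + s *\<^sub>R Q v" by (simp add: chart_add)
    then have 1: "(y', z) = chart b + s *\<^sub>R Q v" by (simp add: x_def)
    then have 2: "?y s = fst (chart b)" by (simp add: prod_eq_iff)
    have "snd (chart b) = f (fst (chart b))"
      using chart_frontier[of b] A_chart[of b] A_frontier[of b] x(2) by (auto simp: b_def)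
    then have "g s = z" using 1 by (simp add: g_def 2 prod_eq_iff)
    moreover have "s \<in> S"
    proof -
      have "0 < s" unfolding s_def by (rule flight_from_interior(1)) (use x v in auto)
      moreover have "s < flight_time D b v"
        using ct(2) flight_from_interior(1)[OF x(1) v]
        by (simp add: s_def b_def chord_length_def chord_through_def)
      ultimately show ?thesis using bv x(2) by (simp add: S_def 2 gp) (simp add: b_def)
    qed
    ultimately show "z \<in> g ` S" by blast
  qed
  have cov: "(\<integral>\<^sup>+z. indicator (g ` S) z *
        (ennreal (1 / chord_length D (chord_through D (unchart (y', z), v))) * H (chord_through D (unchart (y', z), v))) \<partial>lborel)
    = (\<integral>\<^sup>+s. indicator S s * (ennreal \<bar>jac (?y s) v\<bar> *
        (ennreal (1 / chord_length D (chord_through D (unchart (y', g s), v))) * H (chord_through D (unchart (y', g s), v)))) \<partial>lborel)"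
  proof (rule nn_integral_change_of_variables_real)
    show "g \<in> borel_measurable borel" unfolding g_def[abs_def] by measurable
    show "g ` S \<in> sets borel" by (simp add: gS)
    \<comment> \<open>The distance \<open>s\<close> is recovered from the height as the backward
      flight time.\<close>
    show "inj_on g S" by (rule inj_onI) (metis S(3))
    show "bounded (g ` S)"
    proof -
      have "g ` S \<subseteq> snd ` (chart ` D)"
        unfolding gS T_def using imageI[of _ D chart] by (force simp: image_iff)
      moreover obtain a r where "\<forall>y\<in>D. dist a y \<le> r" using bounded_D unfolding bounded_def by blast
      then have "bounded (chart ` D)"
        unfolding bounded_def by (intro exI[of _ "chart a"] exI[of _ r]) (auto simp: dist_chart simp del: split_paired_All)
      ultimately show ?thesis using bounded_snd bounded_subset by blast
    qed
    fix s assume "s \<in> S"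
    then have A: "graph_point (?y s) \<in> A" by (simp add: S_def)
    let ?n = "n (graph_point (?y s))"
    have "(f has_derivative (\<lambda>h. - (fst (Q ?n) \<bullet> h / snd (Q ?n)))) (at (?y s))"
      using n_deriv[OF A] by simp
    moreover have "(?y has_derivative (\<lambda>t. - (t *\<^sub>R fst (Q v)))) (at s)"
      by (auto intro!: derivative_eq_intros)
    ultimately have "((\<lambda>s. f (?y s)) has_derivative (\<lambda>t. - (fst (Q ?n) \<bullet> (- (t *\<^sub>R fst (Q v))) / snd (Q ?n)))) (at s)"
      by (rule has_derivative_compose[rotated])
    then have "((\<lambda>s. f (?y s)) has_real_derivative (fst (Q ?n) \<bullet> fst (Q v) / snd (Q ?n))) (at s)"
      by (rule has_derivative_imp_has_field_derivative) (simp add: mult.commute)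
    then show "(g has_real_derivative jac (?y s) v) (at s)"
      unfolding g_def[abs_def] jac_alt[OF A]
      by (auto intro!: derivative_eq_intros)
  qed measurable
  have "(\<integral>\<^sup>+z. of_bool (unchart (y', z) \<in> D \<and> fst (chord_through D (unchart (y', z), v)) \<in> A) *
        (ennreal (1 / chord_length D (chord_through D (unchart (y', z), v))) * H (chord_through D (unchart (y', z), v))) \<partial>lborel)
    = (\<integral>\<^sup>+z. indicator (g ` S) z *
        (ennreal (1 / chord_length D (chord_through D (unchart (y', z), v))) * H (chord_through D (unchart (y', z), v))) \<partial>lborel)"
    by (intro nn_integral_cong) (auto simp: gS T_def indicator_def)
  also note cov
  also have "(\<integral>\<^sup>+s. indicator S s * (ennreal \<bar>jac (?y s) v\<bar> *
        (ennreal (1 / chord_length D (chord_through D (unchart (y', g s), v))) * H (chord_through D (unchart (y', g s), v)))) \<partial>lborel)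
    = (\<integral>\<^sup>+s. (let y = y' - s *\<^sub>R fst (Q v) in
         of_bool (graph_point y \<in> A \<and> (graph_point y, v) \<in> chords D \<and> 0 < s \<and> s < flight_time D (graph_point y) v) *
        (ennreal \<bar>jac y v\<bar> * (ennreal (1 / flight_time D (graph_point y) v) * H (graph_point y, v)))) \<partial>lborel)"
  proof (rule nn_integral_cong)
    fix s
    show "indicator S s * (ennreal \<bar>jac (?y s) v\<bar> *
        (ennreal (1 / chord_length D (chord_through D (unchart (y', g s), v))) * H (chord_through D (unchart (y', g s), v))))
      = (let y = y' - s *\<^sub>R fst (Q v) in
         of_bool (graph_point y \<in> A \<and> (graph_point y, v) \<in> chords D \<and> 0 < s \<and> s < flight_time D (graph_point y) v) *
        (ennreal \<bar>jac y v\<bar> * (ennreal (1 / flight_time D (graph_point y) v) * H (graph_point y, v))))"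
    proof (cases "s \<in> S")
      case True
      then show ?thesis using S(2)[OF True] by (auto simp: S_def chord_length_def Let_def)
    next
      case False
      then show ?thesis by (auto simp: S_def Let_def)
    qed
  qed
  finally show ?thesis .
qed

text \<open>Phase points at fixed \<open>v\<close> are described by foot point and distance
  \<open>s\<close>. The integrand depends on \<open>s\<close> only through its range, the chord
  length, which cancels the weight; what remains is the Jacobian on directions pointing into
  \<open>D\<close>.\<close>

lemma nn_integral_entering:
  assumes v: "norm v = 1" and H [measurable]: "H \<in> borel_measurable borel"
  shows "(\<integral>\<^sup>+x. indicator D x * (ennreal (1 / chord_length D (chord_through D (x, v))) *
        (indicator A (fst (chord_through D (x, v))) * H (chord_through D (x, v)))) \<partial>lborel)
    = (\<integral>\<^sup>+y. indicator A (graph_point y) * (ennreal (max 0 (jac y v)) * H (graph_point y, v)) \<partial>lborel)"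
proof -
  note [measurable] = A_borel D_borel chords_measurable
  have pD [measurable]: "Measurable.pred borel (\<lambda>x. x \<in> D)" "Measurable.pred borel (\<lambda>x. x \<in> A)"
    "Measurable.pred borel (\<lambda>x. x \<in> chords D)" by simp_all
  let ?k = "\<lambda>y s. of_bool (graph_point y \<in> A \<and> (graph_point y, v) \<in> chords D \<and> 0 < s \<and> s < flight_time D (graph_point y) v) *
        (ennreal \<bar>jac y v\<bar> * (ennreal (1 / flight_time D (graph_point y) v) * H (graph_point y, v)))"
  have k [measurable]: "(\<lambda>(y, s). ?k y s) \<in> borel_measurable (borel \<Otimes>\<^sub>M borel)"
    by measurable
  have "(\<integral>\<^sup>+x. indicator D x * (ennreal (1 / chord_length D (chord_through D (x, v))) *
        (indicator A (fst (chord_through D (x, v))) * H (chord_through D (x, v)))) \<partial>lborel)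
     = (\<integral>\<^sup>+x. of_bool (x \<in> D \<and> fst (chord_through D (x, v)) \<in> A) *
        (ennreal (1 / chord_length D (chord_through D (x, v))) * H (chord_through D (x, v))) \<partial>lborel)"
    by (intro nn_integral_cong) (auto simp: indicator_def)
  also have "\<dots> = (\<integral>\<^sup>+y. \<integral>\<^sup>+z. of_bool (unchart (y, z) \<in> D \<and> fst (chord_through D (unchart (y, z), v)) \<in> A) *
        (ennreal (1 / chord_length D (chord_through D (unchart (y, z), v))) * H (chord_through D (unchart (y, z), v))) \<partial>lborel \<partial>lborel)"
    by (rule nn_integral_unchart) measurable
  also have "\<dots> = (\<integral>\<^sup>+y. \<integral>\<^sup>+s. ?k (y - s *\<^sub>R fst (Q v)) s \<partial>lborel \<partial>lborel)"
    by (rule nn_integral_cong) (simp only: chord_slice_change_of_variables[OF v H] Let_def)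
  also have "\<dots> = (\<integral>\<^sup>+s. \<integral>\<^sup>+y. ?k (y - s *\<^sub>R fst (Q v)) s \<partial>lborel \<partial>lborel)"
    by (rule lborel_pair.Fubini') measurable
  \<comment> \<open>With \<open>s\<close> fixed, the slanted base point is removed by a translation
    in \<open>y\<close>.\<close>
  also have "\<dots> = (\<integral>\<^sup>+s. \<integral>\<^sup>+y. ?k y s \<partial>lborel \<partial>lborel)"
  proof (rule nn_integral_cong)
    fix s :: real
    show "(\<integral>\<^sup>+y. ?k (y - s *\<^sub>R fst (Q v)) s \<partial>lborel) = (\<integral>\<^sup>+y. ?k y s \<partial>lborel)"
      using nn_integral_lborel_translate[of "\<lambda>y. ?k y s" "- (s *\<^sub>R fst (Q v))"] by simp
  qed
  also have "\<dots> = (\<integral>\<^sup>+y. \<integral>\<^sup>+s. ?k y s \<partial>lborel \<partial>lborel)"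
    by (rule lborel_pair.Fubini') measurable
  also have "\<dots> = (\<integral>\<^sup>+y. indicator A (graph_point y) * (ennreal (max 0 (jac y v)) * H (graph_point y, v)) \<partial>lborel)"
  proof (rule nn_integral_cong)
    fix y
    show "(\<integral>\<^sup>+s. ?k y s \<partial>lborel) = indicator A (graph_point y) * (ennreal (max 0 (jac y v)) * H (graph_point y, v))"
    proof (cases "graph_point y \<in> A \<and> (graph_point y, v) \<in> chords D")
      case True
      then have c: "(graph_point y, v) \<in> chords D" and A: "graph_point y \<in> A" by auto
      let ?l = "flight_time D (graph_point y) v"
      have l: "?l > 0" by (rule chordsD(3)[OF c])
      have j: "jac y v \<ge> 0" using chord_iff_jac(2)[OF A v] c by (meson not_less)
      have "(\<integral>\<^sup>+s. ?k y s \<partial>lborel) = (\<integral>\<^sup>+s. indicator {0<..<?l} s * (ennreal \<bar>jac y v\<bar> * (ennreal (1 / ?l) * H (graph_point y, v))) \<partial>lborel)"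
        using True by (intro nn_integral_cong) (auto simp: indicator_def)
      also have "\<dots> = ennreal ?l * (ennreal \<bar>jac y v\<bar> * (ennreal (1 / ?l) * H (graph_point y, v)))"
        using l by (subst nn_integral_multc) auto
      also have "\<dots> = (ennreal ?l * ennreal (1 / ?l)) * (ennreal \<bar>jac y v\<bar> * H (graph_point y, v))"
        by (simp add: mult_ac)
      also have "ennreal ?l * ennreal (1 / ?l) = 1"
        using l by (simp add: ennreal_mult'[symmetric])
      finally show ?thesis using j A by simp
    next
      case False
      then have "jac y v \<le> 0" if "graph_point y \<in> A" using that chord_iff_jac(1)[OF that v] by (meson not_less)
      then have "indicator A (graph_point y) * (ennreal (max 0 (jac y v)) * H (graph_point y, v)) = 0"
        by (cases "graph_point y \<in> A") (auto simp: max_def)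
      moreover have "(\<integral>\<^sup>+s. ?k y s \<partial>lborel) = (\<integral>\<^sup>+s. 0 \<partial>(lborel::real measure))"
        by (rule nn_integral_cong) (use False in auto)
      ultimately show ?thesis by simp
    qed
  qed
  finally show ?thesis .
qed

text \<open>The Jacobian splits into \<open>n \<bullet> v\<close> and \<open>1 / snd (Q n)\<close>;
  the latter times \<open>dy\<close> is the area element of the graph. So on \<open>A\<close> the
  flux is surface area times the positive part of the cosine with the normal.\<close>

lemma nn_integral_flux_chart:
  assumes H [measurable]: "H \<in> borel_measurable borel"
  shows "(\<integral>\<^sup>+z. indicator A (fst z) * H z \<partial>flux D)
    = (\<integral>\<^sup>+y. indicator A (graph_point y) * (ennreal (1 / snd (Q (n (graph_point y)))) *
        (\<integral>\<^sup>+v. ennreal (max 0 (n (graph_point y) \<bullet> v)) * H (graph_point y, v) \<partial>surface_measure)) \<partial>lborel)"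
proof -
  have pA [measurable]: "Measurable.pred borel (\<lambda>x. x \<in> A)" by simp
  have "(\<integral>\<^sup>+z. indicator A (fst z) * H z \<partial>flux D)
    = (\<integral>\<^sup>+v. \<integral>\<^sup>+x. indicator D x * (ennreal (1 / chord_length D (chord_through D (x, v))) *
        (indicator A (fst (chord_through D (x, v))) * H (chord_through D (x, v)))) \<partial>lborel \<partial>surface_measure)"
    by (rule nn_integral_flux) measurable
  also have "\<dots> = (\<integral>\<^sup>+v. \<integral>\<^sup>+y. indicator A (graph_point y) * (ennreal (max 0 (jac y v)) * H (graph_point y, v)) \<partial>lborel \<partial>surface_measure)"
    by (rule nn_integral_cong_AE, use AE_surface_measure_norm in eventually_elim) (rule nn_integral_entering[OF _ H])
  also have "\<dots> = (\<integral>\<^sup>+y. \<integral>\<^sup>+v. indicator A (graph_point y) * (ennreal (max 0 (jac y v)) * H (graph_point y, v)) \<partial>surface_measure \<partial>lborel)"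
    by (rule surface_lborel.Fubini'[symmetric]) measurable
  also have "\<dots> = (\<integral>\<^sup>+y. indicator A (graph_point y) * (ennreal (1 / snd (Q (n (graph_point y)))) *
        (\<integral>\<^sup>+v. ennreal (max 0 (n (graph_point y) \<bullet> v)) * H (graph_point y, v) \<partial>surface_measure)) \<partial>lborel)"
  proof (rule nn_integral_cong)
    fix y
    show "(\<integral>\<^sup>+v. indicator A (graph_point y) * (ennreal (max 0 (jac y v)) * H (graph_point y, v)) \<partial>surface_measure)
      = indicator A (graph_point y) * (ennreal (1 / snd (Q (n (graph_point y)))) *
        (\<integral>\<^sup>+v. ennreal (max 0 (n (graph_point y) \<bullet> v)) * H (graph_point y, v) \<partial>surface_measure))"
    proof (cases "graph_point y \<in> A")
      case True
      have "ennreal (max 0 (jac y v)) = ennreal (1 / snd (Q (n (graph_point y)))) * ennreal (max 0 (n (graph_point y) \<bullet> v))" for v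
        using n_pos[OF True] by (subst ennreal_mult[symmetric]) (auto simp: jac_def max_def divide_le_0_iff zero_le_divide_iff)
      then show ?thesis
        using True by (simp add: nn_integral_cmult[symmetric] mult.assoc)
    qed simp
  qed
  finally show ?thesis .
qed

end

section \<open>Sets of Hausdorff measure zero and weak limits\<close>

text \<open>The tube is covered by about \<open>T / \<rho>\<close> balls of radius
  \<open>2 * \<rho>\<close> centred along the line through \<open>p\<close>; each has volume of
  order \<open>\<rho>\<close> to the power of the dimension, so one power of \<open>\<rho>\<close>
  is lost. The bound \<open>\<rho> \<le> 2\<close> only simplifies the constant.\<close>

lemma tube_cover:
  fixes C :: "'a::euclidean_space set"
  assumes C: "p \<in> C" "bounded C" "diameter C < \<rho>" "0 < \<rho>" "\<rho> \<le> 2" and v: "norm v = 1" and T: "0 \<le> T"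
    and s: "Suc s = DIM('a)"
  obtains E where "E \<in> sets borel" "{\<xi> + t *\<^sub>R v |\<xi> t. \<xi> \<in> C \<and> 0 \<le> t \<and> t \<le> T} \<subseteq> E"
    "emeasure lborel E \<le> ennreal (unit_ball_vol DIM('a) * 2 ^ DIM('a) * (T + 2) * \<rho> ^ s)"
proof -
  define K where "K = nat \<lfloor>T / \<rho>\<rfloor>"
  define E where "E = (\<Union>k\<in>{..K}. cball (p + (real k * \<rho>) *\<^sub>R v) (2 * \<rho>))"
  have "{\<xi> + t *\<^sub>R v |\<xi> t. \<xi> \<in> C \<and> 0 \<le> t \<and> t \<le> T} \<subseteq> E"
  proof clarify
    fix \<xi> t assume \<xi>: "\<xi> \<in> C" and t: "0 \<le> t" "t \<le> T"
    define k where "k = nat \<lfloor>t / \<rho>\<rfloor>"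
    have "k \<le> K" unfolding k_def K_def using t C(4) by (intro nat_mono floor_mono divide_right_mono) auto
    have k: "real k = of_int \<lfloor>t / \<rho>\<rfloor>" unfolding k_def using t C(4) by simp
    have "real k \<le> t / \<rho>" "t / \<rho> < real k + 1" unfolding k by linarith+
    then have *: "real k * \<rho> \<le> t" "t < (real k + 1) * \<rho>" using C(4) by (simp_all add: field_simps)
    have "dist (p + (real k * \<rho>) *\<^sub>R v) (\<xi> + t *\<^sub>R v) = norm ((p - \<xi>) + (real k * \<rho> - t) *\<^sub>R v)"
      by (simp add: dist_norm algebra_simps)
    also have "\<dots> \<le> norm (p - \<xi>) + norm ((real k * \<rho> - t) *\<^sub>R v)" by (rule norm_triangle_ineq)
    also have "norm (p - \<xi>) \<le> \<rho>"
      using diameter_bounded_bound[OF C(2,1) \<xi>] C(3) by (simp add: dist_norm)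
    also have "norm ((real k * \<rho> - t) *\<^sub>R v) \<le> \<rho>"
      unfolding norm_scaleR v using * by (simp add: abs_le_iff algebra_simps)
    finally show "\<xi> + t *\<^sub>R v \<in> E" unfolding E_def using \<open>k \<le> K\<close> by auto
  qed
  moreover have "emeasure lborel E \<le> ennreal (unit_ball_vol DIM('a) * 2 ^ DIM('a) * (T + 2) * \<rho> ^ s)"
  proof -
    have V: "unit_ball_vol (real DIM('a)) \<ge> 0" by (rule less_imp_le[OF unit_ball_vol_pos]) simp
    have "emeasure lborel E \<le> (\<Sum>k\<in>{..K}. emeasure lborel (cball (p + (real k * \<rho>) *\<^sub>R v) (2 * \<rho>)))"
      unfolding E_def by (rule emeasure_subadditive_finite) (auto intro: borel_closed)
    also have "\<dots> = (\<Sum>k\<in>{..K}. ennreal (unit_ball_vol DIM('a) * (2 * \<rho>) ^ DIM('a)))"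
      using C(4) by (simp add: emeasure_cball)
    also have "\<dots> = ennreal (real (Suc K) * (unit_ball_vol DIM('a) * (2 * \<rho>) ^ DIM('a)))"
      by (simp only: sum_constant card_atMost ennreal_of_nat_eq_real_of_nat)
        (rule ennreal_mult'[symmetric], simp)
    also have "\<dots> \<le> ennreal ((T / \<rho> + 1) * (unit_ball_vol DIM('a) * (2 * \<rho>) ^ DIM('a)))"
    proof (rule ennreal_leI, rule mult_right_mono)
      have "real K = of_int \<lfloor>T / \<rho>\<rfloor>" unfolding K_def using T C(4) by simp
      then show "real (Suc K) \<le> T / \<rho> + 1" using of_int_floor_le[of "T / \<rho>"] by simp
    qed (use V C(4) in simp)
    also have "(T / \<rho> + 1) * (unit_ball_vol DIM('a) * (2 * \<rho>) ^ DIM('a))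
        = (T + \<rho>) * (unit_ball_vol DIM('a) * 2 ^ DIM('a) * \<rho> ^ s)"
      using C(4) by (simp add: s[symmetric] field_simps)
    also have "ennreal \<dots> \<le> ennreal (unit_ball_vol DIM('a) * 2 ^ DIM('a) * (T + 2) * \<rho> ^ s)"
    proof (rule ennreal_leI)
      have "(T + \<rho>) * (unit_ball_vol DIM('a) * 2 ^ DIM('a) * \<rho> ^ s) \<le> (T + 2) * (unit_ball_vol DIM('a) * 2 ^ DIM('a) * \<rho> ^ s)"
        using V C(4,5) by (intro mult_right_mono) auto
      then show "(T + \<rho>) * (unit_ball_vol DIM('a) * 2 ^ DIM('a) * \<rho> ^ s) \<le> unit_ball_vol DIM('a) * 2 ^ DIM('a) * (T + 2) * \<rho> ^ s"
        by (simp add: mult_ac)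
    qed
    finally show ?thesis .
  qed
  moreover have "E \<in> sets borel" unfolding E_def by (auto intro!: borel_closed)
  ultimately show ?thesis using that by blast
qed

text \<open>Sweeping a set along a segment raises its dimension by one: covers of \<open>N\<close>
  with small sums of \<open>s\<close>-th powers of diameters become covers of the tube with small
  volume.\<close>

lemma hausdorff_null_tube:
  fixes N :: "'a::euclidean_space set"
  assumes N: "hausdorff_measure s N = 0" and s: "Suc s = DIM('a)" and v: "norm v = 1" and T: "0 \<le> T"
    and B: "B \<subseteq> {\<xi> + t *\<^sub>R v |\<xi> t. \<xi> \<in> N \<and> 0 \<le> t \<and> t \<le> T}"
  shows "emeasure lborel B = 0"
proof -
  have le: "emeasure lborel B \<le> 0 + ennreal \<eta>" if \<eta>: "\<eta> > 0" for \<eta>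
  proof -
    define K where "K = unit_ball_vol DIM('a) * 2 ^ DIM('a) * (T + 2)"
    have K: "K > 0" unfolding K_def using T by (intro mult_pos_pos unit_ball_vol_pos) auto
    \<comment> \<open>The cover costs \<open>K\<close> times two contributions of at most
      \<open>\<delta>\<close>: the Hausdorff sum, and the total enlargement of the powers of the
      diameters.\<close>
    define \<delta> where "\<delta> = \<eta> / (2 * K)"
    have \<delta>: "\<delta> > 0" using \<eta> K by (simp add: \<delta>_def)
    have "hausdorff_pre s 1 N \<le> hausdorff_measure s N"
      unfolding hausdorff_measure_def by (rule SUP_upper) simp
    then have "hausdorff_pre s 1 N < ennreal \<delta>" using N \<delta> by simp
    then obtain C :: "nat \<Rightarrow> 'a set" where C: "N \<subseteq> (\<Union>i. C i)" "\<And>i. bounded (C i)" "\<And>i. diameter (C i) \<le> 1"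
      and sum: "(\<Sum>i. if C i = {} then 0 else ennreal (diameter (C i) ^ s)) < ennreal \<delta>"
      unfolding hausdorff_pre_def INF_less_iff by blast
    have ex: "\<exists>E. E \<in> sets borel \<and> {\<xi> + t *\<^sub>R v |\<xi> t. \<xi> \<in> C i \<and> 0 \<le> t \<and> t \<le> T} \<subseteq> E \<and>
        emeasure lborel E \<le> ennreal K * ((if C i = {} then 0 else ennreal (diameter (C i) ^ s)) + ennreal (\<delta> * (1/2) ^ Suc i))" for i
    proof (cases "C i = {}")
      case True
      then show ?thesis by (intro exI[of _ "{}"]) auto
    next
      case False
      then obtain p where p: "p \<in> C i" by auto
      let ?d = "diameter (C i)"
      have d: "?d \<ge> 0" by (rule diameter_ge_0[OF C(2)])
      have "isCont (\<lambda>r::real. r ^ s) ?d" by (intro continuous_intros)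
      then obtain a where a: "a > 0" "\<And>r. \<bar>r - ?d\<bar> < a \<Longrightarrow> \<bar>r ^ s - ?d ^ s\<bar> < \<delta> * (1/2) ^ Suc i"
        unfolding continuous_at_eps_delta using \<delta>
        by (metis (no_types, opaque_lifting) dist_real_def mult_pos_pos half_gt_zero_iff zero_less_one zero_less_power)
      \<comment> \<open>A strictly larger radius is needed, as a covering set may have diameter 0;
        \<open>a\<close> keeps the change of the \<open>s\<close>-th power within the slack of the
        \<open>i\<close>-th set.\<close>
      define \<rho> where "\<rho> = ?d + min 1 (a / 2)"
      have \<rho>: "?d < \<rho>" "0 < \<rho>" "\<rho> \<le> 2" "\<bar>\<rho> - ?d\<bar> < a" using a(1) d C(3)[of i] by (auto simp: \<rho>_def min_def)
      obtain E where E: "E \<in> sets borel" "{\<xi> + t *\<^sub>R v |\<xi> t. \<xi> \<in> C i \<and> 0 \<le> t \<and> t \<le> T} \<subseteq> E"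
        "emeasure lborel E \<le> ennreal (unit_ball_vol DIM('a) * 2 ^ DIM('a) * (T + 2) * \<rho> ^ s)"
        using tube_cover[OF p C(2) \<rho>(1-3) v T s] by blast
      have "\<rho> ^ s \<le> ?d ^ s + \<delta> * (1/2) ^ Suc i" using a(2)[OF \<rho>(4)] by linarith
      note E(3)
      also have "ennreal (unit_ball_vol DIM('a) * 2 ^ DIM('a) * (T + 2) * \<rho> ^ s) \<le> ennreal (K * (?d ^ s + \<delta> * (1/2) ^ Suc i))"
        unfolding K_def[symmetric] using \<open>\<rho> ^ s \<le> _\<close> K by (intro ennreal_leI mult_left_mono) auto
      also have "\<dots> = ennreal K * (ennreal (?d ^ s) + ennreal (\<delta> * (1/2) ^ Suc i))"
        using K d \<delta> by (simp add: ennreal_mult ennreal_plus)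
      finally show ?thesis using E(1,2) False by auto
    qed
    obtain E where EE: "\<forall>i. E i \<in> sets borel \<and> {\<xi> + t *\<^sub>R v |\<xi> t. \<xi> \<in> C i \<and> 0 \<le> t \<and> t \<le> T} \<subseteq> E i \<and>
        emeasure lborel (E i) \<le> ennreal K * ((if C i = {} then 0 else ennreal (diameter (C i) ^ s)) + ennreal (\<delta> * (1/2) ^ Suc i))"
      using choice[OF allI[OF ex]] by (rule exE)
    note E = EE[rule_format, THEN conjunct1] EE[rule_format, THEN conjunct2, THEN conjunct1]
      EE[rule_format, THEN conjunct2, THEN conjunct2]
    have "B \<subseteq> (\<Union>i. E i)"
    proof
      fix x assume "x \<in> B"
      then obtain \<xi> t where x: "x = \<xi> + t *\<^sub>R v" "\<xi> \<in> N" "0 \<le> t" "t \<le> T" using B by blast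
      then obtain i where "\<xi> \<in> C i" using C(1) by blast
      then have "x \<in> E i" using x E(2)[of i] by blast
      then show "x \<in> (\<Union>i. E i)" by blast
    qed
    then have "emeasure lborel B \<le> emeasure lborel (\<Union>i. E i)" using E(1) by (intro emeasure_mono) auto
    also have "\<dots> \<le> (\<Sum>i. emeasure lborel (E i))" using E(1) by (intro emeasure_subadditive_countably) auto
    also have "\<dots> \<le> (\<Sum>i. ennreal K * ((if C i = {} then 0 else ennreal (diameter (C i) ^ s)) + ennreal (\<delta> * (1/2) ^ Suc i)))"
      by (intro suminf_le E(3)) auto
    also have "\<dots> = ennreal K * ((\<Sum>i. if C i = {} then 0 else ennreal (diameter (C i) ^ s)) + (\<Sum>i. ennreal (\<delta> * (1/2) ^ Suc i)))"
      by (simp only: ennreal_suminf_cmult suminf_add[symmetric] summableI)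
    also have "(\<Sum>i. ennreal (\<delta> * (1/2) ^ Suc i)) = ennreal \<delta>"
    proof (rule suminf_ennreal_eq)
      show "(\<lambda>i. \<delta> * (1/2) ^ Suc i) sums \<delta>" using sums_mult[OF power_half_series, of \<delta>] by simp
    qed (use \<delta> in simp)
    also have "ennreal K * ((\<Sum>i. if C i = {} then 0 else ennreal (diameter (C i) ^ s)) + ennreal \<delta>)
        \<le> ennreal K * (ennreal \<delta> + ennreal \<delta>)"
      using sum by (intro mult_left_mono add_right_mono) auto
    also have "\<dots> = ennreal \<eta>"
      using K \<delta> \<eta> by (simp add: ennreal_plus[symmetric] ennreal_mult[symmetric] \<delta>_def del: ennreal_plus)
    finally show ?thesis by simp
  qed
  have "emeasure lborel B \<le> 0" by (rule ennreal_le_epsilon) (rule le)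
  then show ?thesis by simp
qed

text \<open>The indicator of a product of closed sets is a limit of bounded continuous functions.\<close>

lemma measure_eqI_continuous_PiM:
  fixes P P' :: "('i \<Rightarrow> 's::{metric_space, second_countable_topology}) measure"
  assumes K: "finite K" and sets: "sets P = sets (\<Pi>\<^sub>M t\<in>K. borel)" "sets P' = sets (\<Pi>\<^sub>M t\<in>K. borel)"
    and fin: "finite_measure P" "finite_measure P'"
    and eq: "\<And>f :: ('i \<Rightarrow> 's) \<Rightarrow> real. continuous_on UNIV f \<Longrightarrow> bounded (range f) \<Longrightarrow> (LINT z|P. f z) = (LINT z|P'. f z)"
  shows "P = P'"
proof (rule measure_eqI_generator_eq)
  let ?E = "{Pi\<^sub>E K A |A. \<forall>i\<in>K. closed (A i)} :: ('i \<Rightarrow> 's) set set"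
  let ?\<Omega> = "Pi\<^sub>E K (\<lambda>_. UNIV) :: ('i \<Rightarrow> 's) set"
  show "Int_stable ?E"
  proof (rule Int_stableI, clarify)
    fix A B :: "'i \<Rightarrow> 's set" assume "\<forall>i\<in>K. closed (A i)" "\<forall>i\<in>K. closed (B i)"
    then show "\<exists>C. Pi\<^sub>E K A \<inter> Pi\<^sub>E K B = Pi\<^sub>E K C \<and> (\<forall>i\<in>K. closed (C i))"
      by (intro exI[of _ "\<lambda>i. A i \<inter> B i"]) (auto simp: PiE_Int)
  qed
  show "?E \<subseteq> Pow ?\<Omega>" by (auto simp: PiE_iff)
  have "sets (\<Pi>\<^sub>M t\<in>K. (borel :: 's measure)) = sets (\<Pi>\<^sub>M t\<in>K. sigma UNIV (Collect closed))"
    by (simp only: borel_eq_closed)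
  also have "\<dots> = sets (sigma (\<Pi>\<^sub>E i\<in>K. UNIV) {{f\<in>(\<Pi>\<^sub>E i\<in>K. UNIV). \<forall>i\<in>j. f i \<in> A i} | A j. j \<in> {K} \<and> A \<in> Pi j (\<lambda>_. Collect closed)})"
    using K by (intro sets_PiM_sigma) (auto intro!: exI[of _ "{UNIV}"])
  also have "{{f\<in>(\<Pi>\<^sub>E i\<in>K. (UNIV :: 's set)). \<forall>i\<in>j. f i \<in> A i} | A j. j \<in> {K} \<and> A \<in> Pi j (\<lambda>_. Collect closed)} = ?E"
  proof -
    have "{f\<in>(\<Pi>\<^sub>E i\<in>K. (UNIV :: 's set)). \<forall>i\<in>K. f i \<in> A i} = Pi\<^sub>E K A" for A
      by (auto simp: PiE_iff extensional_def)
    then show ?thesis by (simp add: Pi_iff)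
  qed
  finally have "sets (\<Pi>\<^sub>M t\<in>K. (borel :: 's measure)) = sigma_sets ?\<Omega> ?E"
    using \<open>?E \<subseteq> Pow ?\<Omega>\<close> by simp
  then show "sets P = sigma_sets ?\<Omega> ?E" "sets P' = sigma_sets ?\<Omega> ?E"
    using sets by auto
  show "range (\<lambda>i::nat. ?\<Omega>) \<subseteq> ?E" by auto
  show "\<And>i::nat. emeasure P ?\<Omega> \<noteq> \<infinity>" using fin(1) by (simp add: finite_measure.emeasure_finite)
  fix X assume "X \<in> ?E"
  then obtain A where X: "X = Pi\<^sub>E K A" and A: "\<And>i. i \<in> K \<Longrightarrow> closed (A i)" by auto
  show "emeasure P X = emeasure P' X"
  \<comment> \<open>The distance \<open>infdist\<close> to the empty set is 0, which would make the
    corresponding factor of \<open>h\<close> constantly 1.\<close>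
  proof (cases "\<exists>i\<in>K. A i = {}")
    case True
    then have "X = {}" by (auto simp: X PiE_eq_empty_iff)
    then show ?thesis by simp
  next
    case False
    \<comment> \<open>Each factor is 1 on \<open>A i\<close> and vanishes beyond distance
      \<open>1 / n\<close>, so the limit is the indicator because \<open>A i\<close> is
      closed.\<close>
    define h :: "nat \<Rightarrow> ('i \<Rightarrow> 's) \<Rightarrow> real" where "h n z = (\<Prod>i\<in>K. max 0 (1 - real n * infdist (z i) (A i)))" for n z
    have cont: "continuous_on UNIV (h n)" for n
      unfolding h_def[abs_def]
      by (intro continuous_on_prod continuous_on_max continuous_intros
          continuous_on_product_coordinates)
    have h01: "0 \<le> h n z" "h n z \<le> 1" for n z
      unfolding h_def by (auto intro!: prod_nonneg prod_le_1 simp: infdist_nonneg)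
    have bdd: "bounded (range (h n))" for n
      using h01 by (intro boundedI[of _ 1]) auto
    have lim: "(\<lambda>n. h n z) \<longlonglongrightarrow> indicator X z" if z: "z \<in> ?\<Omega>" for z
    proof -
      have "(\<lambda>n. max 0 (1 - real n * infdist (z i) (A i))) \<longlonglongrightarrow> indicator (A i) (z i)" if i: "i \<in> K" for i
      proof (cases "z i \<in> A i")
        case True
        then show ?thesis by simp
      next
        case out: False
        then have pos: "infdist (z i) (A i) > 0"
          using A[OF i] False i by (meson infdist_pos_not_in_closed)
        have "eventually (\<lambda>n. max 0 (1 - real n * infdist (z i) (A i)) = 0) sequentially"
        proof -
          obtain N :: nat where N: "1 / infdist (z i) (A i) < real N" using reals_Archimedean2 by blast
          have "max 0 (1 - real n * infdist (z i) (A i)) = 0" if "N \<le> n" for n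
          proof -
            have "1 / infdist (z i) (A i) < real n" using N that by linarith
            then have "1 < real n * infdist (z i) (A i)" using pos by (simp add: field_simps)
            then show ?thesis by simp
          qed
          then show ?thesis by (auto simp: eventually_sequentially)
        qed
        then show ?thesis using out by (simp add: tendsto_eventually)
      qed
      then have "(\<lambda>n. h n z) \<longlonglongrightarrow> (\<Prod>i\<in>K. indicator (A i) (z i))"
        unfolding h_def by (rule tendsto_prod)
      also have "(\<Prod>i\<in>K. indicator (A i) (z i)) = (indicator X z :: real)"
        using z K by (auto simp: X indicator_def PiE_iff)
      finally show ?thesis .
    qed
    have meas: "h n \<in> borel_measurable (\<Pi>\<^sub>M t\<in>K. borel)" for n
    proof -
      have 1: "(\<lambda>x :: 's. max 0 (1 - real n * infdist x (A i))) \<in> borel_measurable borel" for i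
        by (intro borel_measurable_continuous_onI continuous_on_max continuous_intros)
      have "(\<lambda>z. max 0 (1 - real n * infdist (z i) (A i))) \<in> borel_measurable (\<Pi>\<^sub>M t\<in>K. (borel :: 's measure))"
        if i: "i \<in> K" for i
        by (rule measurable_compose[OF measurable_component_singleton[OF i]]) (rule 1)
      then show ?thesis
        unfolding h_def[abs_def] by (rule borel_measurable_prod)
    qed
    have Xs: "X \<in> sets (\<Pi>\<^sub>M t\<in>K. borel)"
      unfolding X using A K by (intro sets_PiM_I_finite) (auto intro: borel_closed)
    have meas_lim: "(\<lambda>n. LINT z|N. h n z) \<longlonglongrightarrow> measure N X"
      if N: "sets N = sets (\<Pi>\<^sub>M t\<in>K. borel)" "finite_measure N" for N
    proof -
      interpret N: finite_measure N by fact
      have spN: "space N = ?\<Omega>" using sets_eq_imp_space_eq[OF N(1)] by (simp add: space_PiM)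
      have "(\<lambda>n. LINT z|N. h n z) \<longlonglongrightarrow> (LINT z|N. indicator X z)"
      proof (rule integral_dominated_convergence[where w = "\<lambda>_. 1"])
        show "AE z in N. (\<lambda>n. h n z) \<longlonglongrightarrow> indicator X z"
          using lim spN by (intro AE_I2) auto
        show "\<And>n. AE z in N. norm (h n z) \<le> 1" using h01 by auto
      qed (use meas Xs N(1) in \<open>auto simp: measurable_cong_sets[OF N(1) refl]\<close>)
      then show ?thesis using Xs N(1) by (simp add: Int_absorb2 sets.sets_into_space)
    qed
    have "(\<lambda>n. LINT z|P. h n z) = (\<lambda>n. LINT z|P'. h n z)"
      using eq[OF cont bdd] by simp
    then have "measure P X = measure P' X"
      using meas_lim[OF sets(1) fin(1)] meas_lim[OF sets(2) fin(2)] by (simp add: LIMSEQ_unique)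
    then show ?thesis
      using fin by (simp add: finite_measure.emeasure_eq_measure)
  qed
qed auto

section \<open>The flux measure and the cosine law\<close>

type_synonym 'p phase = "('p \<times> real) \<times> ('p \<times> real)"

locale knudsen =
  fixes D R :: "('p::euclidean_space \<times> real) set" and e :: "'p \<times> real"
    and U :: "'p \<times> real \<Rightarrow> 'p \<times> real \<Rightarrow> 'p \<times> real"
  assumes domain: "billiard_domain D R" and bounded: "bounded D" and norm_e: "norm e = 1"
    and frame: "reflection_frame D R e U"
begin

sublocale bounded_open D
  using domain bounded by unfold_locales (auto simp: billiard_domain_def)

lemma R_frontier: "R \<subseteq> frontier D"
  using domain by (auto simp: billiard_domain_def dest: openin_imp_subset)

lemma R_param: "x \<in> R \<Longrightarrow> \<exists>W \<phi> \<phi>' w. C1_param (frontier D) W \<phi> \<phi>' \<and> w \<in> W \<and> \<phi> w = x"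
  using domain unfolding billiard_domain_def image_iff by metis

lemma frontier_borel [measurable]: "frontier D \<in> sets borel"
  by (simp add: borel_closed frontier_closed)

lemma R_borel [measurable]: "R \<in> sets borel"
proof -
  obtain G where "open G" "R = frontier D \<inter> G"
    using domain by (auto simp: billiard_domain_def openin_open)
  then show ?thesis by (simp add: borel_open sets.Int)
qed

lemma U_orthogonal: "x \<in> frontier D \<Longrightarrow> orthogonal_transformation (U x)"
  using frame by (auto simp: reflection_frame_def)

lemma U_e: "x \<in> R \<Longrightarrow> U x e = inward_normal D x"
  using frame by (auto simp: reflection_frame_def)

text \<open>The frame is only constrained on the boundary; \<open>U0\<close> is Borel measurable on the whole space.\<close>

definition U0 :: "'p \<times> real \<Rightarrow> 'p \<times> real \<Rightarrow> 'p \<times> real" where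
  "U0 x v = (if x \<in> frontier D then U x v else 0)"

text \<open>The frame is only assumed measurable in \<open>x\<close> for each fixed vector;
  linearity in the vector and a finite basis give joint measurability.\<close>

lemma U0_measurable [measurable (raw)]:
  assumes [measurable]: "g \<in> borel_measurable M" "h \<in> borel_measurable M"
  shows "(\<lambda>x. U0 (g x) (h x)) \<in> borel_measurable M"
proof -
  have 1 [measurable]: "(\<lambda>x. U0 x v) \<in> borel_measurable borel" for v
    using frame measurable_restrict_space_iff[of "frontier D" borel "0::'p \<times> real" borel "\<lambda>x. U x v"]
    by (simp add: U0_def[abs_def] reflection_frame_def del: split_paired_All)
  have expand: "U0 x v = (\<Sum>b\<in>Basis. (v \<bullet> b) *\<^sub>R U0 x b)" for x v
  proof (cases "x \<in> frontier D")
    case True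
    then have lin: "linear (U x)" using U_orthogonal by (auto simp: orthogonal_transformation_def)
    have "U x v = U x (\<Sum>b\<in>Basis. (v \<bullet> b) *\<^sub>R b)" by (simp add: euclidean_representation)
    then show ?thesis using True by (simp add: U0_def linear_sum[OF lin] linear_cmul[OF lin])
  qed (simp add: U0_def)
  have "(\<lambda>x. U0 (g x) (h x)) = (\<lambda>x. \<Sum>b\<in>Basis. (h x \<bullet> b) *\<^sub>R U0 (g x) b)"
    by (rule ext) (rule expand)
  also have "\<dots> \<in> borel_measurable M"
    by (intro borel_measurable_sum borel_measurable_scaleR measurable_compose[OF assms(1) 1] borel_measurable_inner assms(2)) auto
  finally show ?thesis .
qed

interpretation cosine: prob_space "cosine_law e"
  by (rule prob_space_cosine_law[OF norm_e])

text \<open>For a fixed direction, the points whose chord starts outside \<open>R\<close> lie in the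
  tube swept by a set of Hausdorff measure 0 up to the maximal chord length, hence form a Lebesgue
  null set.\<close>

lemma AE_flux_R: "AE c in flux D. fst c \<in> R"
proof -
  let ?N = "frontier D - R"
  have null: "hausdorff_measure DIM('p) ?N = 0" using domain by (simp add: billiard_domain_def)
  obtain L where L: "L > 0" "\<And>c. c \<in> chords D \<Longrightarrow> chord_length D c \<le> L"
    using chord_length_bounded by blast
  have [measurable]: "Measurable.pred borel (\<lambda>x. x \<in> R)" "Measurable.pred borel (\<lambda>x. x \<in> ?N)" by simp_all
  have "(\<integral>\<^sup>+c. indicator {c. fst c \<in> ?N} c \<partial>flux D) = (\<integral>\<^sup>+v. 0 \<partial>(surface_measure :: ('p \<times> real) measure))"
  proof (subst nn_integral_flux, measurable, rule nn_integral_cong_AE, use AE_surface_measure_norm in eventually_elim)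
    fix v :: "'p \<times> real" assume v: "norm v = 1"
    let ?B = "{x \<in> D. fst (chord_through D (x, v)) \<in> ?N}"
    have [measurable]: "?B \<in> sets borel" using D_borel by measurable
    have "emeasure lborel ?B = 0"
    proof (rule hausdorff_null_tube[OF null _ v, of L])
      show "?B \<subseteq> {\<xi> + t *\<^sub>R v |\<xi> t. \<xi> \<in> ?N \<and> 0 \<le> t \<and> t \<le> L}"
      proof
        fix x assume x: "x \<in> ?B"
        note ct = chord_through[of x v]
        have "flight_time D x (- v) \<le> L"
          using x v ct(2) L(2)[OF ct(1)] flight_time_nonneg[of D x v] by auto
        then show "x \<in> {\<xi> + t *\<^sub>R v |\<xi> t. \<xi> \<in> ?N \<and> 0 \<le> t \<and> t \<le> L}"
          using x v ct(5) flight_time_nonneg[of D x "- v"]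
          by (intro CollectI exI[of _ "fst (chord_through D (x, v))"] exI[of _ "flight_time D x (- v)"]) auto
      qed
    qed (use L in auto)
    then have "AE x in lborel. x \<notin> ?B" by (intro AE_not_in) auto
    then show "(\<integral>\<^sup>+x. indicator D x * (ennreal (1 / chord_length D (chord_through D (x, v))) *
        indicator {c. fst c \<in> ?N} (chord_through D (x, v))) \<partial>lborel) = 0"
      by (subst nn_integral_0_iff_AE) (auto elim!: eventually_mono simp: indicator_def)
  qed
  then have "AE c in flux D. indicator {c. fst c \<in> ?N} c = (0::ennreal)"
    by (subst nn_integral_0_iff_AE[symmetric]) auto
  with AE_flux_chords show ?thesis
    by eventually_elim (auto simp: chords_def indicator_def split: if_splits)
qed

text \<open>The property is additive in \<open>A\<close>, so that it can be checked chart by chart.\<close>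

definition resampled :: "('p \<times> real) set \<Rightarrow> bool" where
  "resampled A \<longleftrightarrow> A \<in> sets borel \<and> emeasure (flux D) {c. fst c \<in> A} < \<infinity> \<and>
     (\<forall>H \<in> borel_measurable borel. (\<integral>\<^sup>+c. indicator A (fst c) * H c \<partial>flux D) =
        (\<integral>\<^sup>+c. indicator A (fst c) * (\<integral>\<^sup>+\<eta>. H (fst c, U0 (fst c) \<eta>) \<partial>cosine_law e) \<partial>flux D))"

lemma resample_measurable [measurable]:
  assumes [measurable]: "H \<in> borel_measurable borel"
  shows "(\<lambda>c :: 'p phase. \<integral>\<^sup>+\<eta>. H (fst c, U0 (fst c) \<eta>) \<partial>cosine_law e) \<in> borel_measurable borel"
proof (rule cosine.borel_measurable_nn_integral)
  have 1: "(\<lambda>z. (fst z, snd z)) \<in> borel \<Otimes>\<^sub>M cosine_law e \<rightarrow>\<^sub>M (borel :: 'p phase measure) \<Otimes>\<^sub>M borel"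
    by (intro measurable_Pair measurable_fst measurable_compose[OF measurable_snd]
        measurable_cosine_law measurable_ident_sets refl)
  have 2: "(\<lambda>z :: 'p phase \<times> ('p \<times> real). H (fst (fst z), U0 (fst (fst z)) (snd z))) \<in> borel_measurable (borel \<Otimes>\<^sub>M borel)"
    by measurable
  from measurable_compose[OF 1 2]
  show "(\<lambda>(c :: 'p phase, \<eta>). H (fst c, U0 (fst c) \<eta>)) \<in> borel_measurable (borel \<Otimes>\<^sub>M cosine_law e)"
    by (simp add: split_beta')
qed

text \<open>In a chart the directions at a boundary point carry the cosine weight about the normal
  \<open>U x e\<close>, which \<open>nn_integral_sphere_measure_cosine\<close> turns into the law of
  \<open>U x\<close> applied to cosine noise. Finiteness holds because the area element is at most
  \<open>1 + L\<close> and the base points lie in a ball.\<close>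

lemma resampled_chart:
  assumes x: "x \<in> frontier D"
  shows "\<exists>\<epsilon>>0. \<forall>A \<in> sets borel. A \<subseteq> R \<inter> ball x \<epsilon> \<longrightarrow> resampled A"
proof -
  obtain \<epsilon> \<I> f L where \<epsilon>: "\<epsilon> > 0" and iso: "affine_isometry \<I>" "\<I> x = 0" and lip: "L-lipschitz_on UNIV f"
    and graph: "\<I> ` (D \<inter> ball x \<epsilon>) = {z \<in> ball 0 \<epsilon>. snd z > f (fst z)}"
    using domain x unfolding billiard_domain_def lipschitz_domain_def by blast
  obtain Q c where Q: "orthogonal_transformation Q" and I: "\<And>y. \<I> y = Q y + c"
    using iso(1) unfolding affine_isometry_def by blast
  have dist: "dist (\<I> y) (\<I> z) = dist y z" for y z
    using Q orthogonal_transformation_norm[OF Q, of "y - z"]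
    by (simp add: I dist_norm orthogonal_transformation_def linear_diff)
  have inj: "inj \<I>" by (rule injI) (metis dist dist_eq_0_iff)
  interpret ch: lipschitz_chart D x \<epsilon> Q c f L
  proof
    fix y assume y: "y \<in> ball x \<epsilon>"
    have "y \<in> D \<longleftrightarrow> \<I> y \<in> \<I> ` (D \<inter> ball x \<epsilon>)" using inj y by (auto dest: injD)
    also have "\<dots> \<longleftrightarrow> f (fst (\<I> y)) < snd (\<I> y)"
      unfolding graph using y dist[of x y] iso(2) by auto
    finally show "y \<in> D \<longleftrightarrow> f (fst (Q y + c)) < snd (Q y + c)" by (simp add: I)
  qed (use open_D Q \<epsilon> iso(2) I lip in auto)
  have "resampled A" if A [measurable]: "A \<in> sets borel" and sub: "A \<subseteq> R \<inter> ball x \<epsilon>" for A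
  proof -
    define n where "n y = U0 y e" for y
    have n [measurable]: "n \<in> borel_measurable borel" unfolding n_def[abs_def] by measurable
    have normal: "snd (Q (n y)) > 0" "1 / snd (Q (n y)) \<le> 1 + L"
      "(f has_derivative (\<lambda>h. - (fst (Q (n y)) \<bullet> h / snd (Q (n y))))) (at (fst (ch.chart y)))" if y: "y \<in> A" for y
    proof -
      have yR: "y \<in> R" "y \<in> ball x \<epsilon>" using sub y by auto
      obtain W \<phi> \<phi>' w where C1: "C1_param (frontier D) W \<phi> \<phi>'" "w \<in> W" "\<phi> w = y"
        using R_param[OF yR(1)] by blast
      note N = ch.inward_normal_graph[OF C1 yR(2)]
      have "n y = inward_normal D y" using yR R_frontier U_e by (auto simp: n_def U0_def)
      then show "snd (Q (n y)) > 0" "1 / snd (Q (n y)) \<le> 1 + L"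
        "(f has_derivative (\<lambda>h. - (fst (Q (n y)) \<bullet> h / snd (Q (n y))))) (at (fst (ch.chart y)))"
        using N by auto
    qed
    interpret bch: bounded_lipschitz_chart D x \<epsilon> Q c f L A n
      by unfold_locales (use normal sub R_frontier in auto)
    let ?g = "ch.graph_point"
    have pA [measurable]: "Measurable.pred borel (\<lambda>x. x \<in> A)" by simp
    let ?cc = "ennreal (1 / cosine_constant e)"
    have formula: "(\<integral>\<^sup>+z. indicator A (fst z) * H z \<partial>flux D)
        = (\<integral>\<^sup>+y. indicator A (?g y) * (ennreal (1 / snd (Q (n (?g y)))) *
            (?cc * (\<integral>\<^sup>+\<eta>. H (?g y, U0 (?g y) \<eta>) \<partial>cosine_law e))) \<partial>lborel)"
      if H [measurable]: "H \<in> borel_measurable borel" for H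
    proof (subst bch.nn_integral_flux_chart[OF H], rule nn_integral_cong)
      fix y
      show "indicator A (?g y) * (ennreal (1 / snd (Q (n (?g y)))) *
          (\<integral>\<^sup>+v. ennreal (max 0 (n (?g y) \<bullet> v)) * H (?g y, v) \<partial>surface_measure))
        = indicator A (?g y) * (ennreal (1 / snd (Q (n (?g y)))) *
            (?cc * (\<integral>\<^sup>+\<eta>. H (?g y, U0 (?g y) \<eta>) \<partial>cosine_law e)))"
      proof (cases "?g y \<in> A")
        case True
        then have F: "?g y \<in> frontier D" using sub R_frontier by auto
        have "(\<integral>\<^sup>+v. ennreal (max 0 (n (?g y) \<bullet> v)) * H (?g y, v) \<partial>surface_measure)
          = (\<integral>\<^sup>+v. ennreal (max 0 (U (?g y) e \<bullet> v)) * H (?g y, v) \<partial>sphere_measure)"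
          using F by (subst nn_integral_surface_measure) (auto simp: n_def U0_def)
        also have "\<dots> = ?cc * (\<integral>\<^sup>+\<eta>. H (?g y, U (?g y) \<eta>) \<partial>cosine_law e)"
          by (rule nn_integral_sphere_measure_cosine[OF norm_e U_orthogonal[OF F]]) measurable
        finally show ?thesis using F by (simp add: U0_def)
      qed simp
    qed
    \<comment> \<open>The formula is applied to \<open>H\<close> and to its average over the
      direction; the latter depends on the foot point only, so averaging it again changes
      nothing.\<close>
    have 1: "(\<integral>\<^sup>+c. indicator A (fst c) * H c \<partial>flux D) =
        (\<integral>\<^sup>+c. indicator A (fst c) * (\<integral>\<^sup>+\<eta>. H (fst c, U0 (fst c) \<eta>) \<partial>cosine_law e) \<partial>flux D)"
      if H [measurable]: "H \<in> borel_measurable borel" for H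
      by (subst (1 2) formula) (simp_all add: cosine.emeasure_space_1[simplified])
    have 2: "emeasure (flux D) {c. fst c \<in> A} < \<infinity>"
    proof -
      have "emeasure (flux D) {c. fst c \<in> A} = (\<integral>\<^sup>+c. indicator {c. fst c \<in> A} c \<partial>flux D)"
        by (rule nn_integral_indicator[symmetric]) measurable
      also have "\<dots> = (\<integral>\<^sup>+c. indicator A (fst c) * 1 \<partial>flux D)"
        by (auto simp: indicator_def intro!: nn_integral_cong)
      also have "\<dots> = (\<integral>\<^sup>+y. indicator A (?g y) * (ennreal (1 / snd (Q (n (?g y)))) * ?cc) \<partial>lborel)"
        by (subst formula) (simp_all add: cosine.emeasure_space_1[simplified])
      also have "\<dots> \<le> (\<integral>\<^sup>+y. indicator (ball (0::'p) \<epsilon>) y * (ennreal (1 + L) * ?cc) \<partial>lborel)"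
      proof (rule nn_integral_mono)
        fix y
        show "indicator A (?g y) * (ennreal (1 / snd (Q (n (?g y)))) * ?cc) \<le> indicator (ball 0 \<epsilon>) y * (ennreal (1 + L) * ?cc)"
        proof (cases "?g y \<in> A")
          case True
          have "norm y \<le> norm (ch.chart (?g y))"
            using norm_fst_le[of y "snd (ch.chart (?g y))"] bch.fst_chart_graph_point[of y] by (metis prod.collapse)
          also have "\<dots> = dist (?g y) x"
            using ch.dist_chart[of "?g y" x] ch.center by (simp add: ch.chart_def[of x])
          also have "\<dots> < \<epsilon>" using True sub by (auto simp: dist_commute)
          finally have "y \<in> ball 0 \<epsilon>" by simp
          moreover have "ennreal (1 / snd (Q (n (?g y)))) * ?cc \<le> ennreal (1 + L) * ?cc"
            by (intro mult_right_mono ennreal_leI normal(2)[OF True]) auto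
          ultimately show ?thesis using True by simp
        qed simp
      qed
      also have "\<dots> = emeasure lborel (ball (0::'p) \<epsilon>) * (ennreal (1 + L) * ?cc)"
        by (subst nn_integral_multc) auto
      also have "\<dots> < \<infinity>"
        using \<epsilon> by (simp add: emeasure_ball ennreal_mult_less_top)
      finally show ?thesis .
    qed
    show ?thesis unfolding resampled_def by (intro conjI ballI A 2 1)
  qed
  then show ?thesis using \<epsilon> by blast
qed

lemma resampled_Un:
  assumes A: "resampled A" and B: "resampled B" and disj: "A \<inter> B = {}"
  shows "resampled (A \<union> B)"
proof -
  have AB [measurable]: "A \<in> sets borel" "B \<in> sets borel" using A B by (auto simp: resampled_def)
  have [measurable]: "Measurable.pred borel (\<lambda>x. x \<in> A)" "Measurable.pred borel (\<lambda>x. x \<in> B)" by simp_all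
  have split: "(\<integral>\<^sup>+c. indicator (A \<union> B) (fst c) * H c \<partial>flux D)
      = (\<integral>\<^sup>+c. indicator A (fst c) * H c \<partial>flux D) + (\<integral>\<^sup>+c. indicator B (fst c) * H c \<partial>flux D)"
    if [measurable]: "H \<in> borel_measurable borel" for H
    by (subst nn_integral_add[symmetric]) (use disj in \<open>auto simp: indicator_def intro!: nn_integral_cong\<close>)
  have "emeasure (flux D) {c. fst c \<in> A \<union> B} \<le> emeasure (flux D) {c. fst c \<in> A} + emeasure (flux D) {c. fst c \<in> B}"
    using emeasure_subadditive[of "{c. fst c \<in> A}" "flux D" "{c. fst c \<in> B}"] by (simp add: Collect_disj_eq)
  then have fin: "emeasure (flux D) {c. fst c \<in> A \<union> B} < \<infinity>"
    using A B by (auto simp: resampled_def intro: le_less_trans)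
  have eq: "(\<integral>\<^sup>+c. indicator (A \<union> B) (fst c) * H c \<partial>flux D) =
      (\<integral>\<^sup>+c. indicator (A \<union> B) (fst c) * (\<integral>\<^sup>+\<eta>. H (fst c, U0 (fst c) \<eta>) \<partial>cosine_law e) \<partial>flux D)"
    if H: "H \<in> borel_measurable borel" for H
  proof -
    have "(\<integral>\<^sup>+c. indicator A' (fst c) * H c \<partial>flux D) =
      (\<integral>\<^sup>+c. indicator A' (fst c) * (\<integral>\<^sup>+\<eta>. H (fst c, U0 (fst c) \<eta>) \<partial>cosine_law e) \<partial>flux D)"
      if "resampled A'" for A' using that H unfolding resampled_def by blast
    from this[OF A] this[OF B] show ?thesis
      unfolding split[OF H] split[OF resample_measurable[OF H]] by (rule arg_cong2[where f = "(+)"])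
  qed
  show ?thesis
    unfolding resampled_def by (intro conjI ballI sets.Un AB fin eq)
qed

text \<open>The whole frontier is compact, unlike \<open>R\<close> in general, so finitely many
  charts suffice; each step of the induction removes the balls already treated, to keep the pieces
  disjoint.\<close>

lemma resampled_R: "resampled R"
proof -
  define P where "P x \<epsilon> \<longleftrightarrow> \<epsilon> > 0 \<and> (\<forall>A \<in> sets borel. A \<subseteq> R \<inter> ball x \<epsilon> \<longrightarrow> resampled A)" for x \<epsilon>
  obtain \<epsilon> where \<epsilon>: "\<And>x. x \<in> frontier D \<Longrightarrow> P x (\<epsilon> x)"
    using resampled_chart unfolding P_def by metis
  have "compact (frontier D)" using compact_frontier_bounded[OF bounded] .
  moreover have "frontier D \<subseteq> (\<Union>x\<in>frontier D. ball x (\<epsilon> x))" using \<epsilon> by (force simp: P_def)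
  ultimately obtain X where X: "X \<subseteq> frontier D" "finite X" "frontier D \<subseteq> (\<Union>x\<in>X. ball x (\<epsilon> x))"
    by (metis (no_types, lifting) compactE_image open_ball)
  have "resampled (R \<inter> (\<Union>x\<in>X. ball x (\<epsilon> x)))" using X(2,1)
  proof (induction rule: finite_induct)
    case empty
    then show ?case by (simp add: resampled_def)
  next
    case (insert x X)
    let ?A = "R \<inter> ball x (\<epsilon> x) - (\<Union>x\<in>X. ball x (\<epsilon> x))" and ?B = "R \<inter> (\<Union>x\<in>X. ball x (\<epsilon> x))"
    have "open (\<Union>x\<in>X. ball x (\<epsilon> x))" by auto
    then have "?A \<in> sets borel" by (intro sets.Diff sets.Int borel_open R_borel) auto
    then have "resampled ?A" using \<epsilon>[of x] insert.prems by (auto simp: P_def)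
    then have "resampled (?A \<union> ?B)" using insert by (intro resampled_Un) auto
    moreover have "?A \<union> ?B = R \<inter> (\<Union>x\<in>insert x X. ball x (\<epsilon> x))" by auto
    ultimately show ?case by simp
  qed
  moreover have "R \<inter> (\<Union>x\<in>X. ball x (\<epsilon> x)) = R" using X(3) R_frontier by auto
  ultimately show ?thesis by simp
qed

lemma nn_integral_flux_resample:
  assumes [measurable]: "H \<in> borel_measurable borel"
  shows "(\<integral>\<^sup>+c. H c \<partial>flux D) = (\<integral>\<^sup>+c. \<integral>\<^sup>+\<eta>. H (fst c, U0 (fst c) \<eta>) \<partial>cosine_law e \<partial>flux D)"
proof -
  have "(\<integral>\<^sup>+c. H c \<partial>flux D) = (\<integral>\<^sup>+c. indicator R (fst c) * H c \<partial>flux D)"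
    by (rule nn_integral_cong_AE, use AE_flux_R in eventually_elim) simp
  also have "\<dots> = (\<integral>\<^sup>+c. indicator R (fst c) * (\<integral>\<^sup>+\<eta>. H (fst c, U0 (fst c) \<eta>) \<partial>cosine_law e) \<partial>flux D)"
    using resampled_R assms unfolding resampled_def by blast
  also have "\<dots> = (\<integral>\<^sup>+c. \<integral>\<^sup>+\<eta>. H (fst c, U0 (fst c) \<eta>) \<partial>cosine_law e \<partial>flux D)"
    by (rule nn_integral_cong_AE, use AE_flux_R in eventually_elim) simp
  finally show ?thesis .
qed

lemma finite_flux: "finite_measure (flux D)"
proof
  have "emeasure (flux D) (space (flux D)) = emeasure (flux D) {c. fst c \<in> R}"
    using AE_flux_R by (intro emeasure_eq_AE) auto
  also have "\<dots> < \<infinity>" using resampled_R unfolding resampled_def by blast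
  finally show "emeasure (flux D) (space (flux D)) \<noteq> \<infinity>" by simp
qed

subsection \<open>Reversal of the chain of chords\<close>

interpretation noise: sequence_space "cosine_law e"
  by unfold_locales

interpretation flux: finite_measure "flux D"
  by (rule finite_flux)

abbreviation noise :: "(nat \<Rightarrow> 'p \<times> real) measure" where
  "noise \<equiv> \<Pi>\<^sub>M i\<in>UNIV. cosine_law e"

abbreviation runs :: "('p phase \<times> (nat \<Rightarrow> 'p \<times> real)) measure" where
  "runs \<equiv> flux D \<Otimes>\<^sub>M noise"

definition chord_step :: "'p phase \<Rightarrow> 'p \<times> real \<Rightarrow> 'p phase" where
  "chord_step c \<eta> = (fst (chord_flip D c), U0 (fst (chord_flip D c)) \<eta>)"

primrec chord_chain ::
  "'p phase \<Rightarrow> (nat \<Rightarrow> 'p \<times> real) \<Rightarrow> nat \<Rightarrow> 'p phase" where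
  "chord_chain c \<eta> 0 = c"
| "chord_chain c \<eta> (Suc n) = chord_step (chord_chain c \<eta> n) (\<eta> n)"

lemma chord_chain_shift:
  "chord_chain c (case_nat x \<eta>) (Suc n) = chord_chain (chord_step c x) \<eta> n"
  by (induction n) simp_all

lemma noise_component_measurable:
  assumes "g \<in> M \<rightarrow>\<^sub>M noise"
  shows "(\<lambda>x. g x n) \<in> borel_measurable M"
proof -
  have "(\<lambda>x. g x n) \<in> M \<rightarrow>\<^sub>M cosine_law e"
    by (rule measurable_compose[OF assms measurable_component_singleton]) simp
  moreover have "(\<lambda>u. u) \<in> cosine_law e \<rightarrow>\<^sub>M borel"
    by (rule measurable_cosine_law) simp
  ultimately show ?thesis by (rule measurable_compose)
qed

lemma chord_step_measurable [measurable (raw)]: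
  assumes [measurable]: "f \<in> borel_measurable M" "g \<in> borel_measurable M"
  shows "(\<lambda>x. chord_step (f x) (g x)) \<in> borel_measurable M"
  unfolding chord_step_def by measurable

lemma chord_chain_measurable [measurable (raw)]:
  assumes [measurable]: "f \<in> borel_measurable M" and g: "g \<in> M \<rightarrow>\<^sub>M noise"
  shows "(\<lambda>x. chord_chain (f x) (g x) n) \<in> borel_measurable M"
proof (induction n)
  case (Suc n)
  note [measurable] = Suc noise_component_measurable[OF g, of n]
  show ?case by simp
qed simp

text \<open>The Markov operator of the chord chain.\<close>

definition transfer :: "('p phase \<Rightarrow> ennreal) \<Rightarrow> 'p phase \<Rightarrow> ennreal" where
  "transfer f c = (\<integral>\<^sup>+\<eta>. f (chord_step c \<eta>) \<partial>cosine_law e)"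

lemma transfer_measurable [measurable]:
  assumes [measurable]: "f \<in> borel_measurable borel"
  shows "transfer f \<in> borel_measurable borel"
  unfolding transfer_def[abs_def] chord_step_def
  by (rule measurable_compose[OF _ resample_measurable, of "chord_flip D"]) measurable

text \<open>Both sides are the integral over \<open>\<xi>\<close> of the product of the cosine averages of \<open>f\<close> and \<open>g\<close> at \<open>\<xi>\<close>.\<close>

lemma transfer_balance:
  assumes [measurable]: "f \<in> borel_measurable borel" "g \<in> borel_measurable borel"
  shows "(\<integral>\<^sup>+c. f (chord_flip D c) * transfer g c \<partial>flux D) = (\<integral>\<^sup>+c. g (chord_flip D c) * transfer f c \<partial>flux D)"
proof -
  let ?avg = "\<lambda>f (c :: 'p phase). \<integral>\<^sup>+\<eta>. f (fst c, U0 (fst c) \<eta>) \<partial>cosine_law e"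
  have "(\<integral>\<^sup>+c. f (chord_flip D c) * transfer g c \<partial>flux D) = (\<integral>\<^sup>+c. ?avg f c * ?avg g c \<partial>flux D)"
    if [measurable]: "f \<in> borel_measurable borel" "g \<in> borel_measurable borel" for f g
  proof -
    have avg [measurable]: "?avg g \<in> borel_measurable borel"
      by (rule resample_measurable) measurable
    have "(\<integral>\<^sup>+c. f (chord_flip D c) * transfer g c \<partial>flux D) = (\<integral>\<^sup>+c. f (chord_flip D c) * ?avg g (chord_flip D c) \<partial>flux D)"
      by (simp add: transfer_def chord_step_def)
    also have "\<dots> = (\<integral>\<^sup>+c. f c * ?avg g c \<partial>flux D)"
      by (rule nn_integral_flux_flip[of "\<lambda>c. f c * ?avg g c"]) measurable
    also have "\<dots> = (\<integral>\<^sup>+c. \<integral>\<^sup>+\<eta>. f (fst c, U0 (fst c) \<eta>) * ?avg g (fst c, U0 (fst c) \<eta>) \<partial>cosine_law e \<partial>flux D)"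
      by (rule nn_integral_flux_resample) measurable
    also have "\<dots> = (\<integral>\<^sup>+c. ?avg f c * ?avg g c \<partial>flux D)"
      by (simp, intro nn_integral_cong nn_integral_multc measurable_cosine_law) measurable
    finally show ?thesis .
  qed
  note eq = this
  show ?thesis by (simp only: eq[OF assms] eq[OF assms(2,1)] mult.commute)
qed

lemma flip_flip_AE: "AE c in flux D. chord_flip D (chord_flip D c) = c"
  using AE_flux_chords by eventually_elim (rule chord_flip(3))

lemma transfer_const: "transfer (\<lambda>c. k) c = k"
  by (simp add: transfer_def cosine.emeasure_space_1[simplified])

text \<open>Balance against the constant 1 leaves the flipped function, and flips preserve the flux:
  the flux measure is invariant for the chain.\<close>

lemma nn_integral_transfer:
  assumes [measurable]: "f \<in> borel_measurable borel"
  shows "(\<integral>\<^sup>+c. transfer f c \<partial>flux D) = (\<integral>\<^sup>+c. f c \<partial>flux D)"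
  using transfer_balance[of "\<lambda>_. 1" f] nn_integral_flux_flip[of f] by (simp add: transfer_const)

text \<open>The expectation of a product of functions of the successive chords, started at
  \<open>c\<close>, evaluated from the last step backwards by the Markov property
  (\<open>nn_integral_chain_product\<close>).\<close>

primrec chain_functional ::
  "('p phase \<Rightarrow> ennreal) list \<Rightarrow> 'p phase \<Rightarrow> ennreal" where
  "chain_functional [] = (\<lambda>c. 1)"
| "chain_functional (f # fs) = (\<lambda>c. f c * transfer (chain_functional fs) c)"

lemma chain_functional_measurable:
  "set fs \<subseteq> borel_measurable borel \<Longrightarrow> chain_functional fs \<in> borel_measurable borel"
  by (induction fs) auto

text \<open>The left-hand side looks from one reflection both ways: \<open>gs\<close> collects the
  part of the chain already reversed, \<open>fs\<close> the part still ahead. Balance exchanges the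
  two, and invariance under flips moves the viewpoint across the chord of the first function of
  \<open>fs\<close>, which is thereby passed to \<open>gs\<close>.\<close>

lemma chain_functional_turn:
  assumes "set fs \<subseteq> borel_measurable borel" "set gs \<subseteq> borel_measurable borel"
  shows "(\<integral>\<^sup>+c. chain_functional gs (chord_flip D c) * transfer (chain_functional fs) c \<partial>flux D)
    = (\<integral>\<^sup>+c. chain_functional (rev (map (\<lambda>f. f \<circ> chord_flip D) fs) @ gs) c \<partial>flux D)"
  using assms
proof (induction fs arbitrary: gs)
  case Nil
  then show ?case
    using nn_integral_flux_flip[OF chain_functional_measurable[of gs]] by (simp add: transfer_const)
next
  case (Cons f fs)
  let ?g = "f \<circ> chord_flip D"
  have [measurable]: "f \<in> borel_measurable borel" using Cons.prems by auto
  have [measurable]: "chain_functional fs \<in> borel_measurable borel" "chain_functional gs \<in> borel_measurable borel"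
    using Cons.prems by (auto intro!: chain_functional_measurable)
  have g: "?g \<in> borel_measurable borel" by (simp add: comp_def)
  let ?Y = "\<lambda>c. f (chord_flip D c) * transfer (chain_functional fs) (chord_flip D c) * transfer (chain_functional gs) c"
  have "(\<integral>\<^sup>+c. chain_functional gs (chord_flip D c) * transfer (chain_functional (f # fs)) c \<partial>flux D)
      = (\<integral>\<^sup>+c. chain_functional (f # fs) (chord_flip D c) * transfer (chain_functional gs) c \<partial>flux D)"
    using Cons.prems by (intro transfer_balance chain_functional_measurable) auto
  also have "\<dots> = (\<integral>\<^sup>+c. ?Y c \<partial>flux D)" by simp
  also have "\<dots> = (\<integral>\<^sup>+c. ?Y (chord_flip D c) \<partial>flux D)"
    by (rule nn_integral_flux_flip[symmetric]) measurable
  also have "\<dots> = (\<integral>\<^sup>+c. chain_functional (?g # gs) (chord_flip D c) * transfer (chain_functional fs) c \<partial>flux D)"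
    by (rule nn_integral_cong_AE, use flip_flip_AE in eventually_elim) (simp add: mult_ac)
  also have "\<dots> = (\<integral>\<^sup>+c. chain_functional (rev (map (\<lambda>f. f \<circ> chord_flip D) fs) @ ?g # gs) c \<partial>flux D)"
    using Cons.prems g by (intro Cons.IH) auto
  finally show ?case by (simp only: list.map rev.simps append_assoc append.simps)
qed

lemma chain_functional_rev:
  assumes "set fs \<subseteq> borel_measurable borel"
  shows "(\<integral>\<^sup>+c. chain_functional fs c \<partial>flux D)
    = (\<integral>\<^sup>+c. chain_functional (rev (map (\<lambda>f. f \<circ> chord_flip D) fs)) c \<partial>flux D)"
proof (cases fs)
  case (Cons f fs')
  let ?g = "f \<circ> chord_flip D"
  have [measurable]: "f \<in> borel_measurable borel" using assms Cons by auto
  have "(\<integral>\<^sup>+c. chain_functional fs c \<partial>flux D)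
      = (\<integral>\<^sup>+c. chain_functional [?g] (chord_flip D c) * transfer (chain_functional fs') c \<partial>flux D)"
    unfolding Cons by (rule nn_integral_cong_AE, use flip_flip_AE in eventually_elim) (simp add: transfer_const)
  also have "\<dots> = (\<integral>\<^sup>+c. chain_functional (rev (map (\<lambda>f. f \<circ> chord_flip D) fs') @ [?g]) c \<partial>flux D)"
    using assms Cons by (intro chain_functional_turn) (auto simp: comp_def)
  finally show ?thesis by (simp add: Cons)
qed simp

lemma nn_integral_noise:
  assumes [measurable]: "F \<in> borel_measurable noise"
  shows "(\<integral>\<^sup>+\<eta>. F \<eta> \<partial>noise) = (\<integral>\<^sup>+x. \<integral>\<^sup>+\<eta>. F (case_nat x \<eta>) \<partial>noise \<partial>cosine_law e)"
proof -
  have "(\<integral>\<^sup>+\<eta>. F \<eta> \<partial>noise) = (\<integral>\<^sup>+\<eta>. F \<eta> \<partial>distr (cosine_law e \<Otimes>\<^sub>M noise) noise (\<lambda>(x, \<eta>). case_nat x \<eta>))"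
    by (simp only: noise.PiM_iter)
  also have "\<dots> = (\<integral>\<^sup>+(x, \<eta>). F (case_nat x \<eta>) \<partial>(cosine_law e \<Otimes>\<^sub>M noise))"
    by (subst nn_integral_distr) (auto simp: split_beta')
  also have "\<dots> = (\<integral>\<^sup>+x. \<integral>\<^sup>+\<eta>. F (case_nat x \<eta>) \<partial>noise \<partial>cosine_law e)"
    by (subst noise.nn_integral_fst[symmetric]) auto
  finally show ?thesis .
qed

lemma nn_integral_chain_product:
  assumes "set fs \<subseteq> borel_measurable borel"
  shows "(\<integral>\<^sup>+\<eta>. (\<Prod>i<length fs. (fs ! i) (chord_chain c \<eta> i)) \<partial>noise) = chain_functional fs c"
  using assms
proof (induction fs arbitrary: c)
  case Nil
  then show ?case by (simp add: noise.emeasure_space_1)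
next
  case (Cons f fs)
  have [measurable]: "f \<in> borel_measurable borel" using Cons.prems by auto
  have fs [measurable]: "fs ! i \<in> borel_measurable borel" if "i < length fs" for i
    using Cons.prems that by auto
  have prod [measurable]: "(\<lambda>\<eta>. \<Prod>i<length fs. (fs ! i) (chord_chain c' \<eta> i)) \<in> borel_measurable noise" for c'
    by (rule borel_measurable_prod_ennreal) (rule measurable_compose[OF _ fs], auto)
  have "(\<lambda>\<eta>. \<Prod>i<length (f # fs). ((f # fs) ! i) (chord_chain c \<eta> i)) \<in> borel_measurable noise"
  proof (rule borel_measurable_prod_ennreal)
    fix i assume "i \<in> {..<length (f # fs)}"
    then have "(f # fs) ! i \<in> borel_measurable borel" using Cons.prems nth_mem[of i "f # fs"] by blast
    then show "(\<lambda>\<eta>. ((f # fs) ! i) (chord_chain c \<eta> i)) \<in> borel_measurable noise"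
      by (rule measurable_compose[rotated]) measurable
  qed
  then have "(\<integral>\<^sup>+\<eta>. (\<Prod>i<length (f # fs). ((f # fs) ! i) (chord_chain c \<eta> i)) \<partial>noise)
     = (\<integral>\<^sup>+x. \<integral>\<^sup>+\<eta>. (\<Prod>i<length (f # fs). ((f # fs) ! i) (chord_chain c (case_nat x \<eta>) i)) \<partial>noise \<partial>cosine_law e)"
    by (rule nn_integral_noise)
  also have "\<dots> = (\<integral>\<^sup>+x. \<integral>\<^sup>+\<eta>. f c * (\<Prod>i<length fs. (fs ! i) (chord_chain (chord_step c x) \<eta> i)) \<partial>noise \<partial>cosine_law e)"
    by (simp only: length_Cons prod.lessThan_Suc_shift chord_chain_shift chord_chain.simps(1) nth_Cons_0 nth_Cons_Suc)
  also have "\<dots> = (\<integral>\<^sup>+x. f c * chain_functional fs (chord_step c x) \<partial>cosine_law e)"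
    using Cons.prems by (simp add: nn_integral_cmult Cons.IH)
  also have "\<dots> = f c * transfer (chain_functional fs) c"
    unfolding transfer_def
    by (rule nn_integral_cmult, rule measurable_cosine_law)
      (use Cons.prems in \<open>intro measurable_compose[OF _ chain_functional_measurable], auto\<close>)
  finally show ?case by simp
qed

lemma chord_chain_stationary:
  assumes [measurable]: "f \<in> borel_measurable borel"
  shows "(\<integral>\<^sup>+c. \<integral>\<^sup>+\<eta>. f (chord_chain c \<eta> n) \<partial>noise \<partial>flux D) = (\<integral>\<^sup>+c. f c \<partial>flux D)"
proof (induction n)
  case 0
  then show ?case by (simp add: noise.emeasure_space_1)
next
  case (Suc n)
  let ?h = "\<lambda>c. \<integral>\<^sup>+\<eta>. f (chord_chain c \<eta> n) \<partial>noise"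
  have [measurable]: "?h \<in> borel_measurable borel" by measurable
  have "(\<integral>\<^sup>+\<eta>. f (chord_chain c \<eta> (Suc n)) \<partial>noise) = transfer ?h c" for c
    unfolding transfer_def chord_chain_shift[symmetric]
    by (rule nn_integral_noise) measurable
  then show ?case using Suc nn_integral_transfer[of ?h] by simp
qed

section \<open>Reversal in law of the first chords, and absence of infinitely many reflections in
  finite time\<close>

definition chords_upto :: "nat \<Rightarrow> ('p phase \<times> (nat \<Rightarrow> 'p \<times> real)) \<Rightarrow> nat \<Rightarrow> 'p phase"
  where "chords_upto n \<omega> = (\<lambda>i\<in>{..n}. chord_chain (fst \<omega>) (snd \<omega>) i)"

definition reverse_chords :: "nat \<Rightarrow> (nat \<Rightarrow> 'p phase) \<Rightarrow> nat \<Rightarrow> 'p phase"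
  where "reverse_chords n x = (\<lambda>i\<in>{..n}. chord_flip D (x (n - i)))"

lemma chords_upto_measurable [measurable]:
  "chords_upto n \<in> runs \<rightarrow>\<^sub>M (\<Pi>\<^sub>M i\<in>{..n}. borel)"
  unfolding chords_upto_def[abs_def] by measurable

lemma reverse_chords_measurable [measurable]:
  "reverse_chords n \<in> (\<Pi>\<^sub>M i\<in>{..n}. borel) \<rightarrow>\<^sub>M (\<Pi>\<^sub>M i\<in>{..n}. borel)"
  unfolding reverse_chords_def[abs_def]
  by (intro measurable_restrict measurable_compose[OF measurable_component_singleton]) auto

text \<open>Rectangles determine the law, and on rectangles the claim is
  \<open>chain_functional_rev\<close> for indicators.\<close>

lemma chain_reversal:
  "distr runs (\<Pi>\<^sub>M i\<in>{..n}. borel) (\<lambda>\<omega>. reverse_chords n (chords_upto n \<omega>))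
    = distr runs (\<Pi>\<^sub>M i\<in>{..n}. borel) (chords_upto n)" (is "?P = ?Q")
proof (rule sym, rule measure_eqI_PiM_finite)
  let ?S = "\<Pi>\<^sub>M i\<in>{..n}. (borel :: 'p phase measure)"
  \<comment> \<open>Stated for a permutation \<open>k\<close> of the indices and a map
    \<open>\<phi>\<close> of chords so that it covers both sides: identities for the chain itself,
    \<open>n - i\<close> and \<open>chord_flip D\<close> for its reversal.\<close>
  have product: "emeasure (distr runs ?S h) (Pi\<^sub>E {..n} A)
      = (\<integral>\<^sup>+c. chain_functional (map (\<lambda>i. indicator (A (k i)) \<circ> \<phi>) [0..<Suc n]) c \<partial>flux D)"
    if A: "\<And>i. i \<le> n \<Longrightarrow> A i \<in> sets borel" and h [measurable]: "h \<in> runs \<rightarrow>\<^sub>M ?S"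
      and k: "bij_betw k {..n} {..n}" and \<phi>: "\<phi> \<in> borel_measurable borel"
      and hk: "\<And>\<omega> i. i \<le> n \<Longrightarrow> h \<omega> (k i) = \<phi> (chord_chain (fst \<omega>) (snd \<omega>) i)"
    for A h k and \<phi> :: "'p phase \<Rightarrow> 'p phase"
  proof -
    let ?fs = "map (\<lambda>i. indicator (A (k i)) \<circ> \<phi>) [0..<Suc n] :: (_ \<Rightarrow> ennreal) list"
    have kA: "A (k i) \<in> sets borel" if "i \<le> n" for i
      using A k that by (auto simp: bij_betw_def)
    have fs: "set ?fs \<subseteq> borel_measurable borel"
      using kA \<phi> by (auto simp: less_Suc_eq_le comp_def intro!: measurable_compose[OF \<phi>] borel_measurable_indicator)
    have AS [measurable]: "Pi\<^sub>E {..n} A \<in> sets ?S" using A by (intro sets_PiM_I_finite) auto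
    have mem: "indicator (Pi\<^sub>E {..n} A) (h \<omega>) = (\<Prod>i<length ?fs. (?fs ! i) (chord_chain (fst \<omega>) (snd \<omega>) i) :: ennreal)"
      if \<omega>: "\<omega> \<in> space runs" for \<omega>
    proof -
      have ext: "h \<omega> \<in> extensional {..n}"
        using measurable_space[OF h \<omega>] by (simp add: space_PiM PiE_def)
      have "indicator (Pi\<^sub>E {..n} A) (h \<omega>) = (\<Prod>i\<le>n. indicator (A i) (h \<omega> i) :: ennreal)"
        using ext by (auto simp: indicator_def PiE_iff prod_zero_iff)
      also have "\<dots> = (\<Prod>i\<le>n. indicator (A (k i)) (h \<omega> (k i)))"
        by (rule prod.reindex_bij_betw[OF k, symmetric])
      also have "\<dots> = (\<Prod>i\<le>n. indicator (A (k i)) (\<phi> (chord_chain (fst \<omega>) (snd \<omega>) i)))"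
        by (intro prod.cong) (auto simp: hk)
      also have "\<dots> = (\<Prod>i<length ?fs. (?fs ! i) (chord_chain (fst \<omega>) (snd \<omega>) i))"
        by (intro prod.cong) (auto simp: nth_map simp del: upt_Suc)
      finally show ?thesis .
    qed
    have "emeasure (distr runs ?S h) (Pi\<^sub>E {..n} A) = (\<integral>\<^sup>+x. indicator (Pi\<^sub>E {..n} A) x \<partial>distr runs ?S h)"
      by simp
    also have "\<dots> = (\<integral>\<^sup>+\<omega>. indicator (Pi\<^sub>E {..n} A) (h \<omega>) \<partial>runs)"
      by (rule nn_integral_distr) auto
    also have "\<dots> = (\<integral>\<^sup>+c. \<integral>\<^sup>+\<eta>. indicator (Pi\<^sub>E {..n} A) (h (c, \<eta>)) \<partial>noise \<partial>flux D)"
      by (rule noise.nn_integral_fst[symmetric]) measurable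
    also have "\<dots> = (\<integral>\<^sup>+c. chain_functional ?fs c \<partial>flux D)"
    proof (rule nn_integral_cong)
      fix c
      have "(\<integral>\<^sup>+\<eta>. indicator (Pi\<^sub>E {..n} A) (h (c, \<eta>)) \<partial>noise)
          = (\<integral>\<^sup>+\<eta>. (\<Prod>i<length ?fs. (?fs ! i) (chord_chain c \<eta> i)) \<partial>noise)"
        using mem[of "(c, _)"] by (intro nn_integral_cong) (simp add: space_pair_measure)
      then show "(\<integral>\<^sup>+\<eta>. indicator (Pi\<^sub>E {..n} A) (h (c, \<eta>)) \<partial>noise) = chain_functional ?fs c"
        using nn_integral_chain_product[OF fs] by simp
    qed
    finally show ?thesis .
  qed
  fix A :: "nat \<Rightarrow> 'p phase set" assume "\<And>i. i \<in> {..n} \<Longrightarrow> A i \<in> sets borel"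
  then have A: "\<And>i. i \<le> n \<Longrightarrow> A i \<in> sets borel" by simp
  let ?F = "map (\<lambda>i. indicator (A (id i)) \<circ> (\<lambda>c. c)) [0..<Suc n] :: (_ \<Rightarrow> ennreal) list"
  have "emeasure ?Q (Pi\<^sub>E {..n} A) = (\<integral>\<^sup>+c. chain_functional ?F c \<partial>flux D)"
    by (rule product[OF A]) (auto simp: chords_upto_def bij_betw_def)
  also have "\<dots> = (\<integral>\<^sup>+c. chain_functional (rev (map (\<lambda>f. f \<circ> chord_flip D) ?F)) c \<partial>flux D)"
    using A by (intro chain_functional_rev) (auto simp: less_Suc_eq_le comp_def)
  also have "rev (map (\<lambda>f. f \<circ> chord_flip D) ?F) = map (\<lambda>i. indicator (A (n - i)) \<circ> chord_flip D) [0..<Suc n]"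
    by (rule nth_equalityI) (auto simp: rev_nth nth_map comp_def simp del: upt_Suc)
  also have "(\<integral>\<^sup>+c. chain_functional (map (\<lambda>i. indicator (A (n - i)) \<circ> chord_flip D) [0..<Suc n]) c \<partial>flux D)
      = emeasure ?P (Pi\<^sub>E {..n} A)"
  proof (rule product[OF A, symmetric])
    show "bij_betw (\<lambda>i. n - i) {..n} {..n}"
      by (rule bij_betw_byWitness[where f' = "\<lambda>i. n - i"]) auto
    show "(\<lambda>\<omega>. reverse_chords n (chords_upto n \<omega>)) \<in> runs \<rightarrow>\<^sub>M ?S" by measurable
  qed (auto simp: reverse_chords_def chords_upto_def)
  finally show "emeasure ?Q (Pi\<^sub>E {..n} A) = emeasure ?P (Pi\<^sub>E {..n} A)" .
next
  have fin: "finite_measure runs"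
    by (intro finite_measure_pair_measure) (auto intro: finite_flux noise.finite_measure_axioms)
  then have "finite_measure ?Q" by (rule finite_measure.finite_measure_distr) measurable
  then show "\<And>i::nat. emeasure ?Q (space (\<Pi>\<^sub>M i\<in>{..n}. (borel :: 'p phase measure))) \<noteq> \<infinity>"
    by (simp add: finite_measure.emeasure_finite)
  show "range (\<lambda>i::nat. space (\<Pi>\<^sub>M i\<in>{..n}. (borel :: 'p phase measure))) \<subseteq> prod_algebra {..n} (\<lambda>_. borel)"
    by (auto simp: space_PiM intro!: prod_algebraI_finite)
qed auto

text \<open>Chords of bounded total length have lengths tending to 0, hence eventually at most any
  given \<open>\<epsilon>\<close>. By stationarity the measure of this event is at most the flux of
  the chords of length at most \<open>\<epsilon>\<close>, which tends to 0 because chords have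
  positive length and the flux is finite.\<close>

lemma no_explosion:
  "AE \<omega> in runs. \<forall>B::nat. \<exists>n. real B < (\<Sum>i<n. chord_length D (chord_chain (fst \<omega>) (snd \<omega>) i))"
proof -
  let ?P = runs
  let ?l = "\<lambda>\<omega> i. chord_length D (chord_chain (fst \<omega>) (snd \<omega>) i)"
  have short: "emeasure ?P {\<omega> \<in> space ?P. \<exists>N. \<forall>n\<ge>N. ?l \<omega> n \<le> \<epsilon>} \<le> emeasure (flux D) {c. chord_length D c \<le> \<epsilon>}" for \<epsilon>
  proof -
    define F where "F N = {\<omega> \<in> space ?P. \<forall>n\<ge>N. ?l \<omega> n \<le> \<epsilon>}" for N
    have F [measurable]: "F N \<in> sets ?P" for N unfolding F_def by measurable
    have "{\<omega> \<in> space ?P. \<exists>N. \<forall>n\<ge>N. ?l \<omega> n \<le> \<epsilon>} = (\<Union>N. F N)" by (auto simp: F_def)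
    moreover have "emeasure ?P (\<Union>N. F N) = (SUP N. emeasure ?P (F N))"
    proof (rule SUP_emeasure_incseq[symmetric])
      show "range F \<subseteq> sets ?P" using F by blast
      show "incseq F" unfolding incseq_def F_def by (blast intro: order_trans)
    qed
    moreover have "emeasure ?P (F N) \<le> emeasure (flux D) {c. chord_length D c \<le> \<epsilon>}" for N
    proof -
      have "emeasure ?P (F N) = (\<integral>\<^sup>+\<omega>. indicator (F N) \<omega> \<partial>?P)"
        by (rule nn_integral_indicator[OF F, symmetric])
      also have "\<dots> \<le> (\<integral>\<^sup>+\<omega>. indicator {c. chord_length D c \<le> \<epsilon>} (chord_chain (fst \<omega>) (snd \<omega>) N) \<partial>?P)"
        by (intro nn_integral_mono) (auto simp: F_def indicator_def)
      also have "\<dots> = (\<integral>\<^sup>+c. \<integral>\<^sup>+\<eta>. indicator {c. chord_length D c \<le> \<epsilon>} (chord_chain c \<eta> N) \<partial>noise \<partial>flux D)"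
        by (subst noise.nn_integral_fst[symmetric]) auto
      also have "\<dots> = emeasure (flux D) {c. chord_length D c \<le> \<epsilon>}"
        by (subst chord_chain_stationary) auto
      finally show ?thesis .
    qed
    ultimately show ?thesis by (auto intro: SUP_least)
  qed
  let ?bad = "{\<omega> \<in> space ?P. \<not> (\<forall>B::nat. \<exists>n. real B < (\<Sum>i<n. ?l \<omega> i))}"
  have "emeasure ?P ?bad \<le> emeasure (flux D) {c. chord_length D c \<le> 1 / Suc k}" for k
  proof (rule order_trans[OF emeasure_mono short])
    show "?bad \<subseteq> {\<omega> \<in> space ?P. \<exists>N. \<forall>n\<ge>N. ?l \<omega> n \<le> 1 / Suc k}"
    proof clarify
      fix c \<eta> and B :: nat assume B: "\<not> (\<exists>n. real B < (\<Sum>i<n. ?l (c, \<eta>) i))" 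
      have "summable (?l (c, \<eta>))"
        by (rule summableI_nonneg_bounded[of _ "real B"]) (use B in \<open>auto simp: not_less\<close>)
      then have "?l (c, \<eta>) \<longlonglongrightarrow> 0" by (rule summable_LIMSEQ_zero)
      then have "eventually (\<lambda>n. ?l (c, \<eta>) n < 1 / Suc k) sequentially"
        by (rule order_tendstoD) simp
      then show "\<exists>N. \<forall>n\<ge>N. ?l (c, \<eta>) n \<le> 1 / Suc k"
        by (auto simp: eventually_sequentially intro: less_imp_le)
    qed
  qed measurable
  moreover have "(\<lambda>k. emeasure (flux D) {c. chord_length D c \<le> 1 / Suc k}) \<longlonglongrightarrow> emeasure (flux D) (\<Inter>k. {c. chord_length D c \<le> 1 / Suc k})"
    by (rule Lim_emeasure_decseq) (auto simp: decseq_def frac_le intro: order_trans)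
  ultimately have "emeasure ?P ?bad \<le> emeasure (flux D) (\<Inter>k. {c. chord_length D c \<le> 1 / Suc k})"
    by (intro LIMSEQ_le_const) auto
  also have "\<dots> = 0"
  proof -
    have "(\<Inter>k. {c. chord_length D c \<le> 1 / Suc k}) \<inter> chords D = {}"
    proof (intro equals0I)
      fix c assume "c \<in> (\<Inter>k. {c. chord_length D c \<le> 1 / Suc k}) \<inter> chords D"
      then have l: "\<And>k. chord_length D c \<le> 1 / Suc k" and "chord_length D c > 0"
        by (auto simp: chords_def chord_length_def)
      from reals_Archimedean[OF this(2)] obtain k where "inverse (real (Suc k)) < chord_length D c" by auto
      with l[of k] show False by (simp add: inverse_eq_divide)
    qed
    then have "AE c in flux D. c \<notin> (\<Inter>k. {c. chord_length D c \<le> 1 / Suc k})"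
      using AE_flux_chords by (auto elim!: eventually_mono)
    then have "emeasure (flux D) (\<Inter>k. {c. chord_length D c \<le> 1 / Suc k}) = emeasure (flux D) {}"
      by (intro emeasure_eq_AE) auto
    then show ?thesis by simp
  qed
  finally have "emeasure ?P ?bad = 0" by simp
  then show ?thesis by (subst AE_iff_measurable[OF _ refl]) measurable
qed

subsection \<open>Reversal of paths\<close>

abbreviation seqs :: "(nat \<Rightarrow> 'p phase) measure" where
  "seqs \<equiv> \<Pi>\<^sub>M i\<in>UNIV. borel"

lemma seqs_component [measurable (raw)]:
  assumes "f \<in> M \<rightarrow>\<^sub>M seqs" shows "(\<lambda>x. f x i) \<in> borel_measurable M"
  by (rule measurable_compose[OF assms measurable_component_singleton]) simp

lemma arc_length_measurable [measurable (raw)]: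
  assumes [measurable]: "f \<in> M \<rightarrow>\<^sub>M seqs"
  shows "(\<lambda>x. arc_length D (f x) n) \<in> borel_measurable M"
  unfolding arc_length_def by measurable

lemma leg_state_measurable [measurable (raw)]:
  assumes [measurable]: "f \<in> M \<rightarrow>\<^sub>M seqs" "g \<in> borel_measurable M"
  shows "(\<lambda>x. leg_state D (f x) (g x) n) \<in> borel_measurable M"
  unfolding leg_state_def by measurable

lemma path_state_measurable [measurable (raw)]:
  assumes [measurable]: "f \<in> M \<rightarrow>\<^sub>M seqs" "g \<in> borel_measurable M"
  shows "(\<lambda>x. path_state D (f x) (g x)) \<in> borel_measurable M"
  unfolding path_state_def
  by (rule measurable_compose_countable[where f = "\<lambda>n x. leg_state D (f x) (g x) n"]) measurable

lemma turn_back_measurable [measurable]: "turn_back \<in> borel_measurable borel"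
  unfolding turn_back_def[abs_def] by measurable

definition run :: "'p phase \<times> (nat \<Rightarrow> 'p \<times> real) \<Rightarrow> nat \<Rightarrow> 'p phase" where
  "run \<omega> = chord_chain (fst \<omega>) (snd \<omega>)"

lemma run_measurable [measurable]: "run \<in> runs \<rightarrow>\<^sub>M seqs"
  unfolding run_def[abs_def] by (rule measurable_PiM_single') (auto, measurable)

lemma run_chords: "AE \<omega> in runs. \<forall>n. run \<omega> n \<in> chords D"
proof (subst AE_all_countable, intro allI)
  fix n
  have "(\<integral>\<^sup>+\<omega>. indicator (- chords D) (run \<omega> n) \<partial>runs)
      = (\<integral>\<^sup>+c. \<integral>\<^sup>+\<eta>. indicator (- chords D) (chord_chain c \<eta> n) \<partial>noise \<partial>flux D)"
    by (subst noise.nn_integral_fst[symmetric]) (auto simp: run_def)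
  also have "\<dots> = (\<integral>\<^sup>+c. indicator (- chords D) c \<partial>flux D)"
    by (rule chord_chain_stationary) auto
  also have "\<dots> = (\<integral>\<^sup>+c. 0 \<partial>flux D)"
    by (rule nn_integral_cong_AE, use AE_flux_chords in eventually_elim) simp
  finally have "AE \<omega> in runs. indicator (- chords D) (run \<omega> n) = (0::ennreal)"
    by (subst nn_integral_0_iff_AE[symmetric]) auto
  then show "AE \<omega> in runs. run \<omega> n \<in> chords D"
    by (auto elim!: eventually_mono simp: indicator_def split: if_splits)
qed

text \<open>Finite sequences are extended to infinite ones by repeating the last chord, hence
  \<open>min i n\<close>; truncated subtraction in \<open>n - i\<close> does the same for the
  reversed sequence.\<close>

lemma chain_reversal_functional:
  assumes [measurable]: "G \<in> borel_measurable seqs"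
  shows "(\<integral>\<^sup>+\<omega>. G (\<lambda>i. run \<omega> (min i n)) \<partial>runs)
    = (\<integral>\<^sup>+\<omega>. G (\<lambda>i. chord_flip D (run \<omega> (n - i))) \<partial>runs)"
proof -
  let ?S = "\<Pi>\<^sub>M i\<in>{..n}. (borel :: 'p phase measure)"
  let ?ext = "\<lambda>x i. x (min i n) :: 'p phase"
  have [measurable]: "?ext \<in> ?S \<rightarrow>\<^sub>M seqs"
    by (rule measurable_PiM_single') (auto simp: space_PiM)
  have "(\<integral>\<^sup>+\<omega>. G (?ext (chords_upto n \<omega>)) \<partial>runs) = (\<integral>\<^sup>+x. G (?ext x) \<partial>distr runs ?S (chords_upto n))"
    by (rule nn_integral_distr[symmetric]) measurable
  also have "\<dots> = (\<integral>\<^sup>+\<omega>. G (?ext (reverse_chords n (chords_upto n \<omega>))) \<partial>runs)"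
    unfolding chain_reversal[symmetric] by (rule nn_integral_distr) measurable
  moreover have "?ext (chords_upto n \<omega>) = (\<lambda>i. run \<omega> (min i n))" for \<omega>
    by (auto simp: chords_upto_def run_def)
  moreover have "?ext (reverse_chords n (chords_upto n \<omega>)) = (\<lambda>i. chord_flip D (run \<omega> (n - i)))" for \<omega>
    by (auto simp: chords_upto_def run_def reverse_chords_def min_def)
  ultimately show ?thesis by simp
qed

text \<open>\<open>A n\<close> says that the start lies on chord 0 and that exactly \<open>n\<close>
  reflections occur up to time \<open>T\<close>, the endpoint not being a joint. With
  \<open>?L\<close> the length of the first \<open>n + 1\<close> chords, the reversed path starts at
  \<open>?L - T - s\<close>, the distance left when the original one stops; this reflection of
  \<open>s\<close> preserves Lebesgue measure and \<open>A n\<close>.\<close>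

lemma reversal_fixed_collisions:
  assumes J: "finite J" "J \<subseteq> {0..T}" and T: "0 \<le> T"
    and g [measurable]: "g \<in> borel_measurable (\<Pi>\<^sub>M t\<in>J. borel)"
  defines "A \<equiv> \<lambda>n x s. 0 < s \<and> s < chord_length D (x 0) \<and> arc_length D x n < s + T \<and> s + T < arc_length D x (Suc n)"
  shows "(\<integral>\<^sup>+\<omega>. \<integral>\<^sup>+s. of_bool (A n (run \<omega>) s) * g (\<lambda>t\<in>J. path_state D (run \<omega>) (s + t)) \<partial>lborel \<partial>runs)
    = (\<integral>\<^sup>+\<omega>. \<integral>\<^sup>+s. of_bool (A n (run \<omega>) s) * g (\<lambda>t\<in>J. turn_back (path_state D (run \<omega>) (s + (T - t)))) \<partial>lborel \<partial>runs)"
proof -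
  let ?H = "\<lambda>x s. of_bool (A n x s) * g (\<lambda>t\<in>J. path_state D x (s + t))"
  let ?Hr = "\<lambda>x s. of_bool (A n x s) * g (\<lambda>t\<in>J. turn_back (path_state D x (s + (T - t))))"
  have H [measurable]: "(\<lambda>(x, s). ?H x s) \<in> borel_measurable (seqs \<Otimes>\<^sub>M lborel)"
  proof -
    have [measurable]: "(\<lambda>z. \<lambda>t\<in>J. path_state D (fst z) (snd z + t)) \<in> seqs \<Otimes>\<^sub>M lborel \<rightarrow>\<^sub>M (\<Pi>\<^sub>M t\<in>J. borel)"
      by measurable
    have [measurable]: "Measurable.pred (seqs \<Otimes>\<^sub>M lborel) (\<lambda>z. A n (fst z) (snd z))"
      unfolding A_def by measurable
    show ?thesis unfolding split_beta' by measurable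
  qed
  have "(\<integral>\<^sup>+\<omega>. \<integral>\<^sup>+s. ?H (run \<omega>) s \<partial>lborel \<partial>runs)
      = (\<integral>\<^sup>+\<omega>. \<integral>\<^sup>+s. ?H (\<lambda>i. run \<omega> (min i n)) s \<partial>lborel \<partial>runs)"
  proof (rule nn_integral_cong, rule nn_integral_cong)
    fix \<omega> s
    let ?x = "run \<omega>" and ?y = "\<lambda>i. run \<omega> (min i n)"
    have arc: "arc_length D ?y n = arc_length D ?x n" "arc_length D ?y (Suc n) = arc_length D ?x (Suc n)"
      by (intro arc_length_cong; simp)+
    have "A n ?y s \<longleftrightarrow> A n ?x s" unfolding A_def arc by simp
    moreover have "(\<lambda>t\<in>J. path_state D ?x (s + t)) = (\<lambda>t\<in>J. path_state D ?y (s + t))" if "A n ?x s"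
    proof (rule restrict_ext)
      fix t assume "t \<in> J"
      then have "0 \<le> t" "t \<le> T" using J by auto
      then show "path_state D ?x (s + t) = path_state D ?y (s + t)"
        using \<open>A n ?x s\<close> unfolding A_def by (intro path_state_cong[of n]) auto
    qed
    ultimately show "?H ?x s = ?H ?y s" by (cases "A n ?x s") simp_all
  qed
  also have "\<dots> = (\<integral>\<^sup>+\<omega>. \<integral>\<^sup>+s. ?H (\<lambda>i. chord_flip D (run \<omega> (n - i))) s \<partial>lborel \<partial>runs)"
  proof (rule chain_reversal_functional)
    show "(\<lambda>x. \<integral>\<^sup>+s. ?H x s \<partial>lborel) \<in> borel_measurable seqs"
      by (rule lborel.borel_measurable_nn_integral[OF H])
  qed
  also have "\<dots> = (\<integral>\<^sup>+\<omega>. \<integral>\<^sup>+s. ?Hr (run \<omega>) s \<partial>lborel \<partial>runs)"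
  proof (rule nn_integral_cong_AE, use run_chords in eventually_elim)
    fix \<omega> assume "\<forall>n. run \<omega> n \<in> chords D"
    then have chords: "run \<omega> i \<in> chords D" for i by simp
    let ?x = "run \<omega>" and ?y = "\<lambda>i. chord_flip D (run \<omega> (n - i))"
    let ?L = "arc_length D ?x (Suc n)"
    have y: "arc_length D ?y k = ?L - arc_length D ?x (Suc n - k)" if "k \<le> Suc n" for k
      using chords that by (intro arc_length_reverse)
    have "(\<integral>\<^sup>+s. ?H ?y s \<partial>lborel) = (\<integral>\<^sup>+s. ?H ?y (?L - T - s) \<partial>lborel)"
    proof (rule nn_integral_lborel_reflect_real[symmetric])
      have "(\<lambda>s. (?y, s)) \<in> lborel \<rightarrow>\<^sub>M seqs \<Otimes>\<^sub>M lborel"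
        by (intro measurable_Pair measurable_const) (auto simp: space_PiM)
      from measurable_compose[OF this H] show "(\<lambda>s. ?H ?y s) \<in> borel_measurable borel" by simp
    qed
    also have "\<dots> = (\<integral>\<^sup>+s. ?Hr ?x s \<partial>lborel)"
    proof (rule nn_integral_cong_AE)
      \<comment> \<open>The starting positions for which an observed time falls exactly on a
        reflection.\<close>
      let ?bad = "\<Union>t\<in>J. \<Union>k. {arc_length D ?x k - (T - t)}"
      have "AE s in lborel. s \<notin> ?bad"
        using J(1) by (intro AE_not_in countable_imp_null_set_lborel countable_UN) (auto intro: countable_finite)
      then show "AE s in lborel. ?H ?y (?L - T - s) = ?Hr ?x s"
      proof eventually_elim
        fix s assume s: "s \<notin> ?bad"
        \<comment> \<open>The reflection exchanges the condition that the start lies on the first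
          chord with the one that the end lies on the last chord.\<close>
        have A: "A n ?y (?L - T - s) \<longleftrightarrow> A n ?x s"
          unfolding A_def using y[of n] y[of "Suc n"] chord_flip(2)[OF chords[of n]] by auto
        have "(\<lambda>t\<in>J. path_state D ?y (?L - T - s + t)) = (\<lambda>t\<in>J. turn_back (path_state D ?x (s + (T - t))))" if "A n ?x s"
        proof (rule restrict_ext)
          fix t assume t: "t \<in> J"
          then have "0 \<le> t" "t \<le> T" using J by auto
          moreover have "s + (T - t) \<noteq> arc_length D ?x k" for k
          proof
            assume "s + (T - t) = arc_length D ?x k"
            then have "s = arc_length D ?x k - (T - t)" by simp
            then show False using s t by blast
          qed
          ultimately have "path_state D ?y (?L - (s + (T - t))) = turn_back (path_state D ?x (s + (T - t)))"
            using \<open>A n ?x s\<close> chords unfolding A_def by (intro path_state_reverse) auto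
          moreover have "?L - T - s + t = ?L - (s + (T - t))" by simp
          ultimately show "path_state D ?y (?L - T - s + t) = turn_back (path_state D ?x (s + (T - t)))" by (simp only:)
        qed
        then show "?H ?y (?L - T - s) = ?Hr ?x s" using A by (cases "A n ?x s") simp_all
      qed
    qed
    finally show "(\<integral>\<^sup>+s. ?H ?y s \<partial>lborel) = (\<integral>\<^sup>+s. ?Hr ?x s \<partial>lborel)" .
  qed
  finally show ?thesis .
qed

text \<open>For almost every starting position exactly one \<open>n\<close> satisfies
  \<open>A n\<close>: one exists by \<open>no_explosion\<close>, and only countably many positions
  put the time \<open>T\<close> on a joint. Hence the identity is the sum of those for fixed
  \<open>n\<close>.\<close>

lemma path_reversal:
  assumes J: "finite J" "J \<subseteq> {0..T}" and T: "0 \<le> T"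
    and g [measurable]: "g \<in> borel_measurable (\<Pi>\<^sub>M t\<in>J. borel)"
  shows "(\<integral>\<^sup>+\<omega>. \<integral>\<^sup>+s. of_bool (0 < s \<and> s < chord_length D (fst \<omega>)) * g (\<lambda>t\<in>J. path_state D (run \<omega>) (s + t)) \<partial>lborel \<partial>runs)
    = (\<integral>\<^sup>+\<omega>. \<integral>\<^sup>+s. of_bool (0 < s \<and> s < chord_length D (fst \<omega>)) * g (\<lambda>t\<in>J. turn_back (path_state D (run \<omega>) (s + (T - t)))) \<partial>lborel \<partial>runs)"
proof -
  define A where "A n x s \<longleftrightarrow> 0 < s \<and> s < chord_length D (x 0) \<and> arc_length D x n < s + T \<and> s + T < arc_length D x (Suc n)" for n x s
  have A_meas [measurable]: "Measurable.pred (runs \<Otimes>\<^sub>M lborel) (\<lambda>z. A n (run (fst z)) (snd z))" for n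
    unfolding A_def by measurable
  have split: "(\<integral>\<^sup>+\<omega>. \<integral>\<^sup>+s. of_bool (0 < s \<and> s < chord_length D (fst \<omega>)) * g (h (run \<omega>) s) \<partial>lborel \<partial>runs)
    = (\<Sum>n. \<integral>\<^sup>+\<omega>. \<integral>\<^sup>+s. of_bool (A n (run \<omega>) s) * g (h (run \<omega>) s) \<partial>lborel \<partial>runs)"
    if h [measurable]: "(\<lambda>z. h (run (fst z)) (snd z)) \<in> runs \<Otimes>\<^sub>M lborel \<rightarrow>\<^sub>M (\<Pi>\<^sub>M t\<in>J. borel)" for h
  proof -
    let ?F = "\<lambda>n \<omega> s. of_bool (A n (run \<omega>) s) * g (h (run \<omega>) s)"
    have F [measurable]: "(\<lambda>(\<omega>, s). ?F n \<omega> s) \<in> borel_measurable (runs \<Otimes>\<^sub>M lborel)" for n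
      unfolding split_beta' by measurable
    have "(\<integral>\<^sup>+\<omega>. \<integral>\<^sup>+s. of_bool (0 < s \<and> s < chord_length D (fst \<omega>)) * g (h (run \<omega>) s) \<partial>lborel \<partial>runs)
      = (\<integral>\<^sup>+\<omega>. (\<Sum>n. \<integral>\<^sup>+s. ?F n \<omega> s \<partial>lborel) \<partial>runs)"
    proof (rule nn_integral_cong_AE, use no_explosion AE_space in eventually_elim)
      fix \<omega> assume unbounded: "\<forall>B::nat. \<exists>n. real B < (\<Sum>i<n. chord_length D (chord_chain (fst \<omega>) (snd \<omega>) i))"
        and \<omega>: "\<omega> \<in> space runs"
      let ?x = "run \<omega>"
      have Fs: "(\<lambda>s. ?F n \<omega> s) \<in> borel_measurable lborel" for n
        using measurable_compose[OF measurable_Pair1'[OF \<omega>] F[of n]] by simp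
      have "(\<integral>\<^sup>+s. of_bool (0 < s \<and> s < chord_length D (fst \<omega>)) * g (h ?x s) \<partial>lborel) = (\<integral>\<^sup>+s. (\<Sum>n. ?F n \<omega> s) \<partial>lborel)"
      proof (rule nn_integral_cong_AE)
        have "AE s in lborel. s \<notin> (\<Union>k. {arc_length D ?x k - T})"
          by (intro AE_not_in countable_imp_null_set_lborel countable_UN) auto
        then show "AE s in lborel. of_bool (0 < s \<and> s < chord_length D (fst \<omega>)) * g (h ?x s) = (\<Sum>n. ?F n \<omega> s)"
        proof eventually_elim
          fix s assume s: "s \<notin> (\<Union>k. {arc_length D ?x k - T})"
          show "of_bool (0 < s \<and> s < chord_length D (fst \<omega>)) * g (h ?x s) = (\<Sum>n. ?F n \<omega> s)"
          proof (cases "0 < s \<and> s < chord_length D (fst \<omega>)")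
            case True
            obtain B :: nat where "s + T < real B" using reals_Archimedean2 by blast
            moreover obtain m where "real B < arc_length D ?x m"
              using unbounded by (auto simp: arc_length_def run_def)
            ultimately have "s + T < arc_length D ?x (Suc m)"
              using arc_length_mono[of m "Suc m" D ?x] by (simp del: arc_length_simps)
            then obtain k where k: "arc_length D ?x k \<le> s + T" "s + T < arc_length D ?x (Suc k)"
              using obtain_leg[of "s + T" D ?x m] True T by auto
            have A: "A n ?x s \<longleftrightarrow> n = k" for n
            proof
              assume n: "A n ?x s"
              show "n = k"
              proof (rule ccontr)
                assume "n \<noteq> k"
                then consider "Suc n \<le> k" | "Suc k \<le> n" by linarith
                then show False
                  using arc_length_mono[of "Suc n" k D ?x] arc_length_mono[of "Suc k" n D ?x] k n
                  unfolding A_def by cases linarith+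
              qed
            next
              assume n: "n = k"
              have "s \<noteq> arc_length D ?x k - T" using s by blast
              then show "A n ?x s" using n k True by (auto simp: A_def run_def)
            qed
            have "(\<Sum>n. ?F n \<omega> s) = (\<Sum>n\<in>{k}. ?F n \<omega> s)" by (rule suminf_finite) (auto simp: A)
            then show ?thesis using True by (simp add: A)
          next
            case False
            then have "\<not> A n ?x s" for n by (auto simp: A_def run_def)
            then show ?thesis using False by simp
          qed
        qed
      qed
      also have "\<dots> = (\<Sum>n. \<integral>\<^sup>+s. ?F n \<omega> s \<partial>lborel)"
        by (rule nn_integral_suminf) (rule Fs)
      finally show "(\<integral>\<^sup>+s. of_bool (0 < s \<and> s < chord_length D (fst \<omega>)) * g (h ?x s) \<partial>lborel) = (\<Sum>n. \<integral>\<^sup>+s. ?F n \<omega> s \<partial>lborel)" .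
    qed
    also have "\<dots> = (\<Sum>n. \<integral>\<^sup>+\<omega>. \<integral>\<^sup>+s. ?F n \<omega> s \<partial>lborel \<partial>runs)"
      by (rule nn_integral_suminf) (rule lborel.borel_measurable_nn_integral[OF F])
    finally show ?thesis .
  qed
  have state: "(\<lambda>z. path_state D (run (fst z)) (snd z + r)) \<in> borel_measurable (runs \<Otimes>\<^sub>M lborel)" for r
    by measurable
  have h1: "(\<lambda>z. \<lambda>t\<in>J. path_state D (run (fst z)) (snd z + t)) \<in> runs \<Otimes>\<^sub>M lborel \<rightarrow>\<^sub>M (\<Pi>\<^sub>M t\<in>J. borel)"
    by (intro measurable_restrict state)
  have h2: "(\<lambda>z. \<lambda>t\<in>J. turn_back (path_state D (run (fst z)) (snd z + (T - t)))) \<in> runs \<Otimes>\<^sub>M lborel \<rightarrow>\<^sub>M (\<Pi>\<^sub>M t\<in>J. borel)"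
    by (intro measurable_restrict measurable_compose[OF state turn_back_measurable])
  show ?thesis
  proof (subst split[OF h1], subst split[OF h2])
    show "(\<Sum>n. \<integral>\<^sup>+\<omega>. \<integral>\<^sup>+s. of_bool (A n (run \<omega>) s) * g (\<lambda>t\<in>J. path_state D (run \<omega>) (s + t)) \<partial>lborel \<partial>runs)
      = (\<Sum>n. \<integral>\<^sup>+\<omega>. \<integral>\<^sup>+s. of_bool (A n (run \<omega>) s) * g (\<lambda>t\<in>J. turn_back (path_state D (run \<omega>) (s + (T - t)))) \<partial>lborel \<partial>runs)"
      unfolding A_def by (intro suminf_cong reversal_fixed_collisions J T g)
  qed
qed

subsection \<open>The billiard process\<close>

interpretation noise_lborel: pair_sigma_finite noise "lborel :: real measure" ..

lemma D_nonempty: "D \<noteq> {}"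
  using domain by (simp add: billiard_domain_def)

text \<open>The indices differ by one because chord 0 is the one containing the start: the
  \<open>n\<close>-th point of the boundary chain is the foot of chord \<open>n + 1\<close>, and
  \<open>\<eta> n\<close> determines that chord.\<close>

lemma billiard_chain_chord_chain:
  assumes c: "fst (chord_flip D c) \<in> frontier D"
  shows "fst (chord_chain c \<eta> (Suc n)) \<in> frontier D"
    and "billiard_chain D U (fst (chord_flip D c)) \<eta> n = fst (chord_chain c \<eta> (Suc n))"
    and "U (fst (chord_chain c \<eta> (Suc n))) (\<eta> n) = snd (chord_chain c \<eta> (Suc n))"
proof -
  have F: "fst (chord_chain c \<eta> (Suc n)) \<in> frontier D" for n
  proof (induction n)
    case 0
    then show ?case using c by (simp add: chord_step_def)
  next
    case (Suc n)
    have "fst (chord_chain c \<eta> (Suc (Suc n)))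
        = hit_point D (fst (chord_chain c \<eta> (Suc n))) (snd (chord_chain c \<eta> (Suc n)))"
      by (simp only: chord_chain.simps(2)[of c \<eta> "Suc n"] chord_step_def chord_flip_def fst_conv)
    then show ?case using hit_point_frontier'[OF Suc] by (simp only:)
  qed
  show "fst (chord_chain c \<eta> (Suc n)) \<in> frontier D" by (rule F)
  have snd: "U (fst (chord_chain c \<eta> (Suc n))) (\<eta> n) = snd (chord_chain c \<eta> (Suc n))" for n
    using F[of n] by (simp add: chord_step_def U0_def)
  show "U (fst (chord_chain c \<eta> (Suc n))) (\<eta> n) = snd (chord_chain c \<eta> (Suc n))" by (rule snd)
  show "billiard_chain D U (fst (chord_flip D c)) \<eta> n = fst (chord_chain c \<eta> (Suc n))"
  proof (induction n)
    case 0
    then show ?case by (simp add: chord_step_def)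
  next
    case (Suc n)
    have "billiard_chain D U (fst (chord_flip D c)) \<eta> (Suc n)
        = hit_point D (fst (chord_chain c \<eta> (Suc n))) (snd (chord_chain c \<eta> (Suc n)))"
      by (simp only: billiard_chain.simps Suc snd)
    also have "\<dots> = fst (chord_chain c \<eta> (Suc (Suc n)))"
      by (simp only: chord_chain.simps(2)[of c \<eta> "Suc n"] chord_step_def chord_flip_def fst_conv)
    finally show ?case .
  qed
qed

text \<open>Reflection times count from the end of chord 0, arc length from its beginning.\<close>

lemma reflection_time_arc_length:
  assumes c: "fst (chord_flip D c) \<in> frontier D"
  shows "reflection_time D U (fst (chord_flip D c)) \<eta> n = arc_length D (chord_chain c \<eta>) (Suc n) - chord_length D c"
proof -
  have "reflection_time D U (fst (chord_flip D c)) \<eta> n = (\<Sum>i<n. chord_length D (chord_chain c \<eta> (Suc i)))"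
    unfolding reflection_time_def chord_length_def
    by (simp only: billiard_chain_chord_chain(2,3)[OF c])
  then show ?thesis
    unfolding arc_length_def by (simp only: sum.lessThan_Suc_shift chord_chain.simps(1) add_diff_cancel_left')
qed

text \<open>The definite description is the one in \<open>billiard_from_boundary\<close>, so that
  \<open>uniform_start_billiard_eq\<close> below also holds where infinitely many reflections occur; measurability
  needs it everywhere.\<close>

definition later_state :: "(nat \<Rightarrow> 'p phase) \<Rightarrow> real \<Rightarrow> 'p phase" where
  "later_state x a = leg_state D x a (Suc (THE n. arc_length D x (Suc n) \<le> a \<and> a < arc_length D x (Suc (Suc n))))"

text \<open>The process rewritten in terms of chords and \<open>U0\<close>. Unlike the original,
  which involves \<open>U\<close>, it is visibly measurable on the whole product space. Here
  \<open>a\<close> is the arc length from the foot of the chord through the start.\<close>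

definition billiard_state ::
  "real \<Rightarrow> 'p phase \<times> (nat \<Rightarrow> 'p \<times> real) \<Rightarrow> 'p phase" where
  "billiard_state t = (\<lambda>(z, \<eta>). let x = chord_chain (chord_through D z) \<eta>; a = flight_time D (fst z) (- snd z) + t in
     if a < chord_length D (x 0) then leg_state D x a 0 else later_state x a)"

lemma uniform_start_billiard_eq:
  assumes x: "x \<in> D" and v: "norm v = 1"
  shows "uniform_start_billiard D U t ((x, v), \<eta>) = billiard_state t ((x, v), \<eta>)"
proof -
  define c where "c = chord_through D (x, v)"
  let ?C = "chord_chain c \<eta>" and ?s = "flight_time D x (- v)" and ?f = "flight_time D x v"
  note ct = chord_through[OF x v, folded c_def]
  have l: "chord_length D c = ?s + ?f" by (rule ct(2))
  have snd_c: "snd c = v" by (simp add: c_def chord_through_def)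
  have h: "hit_point D x v = fst (chord_flip D c)" using ct(4) by (simp add: chord_flip_def snd_c)
  have hF: "fst (chord_flip D c) \<in> frontier D" using flight_from_interior(2)[OF x v] by (simp add: h)
  show ?thesis
  proof (cases "t < ?f")
    case True
    have "x + t *\<^sub>R v = fst c + (?s + t) *\<^sub>R v" using ct(5) by (simp add: algebra_simps)
    then show ?thesis
      using True l by (simp add: uniform_start_billiard_def billiard_from_interior_def billiard_state_def
          leg_state_def snd_c Let_def c_def[symmetric])
  next
    case False
    let ?P = "\<lambda>n. arc_length D ?C (Suc n) \<le> ?s + t \<and> ?s + t < arc_length D ?C (Suc (Suc n))"
    \<comment> \<open>The predicates themselves are equal, so \<open>THE\<close> denotes the same
      index also where no index satisfies them.\<close>
    have P: "(\<lambda>n. reflection_time D U (fst (chord_flip D c)) \<eta> n \<le> t - ?f \<and>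
        t - ?f < reflection_time D U (fst (chord_flip D c)) \<eta> (Suc n)) = ?P"
      unfolding reflection_time_arc_length[OF hF] l by (rule ext) (simp only: algebra_simps, auto)
    define n where "n = (THE n. ?P n)"
    have "billiard_from_boundary D U (fst (chord_flip D c)) \<eta> (t - ?f)
        = (fst (?C (Suc n)) + (t - ?f - reflection_time D U (fst (chord_flip D c)) \<eta> n) *\<^sub>R snd (?C (Suc n)), snd (?C (Suc n)))"
      unfolding billiard_from_boundary_def Let_def P n_def[symmetric]
      by (simp only: billiard_chain_chord_chain(2,3)[OF hF])
    also have "t - ?f - reflection_time D U (fst (chord_flip D c)) \<eta> n = ?s + t - arc_length D ?C (Suc n)"
      unfolding reflection_time_arc_length[OF hF] l by simp
    also have "(fst (?C (Suc n)) + (?s + t - arc_length D ?C (Suc n)) *\<^sub>R snd (?C (Suc n)), snd (?C (Suc n)))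
        = later_state ?C (?s + t)"
      unfolding later_state_def leg_state_def n_def ..
    finally show ?thesis
      using False l by (simp add: uniform_start_billiard_def billiard_from_interior_def billiard_state_def
          Let_def c_def[symmetric] h)
  qed
qed

lemma later_state_path_state:
  assumes "chord_length D (x 0) \<le> a" "a < arc_length D x m"
  shows "later_state x a = path_state D x a"
proof -
  have "0 \<le> a" using assms(1) chord_length_nonneg[of D "x 0"] by linarith
  moreover have "a < arc_length D x (Suc m)" using assms(2) arc_length_mono[of m "Suc m" D x] by linarith
  ultimately obtain k where k: "k \<le> m" "arc_length D x k \<le> a" "a < arc_length D x (Suc k)"
    by (rule obtain_leg)
  have "k \<noteq> 0" using k(3) assms(1) by (intro notI) simp
  then obtain n where n: "k = Suc n" by (cases k) auto
  have "(THE n. arc_length D x (Suc n) \<le> a \<and> a < arc_length D x (Suc (Suc n))) = n"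
  proof (rule the_equality)
    fix j assume j: "arc_length D x (Suc j) \<le> a \<and> a < arc_length D x (Suc (Suc j))"
    show "j = n"
    proof (rule ccontr)
      assume "j \<noteq> n"
      then consider "Suc (Suc j) \<le> Suc n" | "Suc (Suc n) \<le> Suc j" by linarith
      then show False
        using arc_length_mono[of "Suc (Suc j)" "Suc n" D x] arc_length_mono[of "Suc (Suc n)" "Suc j" D x] j k(2,3)
        unfolding n by cases linarith+
    qed
  qed (use k n in blast)
  then show ?thesis
    using path_state_eq[OF k(2,3)] by (simp only: later_state_def n)
qed

lemma billiard_state_path_state:
  assumes c: "(\<xi>, u) \<in> chords D" and s: "0 < s" "s < flight_time D \<xi> u" and t: "0 \<le> t"
    and unbounded: "\<And>B::nat. \<exists>n. real B < arc_length D (chord_chain (\<xi>, u) \<eta>) n"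
  shows "billiard_state t ((\<xi> + s *\<^sub>R u, u), \<eta>) = path_state D (chord_chain (\<xi>, u) \<eta>) (s + t)"
proof -
  let ?C = "chord_chain (\<xi>, u) \<eta>"
  note p = point_on_chord[OF c s]
  obtain B :: nat where "s + t < real B" using reals_Archimedean2 by blast
  moreover obtain m where "real B < arc_length D ?C m" using unbounded[of B] by blast
  ultimately have m: "s + t < arc_length D ?C m" by linarith
  have "leg_state D ?C (s + t) 0 = path_state D ?C (s + t)" if "s + t < chord_length D (?C 0)"
    by (rule path_state_eq[symmetric]) (use that s t in simp_all)
  moreover have "later_state ?C (s + t) = path_state D ?C (s + t)" if "\<not> s + t < chord_length D (?C 0)"
    using m that by (intro later_state_path_state) auto
  ultimately show ?thesis
    by (auto simp: billiard_state_def Let_def p(2,3))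
qed

text \<open>By monotonicity at most one index qualifies, so \<open>THE\<close> is the measurable
  \<open>LEAST\<close> where an index exists and one fixed number elsewhere.\<close>

lemma later_state_measurable [measurable (raw)]:
  assumes [measurable]: "f \<in> M \<rightarrow>\<^sub>M seqs" "g \<in> borel_measurable M"
  shows "(\<lambda>x. later_state (f x) (g x)) \<in> borel_measurable M"
proof -
  let ?P = "\<lambda>n x. arc_length D (f x) (Suc n) \<le> g x \<and> g x < arc_length D (f x) (Suc (Suc n))"
  have uniq: "j = n" if "?P j x" "?P n x" for j n x
  proof (rule ccontr)
    assume "j \<noteq> n"
    then consider "Suc (Suc j) \<le> Suc n" | "Suc (Suc n) \<le> Suc j" by linarith
    then show False
      using arc_length_mono[of "Suc (Suc j)" "Suc n" D "f x"] arc_length_mono[of "Suc (Suc n)" "Suc j" D "f x"] that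
      by cases linarith+
  qed
  have the: "(THE n. ?P n x) = (if \<exists>n. ?P n x then LEAST n. ?P n x else (THE n. False))" for x
  proof (cases "\<exists>n. ?P n x")
    case True
    then have "?P (LEAST n. ?P n x) x" by (rule LeastI_ex)
    then have "(THE n. ?P n x) = (LEAST n. ?P n x)" using uniq by (intro the_equality) blast+
    then show ?thesis using True by simp
  next
    case False
    then have "(\<lambda>n. ?P n x) = (\<lambda>n. False)" by auto
    then show ?thesis using False by (simp only: if_False)
  qed
  have [measurable]: "Measurable.pred M (?P n)" for n by measurable
  have idx: "(\<lambda>x. Suc (THE n. ?P n x)) \<in> measurable M (count_space UNIV)"
    unfolding the by measurable
  show ?thesis
    unfolding later_state_def
    by (rule measurable_compose_countable[where f = "\<lambda>n x. leg_state D (f x) (g x) n" and g = "\<lambda>x. Suc (THE n. ?P n x)", OF _ idx])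
      measurable
qed

lemma chain_sequence_measurable [measurable (raw)]:
  assumes [measurable]: "f \<in> borel_measurable M" "g \<in> M \<rightarrow>\<^sub>M noise"
  shows "(\<lambda>x. chord_chain (f x) (g x)) \<in> M \<rightarrow>\<^sub>M seqs"
  by (rule measurable_PiM_single') (auto, measurable)

lemma billiard_state_measurable [measurable]: "billiard_state t \<in> borel_measurable (borel \<Otimes>\<^sub>M noise)"
  unfolding billiard_state_def split_beta' Let_def by measurable

section \<open>The uniform start, expressed by flux and position on the chord\<close>

lemma space_uniform_phase: "space (uniform_phase D) = D \<times> sphere 0 1"
  by (simp add: uniform_phase_def space_pair_measure space_restrict_space)

lemma space_billiard_space: "space (billiard_space D e) = (D \<times> sphere 0 1) \<times> space noise"
  by (simp add: billiard_space_def space_pair_measure space_uniform_phase)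

lemma uniform_phase_ident [measurable]: "(\<lambda>z. z) \<in> uniform_phase D \<rightarrow>\<^sub>M borel"
proof -
  have "(\<lambda>z. (fst z, snd z)) \<in> uniform_phase D \<rightarrow>\<^sub>M borel \<Otimes>\<^sub>M borel"
    unfolding uniform_phase_def
  proof (rule measurable_Pair)
    have "(\<lambda>x. x) \<in> uniform_measure (restrict_space lborel D) D \<rightarrow>\<^sub>M borel"
      by (simp add: measurable_cong_sets[OF sets_uniform_measure refl] measurable_restrict_space1)
    then show "fst \<in> uniform_measure (restrict_space lborel D) D \<Otimes>\<^sub>M uniform_measure sphere_measure (sphere 0 1) \<rightarrow>\<^sub>M borel"
      by (rule measurable_compose[OF measurable_fst])
    have "(\<lambda>x. x) \<in> uniform_measure sphere_measure (sphere 0 1) \<rightarrow>\<^sub>M borel"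
      by (simp add: measurable_cong_sets[OF sets_uniform_measure refl] measurable_sphere_measure)
    then show "snd \<in> uniform_measure (restrict_space lborel D) D \<Otimes>\<^sub>M uniform_measure sphere_measure (sphere 0 1) \<rightarrow>\<^sub>M borel"
      by (rule measurable_compose[OF measurable_snd])
  qed
  then show ?thesis by (simp add: borel_prod)
qed

lemma billiard_space_ident: "(\<lambda>z. z) \<in> billiard_space D e \<rightarrow>\<^sub>M borel \<Otimes>\<^sub>M noise"
proof -
  have "(\<lambda>z. (fst z, snd z)) \<in> billiard_space D e \<rightarrow>\<^sub>M borel \<Otimes>\<^sub>M noise"
    unfolding billiard_space_def
    by (intro measurable_Pair measurable_snd measurable_compose[OF measurable_fst uniform_phase_ident])
  then show ?thesis by simp
qed

lemma billiard_measurable: "uniform_start_billiard D U t \<in> borel_measurable (billiard_space D e)"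
proof -
  have "billiard_state t \<in> borel_measurable (billiard_space D e)"
    using measurable_compose[OF billiard_space_ident billiard_state_measurable] by simp
  then show ?thesis
    by (rule measurable_cong[THEN iffD1, rotated])
      (auto simp: space_billiard_space uniform_start_billiard_eq)
qed

lemma emeasure_D: "emeasure lborel D \<noteq> 0" "emeasure lborel D \<noteq> \<infinity>"
proof -
  show "emeasure lborel D \<noteq> 0"
    using open_not_negligible[OF open_D D_nonempty] open_D
    by (auto simp: negligible_iff_null_sets null_sets_completionI null_sets_def)
  show "emeasure lborel D \<noteq> \<infinity>"
    using emeasure_bounded_finite[OF bounded] by simp
qed

lemma emeasure_sphere:
  "emeasure (sphere_measure :: ('p \<times> real) measure) (sphere 0 1) \<noteq> 0"
  "emeasure (sphere_measure :: ('p \<times> real) measure) (sphere 0 1) \<noteq> \<infinity>"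
proof -
  show "emeasure (sphere_measure :: ('p \<times> real) measure) (sphere 0 1) \<noteq> \<infinity>"
    using finite_measure.emeasure_finite[OF finite_measure_sphere_measure] by auto
  show "emeasure (sphere_measure :: ('p \<times> real) measure) (sphere 0 1) \<noteq> 0"
  proof
    assume 0: "emeasure (sphere_measure :: ('p \<times> real) measure) (sphere 0 1) = 0"
    have "sphere 0 1 \<in> null_sets (sphere_measure :: ('p \<times> real) measure)"
      using 0 sets.top[of "sphere_measure :: ('p \<times> real) measure"] by (intro null_setsI) simp_all
    from AE_not_in[OF this] have "AE u in (sphere_measure :: ('p \<times> real) measure). ennreal (max 0 (e \<bullet> u)) = 0"
      by (rule AE_mp) (rule AE_I2, simp)
    then have "(\<integral>\<^sup>+u. ennreal (max 0 (e \<bullet> u)) \<partial>sphere_measure) = (\<integral>\<^sup>+u. 0 \<partial>(sphere_measure :: ('p \<times> real) measure))"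
      by (rule nn_integral_cong_AE)
    then show False using cosine_integral_pos_finite(1)[OF norm_e] by simp
  qed
qed

lemma prob_space_uniform_sphere:
  "prob_space (uniform_measure (sphere_measure :: ('p \<times> real) measure) (sphere 0 1))"
  by (rule prob_space_uniform_measure) (use emeasure_sphere in auto)

lemma prob_space_uniform_D: "prob_space (uniform_measure (restrict_space lborel D) D)"
  by (rule prob_space_uniform_measure) (use emeasure_D in \<open>auto simp: emeasure_restrict_space\<close>)

interpretation uniform_sphere: prob_space "uniform_measure (sphere_measure :: ('p \<times> real) measure) (sphere 0 1)"
  by (rule prob_space_uniform_sphere)

interpretation uniform_D: prob_space "uniform_measure (restrict_space lborel D) D"
  by (rule prob_space_uniform_D)

interpretation phase: pair_prob_space "uniform_measure (restrict_space lborel D) D"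
  "uniform_measure (sphere_measure :: ('p \<times> real) measure) (sphere 0 1)" ..

interpretation phase_noise: pair_prob_space "uniform_phase D" noise
  unfolding uniform_phase_def ..

lemma prob_space_billiard_space: "prob_space (billiard_space D e)"
  unfolding billiard_space_def by unfold_locales

text \<open>Only proportionality to phase volume matters below, so the constant is left unspecified;
  it is the same for all \<open>f\<close>.\<close>

lemma nn_integral_uniform_phase:
  "\<exists>k. \<forall>f \<in> borel_measurable borel. (\<integral>\<^sup>+z. f z \<partial>uniform_phase D)
     = k * (\<integral>\<^sup>+v. \<integral>\<^sup>+x. indicator D x * f (x, v) \<partial>lborel \<partial>surface_measure)"
proof (intro exI ballI)
  fix f :: "'p phase \<Rightarrow> ennreal"
  assume f [measurable]: "f \<in> borel_measurable borel"
  let ?a = "emeasure lborel D" and ?b = "emeasure (sphere_measure :: ('p \<times> real) measure) (sphere 0 1)"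
  have [measurable]: "Measurable.pred borel (\<lambda>x. x \<in> D)" by simp
  have inner: "(\<integral>\<^sup>+v. f (x, v) \<partial>uniform_measure sphere_measure (sphere 0 1))
      = (\<integral>\<^sup>+v. f (x, v) \<partial>surface_measure) * inverse ?b" for x
  proof -
    have "(\<lambda>v. f (x, v)) \<in> borel_measurable borel" by measurable
    then have "(\<integral>\<^sup>+v. f (x, v) \<partial>uniform_measure sphere_measure (sphere 0 1))
        = (\<integral>\<^sup>+v. f (x, v) * indicator (sphere 0 1) v \<partial>sphere_measure) / ?b"
      using sets.top[of "sphere_measure :: ('p \<times> real) measure"]
      by (intro nn_integral_uniform_measure measurable_sphere_measure) simp_all
    also have "(\<integral>\<^sup>+v. f (x, v) * indicator (sphere 0 1) v \<partial>sphere_measure) = (\<integral>\<^sup>+v. f (x, v) \<partial>sphere_measure)"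
      by (intro nn_integral_cong) simp
    also have "\<dots> = (\<integral>\<^sup>+v. f (x, v) \<partial>surface_measure)"
      by (rule nn_integral_surface_measure[symmetric]) measurable
    finally show ?thesis by (simp only: divide_ennreal_def)
  qed
  have "(\<integral>\<^sup>+z. f z \<partial>uniform_phase D)
     = (\<integral>\<^sup>+x. \<integral>\<^sup>+v. f (x, v) \<partial>uniform_measure sphere_measure (sphere 0 1) \<partial>uniform_measure (restrict_space lborel D) D)"
    unfolding uniform_phase_def
    by (rule uniform_sphere.nn_integral_fst[symmetric])
      (rule measurable_compose[OF uniform_phase_ident f, unfolded uniform_phase_def])
  also have "\<dots> = (\<integral>\<^sup>+x. (\<integral>\<^sup>+v. f (x, v) \<partial>surface_measure) * inverse ?b \<partial>uniform_measure (restrict_space lborel D) D)"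
    by (simp only: inner)
  also have "\<dots> = (\<integral>\<^sup>+x. (\<integral>\<^sup>+v. f (x, v) \<partial>surface_measure) * inverse ?b * indicator D x \<partial>restrict_space lborel D) / emeasure (restrict_space lborel D) D"
    by (rule nn_integral_uniform_measure) (auto intro!: measurable_restrict_space1 simp: sets_restrict_space_iff)
  also have "emeasure (restrict_space lborel D) D = ?a"
    by (simp add: emeasure_restrict_space)
  also have "(\<integral>\<^sup>+x. (\<integral>\<^sup>+v. f (x, v) \<partial>surface_measure) * inverse ?b * indicator D x \<partial>restrict_space lborel D)
      = (\<integral>\<^sup>+x. (\<integral>\<^sup>+v. indicator D x * f (x, v) \<partial>surface_measure) * inverse ?b \<partial>lborel)"
    by (subst nn_integral_restrict_space) (auto intro!: nn_integral_cong simp: indicator_def)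
  also have "\<dots> = (\<integral>\<^sup>+x. \<integral>\<^sup>+v. indicator D x * f (x, v) \<partial>surface_measure \<partial>lborel) * inverse ?b"
    by (rule nn_integral_multc) measurable
  also have "(\<integral>\<^sup>+x. \<integral>\<^sup>+v. indicator D x * f (x, v) \<partial>surface_measure \<partial>lborel)
      = (\<integral>\<^sup>+v. \<integral>\<^sup>+x. indicator D x * f (x, v) \<partial>lborel \<partial>surface_measure)"
  proof (rule surface_lborel.Fubini')
    have "(\<lambda>z. (snd z, fst z)) \<in> surface_measure \<Otimes>\<^sub>M lborel \<rightarrow>\<^sub>M (borel :: 'p phase measure)"
      by (intro borel_measurable_Pair measurable_compose[OF measurable_snd] measurable_compose[OF measurable_fst])
        (auto intro: measurable_ident_sets)
    from measurable_compose[OF this, of "\<lambda>z. indicator D (fst z) * f z" borel]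
    show "(\<lambda>(v, x). indicator D x * f (x, v)) \<in> borel_measurable (surface_measure \<Otimes>\<^sub>M lborel)"
      by (simp add: split_beta')
  qed
  finally show "(\<integral>\<^sup>+z. f z \<partial>uniform_phase D)
     = (inverse ?a * inverse ?b) * (\<integral>\<^sup>+v. \<integral>\<^sup>+x. indicator D x * f (x, v) \<partial>lborel \<partial>surface_measure)"
    by (simp add: divide_ennreal_def mult_ac)
qed

text \<open>\<open>santalo\<close> replaces the uniform start by a chord taken from the flux and
  Lebesgue measure along it; the noise is carried along by Fubini. This form allows
  \<open>path_reversal\<close> to be applied.\<close>

lemma nn_integral_billiard_space:
  "\<exists>k. \<forall>F \<in> borel_measurable (borel \<Otimes>\<^sub>M noise). (\<integral>\<^sup>+\<omega>. F \<omega> \<partial>billiard_space D e)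
     = k * (\<integral>\<^sup>+\<omega>. \<integral>\<^sup>+s. of_bool (0 < s \<and> s < chord_length D (fst \<omega>)) *
         F ((fst (fst \<omega>) + s *\<^sub>R snd (fst \<omega>), snd (fst \<omega>)), snd \<omega>) \<partial>lborel \<partial>runs)"
proof -
  obtain k where k: "\<And>f. f \<in> borel_measurable borel \<Longrightarrow> (\<integral>\<^sup>+z. f z \<partial>uniform_phase D)
     = k * (\<integral>\<^sup>+v. \<integral>\<^sup>+x. indicator D x * f (x, v) \<partial>lborel \<partial>surface_measure)"
    using nn_integral_uniform_phase by blast
  have "(\<integral>\<^sup>+\<omega>. F \<omega> \<partial>billiard_space D e)
     = k * (\<integral>\<^sup>+\<omega>. \<integral>\<^sup>+s. of_bool (0 < s \<and> s < chord_length D (fst \<omega>)) *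
         F ((fst (fst \<omega>) + s *\<^sub>R snd (fst \<omega>), snd (fst \<omega>)), snd \<omega>) \<partial>lborel \<partial>runs)"
    if F [measurable]: "F \<in> borel_measurable (borel \<Otimes>\<^sub>M noise)" for F
  proof -
    let ?f = "\<lambda>z. \<integral>\<^sup>+\<eta>. F (z, \<eta>) \<partial>noise"
    have f [measurable]: "?f \<in> borel_measurable borel" by measurable
    let ?G = "\<lambda>c \<eta> s. of_bool (0 < s \<and> s < chord_length D c) * F ((fst c + s *\<^sub>R snd c, snd c), \<eta>)"
    have G: "(\<lambda>(\<omega>, s). ?G (fst \<omega>) (snd \<omega>) s) \<in> borel_measurable (runs \<Otimes>\<^sub>M lborel)"
      by measurable
    have Gc: "(\<lambda>(\<eta>, s). ?G c \<eta> s) \<in> borel_measurable (noise \<Otimes>\<^sub>M lborel)" for c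
      by measurable
    have "(\<integral>\<^sup>+\<omega>. F \<omega> \<partial>billiard_space D e) = (\<integral>\<^sup>+z. ?f z \<partial>uniform_phase D)"
      unfolding billiard_space_def
      by (rule noise.nn_integral_fst[symmetric])
        (rule measurable_compose[OF billiard_space_ident F, unfolded billiard_space_def])
    also have "\<dots> = k * (\<integral>\<^sup>+c. \<integral>\<^sup>+s. indicator {0<..<chord_length D c} s * ?f (fst c + s *\<^sub>R snd c, snd c) \<partial>lborel \<partial>flux D)"
      unfolding k[OF f] santalo[OF f] ..
    also have "(\<integral>\<^sup>+c. \<integral>\<^sup>+s. indicator {0<..<chord_length D c} s * ?f (fst c + s *\<^sub>R snd c, snd c) \<partial>lborel \<partial>flux D)
        = (\<integral>\<^sup>+c. \<integral>\<^sup>+s. \<integral>\<^sup>+\<eta>. ?G c \<eta> s \<partial>noise \<partial>lborel \<partial>flux D)"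
      by (intro nn_integral_cong) (simp add: nn_integral_cmult indicator_def)
    also have "\<dots> = (\<integral>\<^sup>+c. \<integral>\<^sup>+\<eta>. \<integral>\<^sup>+s. ?G c \<eta> s \<partial>lborel \<partial>noise \<partial>flux D)"
      by (intro nn_integral_cong noise_lborel.Fubini' Gc)
    also have "\<dots> = (\<integral>\<^sup>+\<omega>. \<integral>\<^sup>+s. ?G (fst \<omega>) (snd \<omega>) s \<partial>lborel \<partial>runs)"
      by (subst noise.nn_integral_fst[symmetric]) (use lborel.borel_measurable_nn_integral[OF G] in simp_all)
    finally show ?thesis .
  qed
  then show ?thesis by blast
qed

section \<open>Reversibility of the billiard on a finite horizon and of its stationary
  version\<close>

lemma billiard_reversal:
  assumes J: "finite J" "J \<subseteq> {0..T}" and T: "0 \<le> T"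
    and g [measurable]: "g \<in> borel_measurable (\<Pi>\<^sub>M t\<in>J. borel)"
  shows "(\<integral>\<^sup>+\<omega>. g (\<lambda>t\<in>J. uniform_start_billiard D U t \<omega>) \<partial>billiard_space D e)
    = (\<integral>\<^sup>+\<omega>. g (\<lambda>t\<in>J. turn_back (uniform_start_billiard D U (T - t) \<omega>)) \<partial>billiard_space D e)"
proof -
  obtain k where k: "\<And>F. F \<in> borel_measurable (borel \<Otimes>\<^sub>M noise) \<Longrightarrow> (\<integral>\<^sup>+\<omega>. F \<omega> \<partial>billiard_space D e)
     = k * (\<integral>\<^sup>+\<omega>. \<integral>\<^sup>+s. of_bool (0 < s \<and> s < chord_length D (fst \<omega>)) *
         F ((fst (fst \<omega>) + s *\<^sub>R snd (fst \<omega>), snd (fst \<omega>)), snd \<omega>) \<partial>lborel \<partial>runs)"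
    using nn_integral_billiard_space by blast
  \<comment> \<open>The times \<open>r t\<close> and the maps \<open>\<phi> t\<close> are kept
    general because the same facts serve the forward side (\<open>t\<close> and the identity) and
    the reversed side (\<open>T - t\<close> and \<open>turn_back\<close>).\<close>
  have meas: "(\<lambda>\<omega>. g (\<lambda>t\<in>J. \<phi> t (billiard_state (r t) \<omega>))) \<in> borel_measurable (borel \<Otimes>\<^sub>M noise)"
    if "\<And>t. \<phi> t \<in> borel_measurable borel" for r and \<phi> :: "real \<Rightarrow> _ \<Rightarrow> _"
    by (intro measurable_compose[OF _ g] measurable_restrict measurable_compose[OF billiard_state_measurable that])
  have on_space: "(\<integral>\<^sup>+\<omega>. g (\<lambda>t\<in>J. \<phi> t (uniform_start_billiard D U (r t) \<omega>)) \<partial>billiard_space D e)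
      = (\<integral>\<^sup>+\<omega>. g (\<lambda>t\<in>J. \<phi> t (billiard_state (r t) \<omega>)) \<partial>billiard_space D e)"
    for r and \<phi> :: "real \<Rightarrow> _ \<Rightarrow> _"
    by (rule nn_integral_cong) (auto simp: space_billiard_space uniform_start_billiard_eq)
  have path: "(\<integral>\<^sup>+\<omega>. \<integral>\<^sup>+s. of_bool (0 < s \<and> s < chord_length D (fst \<omega>)) *
         g (\<lambda>t\<in>J. \<phi> t (billiard_state (r t) ((fst (fst \<omega>) + s *\<^sub>R snd (fst \<omega>), snd (fst \<omega>)), snd \<omega>))) \<partial>lborel \<partial>runs)
     = (\<integral>\<^sup>+\<omega>. \<integral>\<^sup>+s. of_bool (0 < s \<and> s < chord_length D (fst \<omega>)) *
         g (\<lambda>t\<in>J. \<phi> t (path_state D (run \<omega>) (s + r t))) \<partial>lborel \<partial>runs)"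
    if r: "\<And>t. t \<in> J \<Longrightarrow> 0 \<le> r t" for r and \<phi> :: "real \<Rightarrow> _ \<Rightarrow> _"
  proof (rule nn_integral_cong_AE, use run_chords no_explosion in eventually_elim, rule nn_integral_cong)
    fix \<omega> s
    assume chords: "\<forall>n. run \<omega> n \<in> chords D"
      and unb: "\<forall>B::nat. \<exists>n. real B < (\<Sum>i<n. chord_length D (chord_chain (fst \<omega>) (snd \<omega>) i))"
    obtain \<xi> u \<eta> where \<omega>: "\<omega> = ((\<xi>, u), \<eta>)" by (metis prod.collapse)
    have c: "(\<xi>, u) \<in> chords D" using chords[rule_format, of 0] by (simp add: run_def \<omega>)
    have "billiard_state (r t) ((\<xi> + s *\<^sub>R u, u), \<eta>) = path_state D (run \<omega>) (s + r t)"
      if "0 < s" "s < flight_time D \<xi> u" "t \<in> J" for t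
      unfolding run_def \<omega> fst_conv snd_conv
      by (rule billiard_state_path_state[OF c that(1,2) r[OF that(3)]])
        (use unb in \<open>simp add: arc_length_def \<omega>\<close>)
    then have "(\<lambda>t\<in>J. \<phi> t (billiard_state (r t) ((\<xi> + s *\<^sub>R u, u), \<eta>))) = (\<lambda>t\<in>J. \<phi> t (path_state D (run \<omega>) (s + r t)))"
      if "0 < s \<and> s < flight_time D \<xi> u" using that by (intro restrict_ext) auto
    then show "of_bool (0 < s \<and> s < chord_length D (fst \<omega>)) *
         g (\<lambda>t\<in>J. \<phi> t (billiard_state (r t) ((fst (fst \<omega>) + s *\<^sub>R snd (fst \<omega>), snd (fst \<omega>)), snd \<omega>)))
       = of_bool (0 < s \<and> s < chord_length D (fst \<omega>)) * g (\<lambda>t\<in>J. \<phi> t (path_state D (run \<omega>) (s + r t)))"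
      by (cases "0 < s \<and> s < flight_time D \<xi> u") (auto simp: \<omega> chord_length_def)
  qed
  have pos: "0 \<le> t" "0 \<le> T - t" if "t \<in> J" for t using J that by auto
  have 1: "(\<integral>\<^sup>+\<omega>. g (\<lambda>t\<in>J. uniform_start_billiard D U t \<omega>) \<partial>billiard_space D e)
      = k * (\<integral>\<^sup>+\<omega>. \<integral>\<^sup>+s. of_bool (0 < s \<and> s < chord_length D (fst \<omega>)) *
         g (\<lambda>t\<in>J. path_state D (run \<omega>) (s + t)) \<partial>lborel \<partial>runs)"
    using on_space[of "\<lambda>t z. z" "\<lambda>t. t"] k[OF meas[of "\<lambda>t z. z" "\<lambda>t. t"]] path[of "\<lambda>t. t" "\<lambda>t z. z", OF pos(1)] by simp
  have 2: "(\<integral>\<^sup>+\<omega>. g (\<lambda>t\<in>J. turn_back (uniform_start_billiard D U (T - t) \<omega>)) \<partial>billiard_space D e)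
      = k * (\<integral>\<^sup>+\<omega>. \<integral>\<^sup>+s. of_bool (0 < s \<and> s < chord_length D (fst \<omega>)) *
         g (\<lambda>t\<in>J. turn_back (path_state D (run \<omega>) (s + (T - t)))) \<partial>lborel \<partial>runs)"
    using on_space[of "\<lambda>t. turn_back" "\<lambda>t. T - t"] k[OF meas[of "\<lambda>t. turn_back" "\<lambda>t. T - t"]]
      path[of "\<lambda>t. T - t" "\<lambda>t. turn_back", OF pos(2)] by simp
  show ?thesis unfolding 1 2 path_reversal[OF J T g] ..
qed

lemma billiard_reversal_law:
  assumes J: "finite J" "J \<subseteq> {0..T}" and T: "0 \<le> T"
  shows "distr (billiard_space D e) (\<Pi>\<^sub>M t\<in>J. borel) (\<lambda>\<omega>. \<lambda>t\<in>J. uniform_start_billiard D U t \<omega>)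
    = distr (billiard_space D e) (\<Pi>\<^sub>M t\<in>J. borel) (\<lambda>\<omega>. \<lambda>t\<in>J. turn_back (uniform_start_billiard D U (T - t) \<omega>))"
    (is "distr ?N ?S ?f = distr ?N ?S ?g")
proof (rule measure_eqI)
  fix A assume "A \<in> sets (distr ?N ?S ?f)"
  then have A: "A \<in> sets ?S" by simp
  have f: "?f \<in> ?N \<rightarrow>\<^sub>M ?S" by (intro measurable_restrict billiard_measurable)
  have g: "?g \<in> ?N \<rightarrow>\<^sub>M ?S"
    by (intro measurable_restrict measurable_compose[OF billiard_measurable turn_back_measurable])
  have "emeasure (distr ?N ?S h) A = (\<integral>\<^sup>+\<omega>. indicator A (h \<omega>) \<partial>?N)" if h: "h \<in> ?N \<rightarrow>\<^sub>M ?S" for h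
  proof -
    have "emeasure (distr ?N ?S h) A = (\<integral>\<^sup>+x. indicator A x \<partial>distr ?N ?S h)" using A by simp
    also have "\<dots> = (\<integral>\<^sup>+\<omega>. indicator A (h \<omega>) \<partial>?N)" using A h by (intro nn_integral_distr) auto
    finally show ?thesis .
  qed
  from this[OF f] this[OF g] billiard_reversal[OF J T, of "indicator A"] A
  show "emeasure (distr ?N ?S ?f) A = emeasure (distr ?N ?S ?g) A" by simp
qed simp

text \<open>That the right-hand side does not depend on \<open>T\<close> is the invariance of the uniform distribution.\<close>

lemma billiard_shifted_law:
  assumes K: "finite K" "\<And>t. t \<in> K \<Longrightarrow> \<bar>t\<bar> \<le> m" and m: "0 \<le> m" "m \<le> T"
  shows "fdd (billiard_space D e) (\<lambda>t. uniform_start_billiard D U (t + T)) K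
    = distr (billiard_space D e) (\<Pi>\<^sub>M t\<in>K. borel) (\<lambda>\<omega>. \<lambda>t\<in>K. turn_back (uniform_start_billiard D U (m - t) \<omega>))"
proof -
  let ?N = "billiard_space D e" and ?J = "(\<lambda>t. t + T) ` K" and ?B = "uniform_start_billiard D U"
  let ?\<theta> = "\<lambda>z :: real \<Rightarrow> 'p phase. \<lambda>t\<in>K. z (t + T)"
  \<comment> \<open>Reversal of the horizon from 0 to \<open>m + T\<close> takes the observation
    time \<open>t + T\<close> to \<open>m - t\<close>, in which \<open>T\<close> no longer
    occurs.\<close>
  have J: "finite ?J" "?J \<subseteq> {0..m + T}" "0 \<le> m + T" using K m by (auto simp: abs_le_iff) force+
  have \<theta>: "?\<theta> \<in> (\<Pi>\<^sub>M t\<in>?J. borel) \<rightarrow>\<^sub>M (\<Pi>\<^sub>M t\<in>K. borel)"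
    by (intro measurable_restrict measurable_component_singleton) auto
  have f: "(\<lambda>\<omega>. \<lambda>t\<in>?J. ?B t \<omega>) \<in> ?N \<rightarrow>\<^sub>M (\<Pi>\<^sub>M t\<in>?J. borel)"
    by (intro measurable_restrict billiard_measurable)
  have g: "(\<lambda>\<omega>. \<lambda>t\<in>?J. turn_back (?B (m + T - t) \<omega>)) \<in> ?N \<rightarrow>\<^sub>M (\<Pi>\<^sub>M t\<in>?J. borel)"
    by (intro measurable_restrict measurable_compose[OF billiard_measurable turn_back_measurable])
  have "fdd ?N (\<lambda>t. ?B (t + T)) K = distr (distr ?N (\<Pi>\<^sub>M t\<in>?J. borel) (\<lambda>\<omega>. \<lambda>t\<in>?J. ?B t \<omega>)) (\<Pi>\<^sub>M t\<in>K. borel) ?\<theta>"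
    unfolding fdd_def distr_distr[OF \<theta> f] by (intro distr_cong) (auto simp: comp_def restrict_def)
  also have "\<dots> = distr (distr ?N (\<Pi>\<^sub>M t\<in>?J. borel) (\<lambda>\<omega>. \<lambda>t\<in>?J. turn_back (?B (m + T - t) \<omega>))) (\<Pi>\<^sub>M t\<in>K. borel) ?\<theta>"
    unfolding billiard_reversal_law[OF J] ..
  also have "\<dots> = distr ?N (\<Pi>\<^sub>M t\<in>K. borel) (\<lambda>\<omega>. \<lambda>t\<in>K. turn_back (?B (m - t) \<omega>))"
    unfolding distr_distr[OF \<theta> g] by (intro distr_cong) (auto simp: comp_def restrict_def)
  finally show ?thesis .
qed

text \<open>For \<open>T \<ge> m\<close> the laws in the limit are constant by
  \<open>billiard_shifted_law\<close>, so the weak limit is their common value; bounded continuous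
  functions separate finite measures.\<close>

lemma stationary_law:
  assumes Z: "stationary_billiard D e U M Z"
    and K: "finite K" "\<And>t. t \<in> K \<Longrightarrow> \<bar>t\<bar> \<le> m" and m: "0 \<le> m"
  shows "fdd M Z K
    = distr (billiard_space D e) (\<Pi>\<^sub>M t\<in>K. borel) (\<lambda>\<omega>. \<lambda>t\<in>K. turn_back (uniform_start_billiard D U (m - t) \<omega>))"
    (is "_ = ?Q")
proof (rule measure_eqI_continuous_PiM[OF K(1)])
  have M: "prob_space M" and meas: "\<And>t. Z t \<in> borel_measurable M" using Z by (auto simp: stationary_billiard_def)
  show "sets (fdd M Z K) = sets (\<Pi>\<^sub>M t\<in>K. borel)" by (simp add: fdd_def)
  show "sets ?Q = sets (\<Pi>\<^sub>M t\<in>K. borel)" by simp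
  show "finite_measure (fdd M Z K)"
    unfolding fdd_def
    by (intro finite_measure.finite_measure_distr prob_space.finite_measure M measurable_restrict meas)
  show "finite_measure ?Q"
    by (intro finite_measure.finite_measure_distr prob_space.finite_measure prob_space_billiard_space
        measurable_restrict measurable_compose[OF billiard_measurable turn_back_measurable])
  fix f :: "(real \<Rightarrow> 'p phase) \<Rightarrow> real"
  assume "continuous_on UNIV f" "bounded (range f)"
  then have "((\<lambda>T. LINT z|fdd (billiard_space D e) (\<lambda>t. uniform_start_billiard D U (t + T)) K. f z)
      \<longlongrightarrow> (LINT z|fdd M Z K. f z)) at_top"
    using Z K(1) by (simp add: stationary_billiard_def)
  moreover have "eventually (\<lambda>T. (LINT z|fdd (billiard_space D e) (\<lambda>t. uniform_start_billiard D U (t + T)) K. f z)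
      = (LINT z|?Q. f z)) at_top"
    using eventually_ge_at_top[of m] by eventually_elim (simp add: billiard_shifted_law[OF K m])
  ultimately have "((\<lambda>T::real. LINT z|?Q. f z) \<longlongrightarrow> (LINT z|fdd M Z K. f z)) at_top"
    by (rule Lim_transform_eventually)
  then show "(LINT z|fdd M Z K. f z) = (LINT z|?Q. f z)"
    by (rule tendsto_unique[OF trivial_limit_at_top_linorder _ tendsto_const])
qed

text \<open>The stationary law has two descriptions: the billiard at the times \<open>t + m\<close>,
  and the turned-back billiard at the times \<open>m - t\<close>. Applying the first to the negated
  times and turning back yields the second for \<open>K\<close>.\<close>

lemma stationary_reversal:
  assumes Z: "stationary_billiard D e U M Z"
  shows "same_law M Z M (\<lambda>t \<omega>. turn_back (Z (- t) \<omega>))"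
  unfolding same_law_def
proof (intro allI impI)
  fix K :: "real set" assume K: "finite K"
  \<comment> \<open>Any common bound of the times would do; the sum also covers an empty
    \<open>K\<close>.\<close>
  define m where "m = (\<Sum>t\<in>K. \<bar>t\<bar>)"
  have m: "0 \<le> m" "\<And>t. t \<in> K \<Longrightarrow> \<bar>t\<bar> \<le> m"
    using K by (auto simp: m_def intro: sum_nonneg member_le_sum)
  let ?N = "billiard_space D e" and ?J = "uminus ` K" and ?B = "uniform_start_billiard D U"
  have J: "finite ?J" "\<And>t. t \<in> ?J \<Longrightarrow> \<bar>t\<bar> \<le> m" using K m by auto
  have meas: "Z t \<in> borel_measurable M" for t using Z by (simp add: stationary_billiard_def)
  let ?\<theta> = "\<lambda>z :: real \<Rightarrow> 'p phase. \<lambda>t\<in>K. turn_back (z (- t))"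
  have \<theta>: "?\<theta> \<in> (\<Pi>\<^sub>M t\<in>?J. borel) \<rightarrow>\<^sub>M (\<Pi>\<^sub>M t\<in>K. borel)"
  proof (rule measurable_restrict)
    fix t assume "t \<in> K"
    then have "- t \<in> ?J" by simp
    show "(\<lambda>z. turn_back (z (- t))) \<in> borel_measurable (\<Pi>\<^sub>M t\<in>?J. (borel :: 'p phase measure))"
      by (rule measurable_compose[OF measurable_component_singleton[OF \<open>- t \<in> ?J\<close>]]) (rule turn_back_measurable)
  qed
  have f: "(\<lambda>\<omega>. \<lambda>t\<in>?J. Z t \<omega>) \<in> M \<rightarrow>\<^sub>M (\<Pi>\<^sub>M t\<in>?J. borel)"
    by (intro measurable_restrict meas)
  have g: "(\<lambda>\<omega>. \<lambda>t\<in>?J. ?B (t + m) \<omega>) \<in> ?N \<rightarrow>\<^sub>M (\<Pi>\<^sub>M t\<in>?J. borel)"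
    by (intro measurable_restrict billiard_measurable)
  have "fdd M (\<lambda>t \<omega>. turn_back (Z (- t) \<omega>)) K = distr (fdd M Z ?J) (\<Pi>\<^sub>M t\<in>K. borel) ?\<theta>"
    unfolding fdd_def distr_distr[OF \<theta> f] by (intro distr_cong) (auto simp: comp_def restrict_def)
  also have "fdd M Z ?J = fdd ?N (\<lambda>t. ?B (t + m)) ?J"
    by (rule trans[OF stationary_law[OF Z J m(1)] billiard_shifted_law[OF J m(1) order_refl, symmetric]])
  also have "distr (fdd ?N (\<lambda>t. ?B (t + m)) ?J) (\<Pi>\<^sub>M t\<in>K. borel) ?\<theta>
      = distr ?N (\<Pi>\<^sub>M t\<in>K. borel) (\<lambda>\<omega>. \<lambda>t\<in>K. turn_back (?B (m - t) \<omega>))"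
    unfolding fdd_def distr_distr[OF \<theta> g] by (intro distr_cong) (auto simp: comp_def restrict_def)
  also have "\<dots> = fdd M Z K" by (rule stationary_law[OF Z K m(2,1), symmetric])
  finally show "fdd M Z K = fdd M (\<lambda>t \<omega>. turn_back (Z (- t) \<omega>)) K" ..
qed

end

theorem theorem2p5:
  fixes D R :: "((real ^ 'm) \<times> real) set"
    and e :: "(real ^ 'm) \<times> real"
    and U :: "(real ^ 'm) \<times> real \<Rightarrow> (real ^ 'm) \<times> real \<Rightarrow> (real ^ 'm) \<times> real"
    and M :: "'w measure"
    and X V :: "real \<Rightarrow> 'w \<Rightarrow> (real ^ 'm) \<times> real"
  assumes "billiard_domain D R"
    and "bounded D"
    and "e \<in> Basis"
    and "reflection_frame D R e U"
    and "stationary_billiard D e U M (\<lambda>t \<omega>. (X t \<omega>, V t \<omega>))"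
  shows "same_law M (\<lambda>t \<omega>. (X t \<omega>, V t \<omega>)) M (\<lambda>t \<omega>. (X (- t) \<omega>, - V (- t) \<omega>))"
proof -
  interpret knudsen D R e U
    using assms by unfold_locales (auto simp: norm_Basis)
  show ?thesis using stationary_reversal[OF assms(5)] by (simp add: turn_back_def)
qed

end
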